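(* Let $Z=(Z^+,Z^-)$ be a planar piecewise vector field with switching set $\Sigma=\{y=0\}$ satisfying hypothesis (H1) stated in the context, with half-return maps $\varphi^\pm:[0,x_0)\to\mathbb{R}$, associated signs $\delta,\mu\in\{-1,1\}$, and let $Z_b(x,y)=Z^+(x-b,y)$ for $y>0$, $Z_b(x,y)=Z^-(x,y)$ for $y<0$, $b\in\mathbb{R}$. Suppose that $\varphi^\pm$ are of Dulac-type, i.e. there are $\alpha_1^\pm\in\mathbb{R}\setminus\{0\}$ and $r^\pm,\ell>0$ such that $$\varphi^\pm(x)=\alpha_1^\pm x^{r^\pm}+\mathcal{R}^\pm(x),\qquad \mathcal{R}^\pm\in\mathcal{F}^1_{r^\pm+\ell}.$$ Let $r_m=\min\{r^+,r^-\}$, $$V_1=\begin{cases}\delta\alpha_1^+, & r^+<r^-,\\ \delta(\alpha_1^+-\alpha_1^-), & r^+=r^-,\\ -\delta\alpha_1^-, & r^+>r^-,\end{cases}\qquad R=\begin{cases}1/r_m, & r_m\geqslant1,\\ 1, & r_m\leqslant1.\end{cases}$$ If $V_1\neq0$, then there is $b_0>0$ such that if $0<\mu b<b_0$, then $Z_b$ has exactly one crossing periodic orbit in a neighborhood of the origin. Furthermore, such a periodic orbit is a hyperbolic stable (resp. unstable) crossing limit cycle if $V_1<0$ (resp. $V_1>0$). If $(r^+-1)(r^--1)\geqslant0$, then its position is given by $x(b)=\xi_0\,|b|^R+o\bigl(|b|^R\bigr)$, where $$\xi_0=\begin{cases} \dfrac{1}{|V_1|^{1/r_m}}, & \text{if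 } r_m\geqslant1,\ r^+>1,\\[2mm] \dfrac{1-\alpha_1^+}{|V_1|}, & \text{if } r_m\geqslant1,\ r^+=1,\\[2mm] 1, & \text{if } r_m\leqslant1,\ r^+<1,\ r^+\neq r^-,\\[1mm] \dfrac{1-\alpha_1^+}{|\alpha_1^+|}, & \text{if } r_m\leqslant1,\ r^-<r^+=1,\\[2mm] \dfrac{|\alpha_1^+|^{1/r_m}}{\bigl||\alpha_1^+|^{1/r_m}-|\alpha_1^-|^{1/r_m}\bigr|}, & \text{if } r_m\leqslant1,\ r^-=r^+<1. \end{cases}$$ If $(r^+-1)(r^--1)<0$, then its position is given by $$x(b)=\begin{cases} b+o(b), & \text{if } \mu=1,\\ o(b), & \text{if }\mu=-1.\end{cases}$$ Moreover, in any case, for $b$ close to $0$ and after reducing $x_0$ if necessary, if $\mu b<0$, then there is no periodic orbit passing through $\Sigma_0=[0,x_0)\times\{0\}$.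
   Context: Setting. Let $\Sigma=\{(x,y)\in\mathbb{R}^2: y=0\}$ and $\Sigma^\pm=\{(x,y)\in\mathbb{R}^2:\pm y\geqslant 0\}$. Consider $Z(x,y)=Z^+(x,y)$ if $y>0$ and $Z(x,y)=Z^-(x,y)$ if $y<0$, where $Z^\pm=(P^\pm,Q^\pm)$ are well defined and locally Lipschitz on $\Sigma^\pm$. Let $\psi^\pm(t;x,y)$ be the solution of $Z^\pm$ with $\psi^\pm(0;x,y)=(x,y)$. Hypothesis (H1): there are $x_0>0$ and continuous functions $\tau^\pm:(0,x_0)\to\mathbb{R}$ such that for every $x\in(0,x_0)$: (i) $\psi^\pm(\tau^\pm(x);x,0)\in\Sigma$; (ii) $\tau^+(x)\tau^-(x)<0$; (iii) $\psi^\pm(t;x,0)\in\Sigma^\pm\setminus\Sigma$ for every $t$ in the open interval bounded by $0$ and $\tau^\pm(x)$; (iv) $\varphi^\pm(x)<0$, where $(\varphi^\pm(x),0):=\psi^\pm(\tau^\pm(x);x,0)$; (v) $\varphi^+(x)\neq\varphi^-(x)$; (vi) $\varphi^\pm$ extend continuously to $x=0$ with $\varphi^\pm(0)=0$. Signs: $\delta=1$ if $\tau^+(x)<0<\tau^-(x)$ and $\delta=-1$ if $\tau^-(x)<0<\tau^+(x)$ (independent of $x\in(0,x_0)$). Displacement function: $\Delta_0(x)=\delta(\varphi^+(x)-\varphi^-(x))$. Let $\sigma=\operatorname{sign}(\Delta_0(x))\in\{-1,1\}$ (independent of $x\in(0,x_0)$) and $\mu=-\sigma\delta$. Flat functions: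 for $\ell\in\mathbb{R}$ and $k\in\mathbb{Z}_{\geqslant0}\cup\{\infty\}$, a $C^k$ function $\mathcal{R}:(0,\varepsilon)\to\mathbb{R}$ belongs to $\mathcal{F}^k_\ell$ if for each integer $0\leqslant\nu\leqslant k$ there are $C>0$ and $\varepsilon_0>0$ with $\bigl|\frac{d^\nu\mathcal{R}}{dx^\nu}(x)\bigr|\leqslant C x^{\ell-\nu}$ for all $x\in(0,\varepsilon_0)$. Terminology: a crossing periodic orbit of $Z_b$ is a periodic orbit obtained by concatenating an orbit arc of the upper vector field $Z^+(x-b,y)$ in $\Sigma^+$ and an orbit arc of $Z^-$ in $\Sigma^-$, crossing $\Sigma$ without sliding. A limit cycle is an isolated periodic orbit; it is hyperbolic if the derivative of its first return map at the corresponding fixed point is different from $1$. The position of the limit cycle is the number $x(b)>0$ such that it passes through $(x(b),0)\in\Sigma$ (the intersection with positive abscissa near the origin). Since the arcs may be large, "in a neighborhood of the origin" refers to the intersection points of the orbit with $\Sigma$.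
   Formalization: For r^- < r^+ <= 1 the printed ξ_0 (1 if r^+<1, (1-α_1^+)/|α_1^+| if r^+=1) is false; the formal statement has ξ_0=0, i.e. x(b)=o(|b|). In the last sentence "periodic orbit" means crossing periodic orbit, since a grazing orbit through the origin may persist. *)

theory Defs
  imports "HOL-Analysis.Analysis" "HOL-Library.Landau_Symbols" "HOL-Library.Extended_Nat"
begin

type_synonym vfield = "real \<times> real \<Rightarrow> real \<times> real"

definition Sigma_line :: "(real \<times> real) set"
  where "Sigma_line = {p. snd p = 0}"

definition Sigma_up :: "(real \<times> real) set"
  where "Sigma_up = {p. snd p \<ge> 0}"

definition Sigma_down :: "(real \<times> real) set"
  where "Sigma_down = {p. snd p \<le> 0}"

definition solves_on :: "vfield \<Rightarrow> (real \<Rightarrow> real \<times> real) \<Rightarrow> real set \<Rightarrow> bool"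
  where "solves_on Z \<gamma> J \<longleftrightarrow>
    (\<forall>t\<in>J. (\<gamma> has_vector_derivative Z (\<gamma> t)) (at t within J))"

text \<open>A vector field on a closed half plane \<open>S\<close> is a total function whose values outside \<open>S\<close> are
  never used. For \<open>x \<in> (0,x0)\<close> the curve \<open>\<psi>\<close> below is the trajectory \<open>\<psi>(t;x,0)\<close> of \<open>Z\<close>, for \<open>t\<close>
  between \<open>0\<close> and \<open>\<tau> x\<close>; since \<open>Z\<close> is locally Lipschitz on \<open>S\<close>, it is unique.\<close>

definition half_return ::
    "vfield \<Rightarrow> (real \<times> real) set \<Rightarrow> real \<Rightarrow> (real \<Rightarrow> real) \<Rightarrow> (real \<Rightarrow> real) \<Rightarrow> bool"
  where "half_return Z S x0 \<tau> \<phi> \<longleftrightarrow>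
    continuous_on {0<..<x0} \<tau> \<and>
    (\<forall>x\<in>{0<..<x0}. \<exists>\<psi>.
        solves_on Z \<psi> (closed_segment 0 (\<tau> x)) \<and> \<psi> 0 = (x, 0) \<and> \<psi> (\<tau> x) = (\<phi> x, 0) \<and>
        (\<forall>t\<in>open_segment 0 (\<tau> x). \<psi> t \<in> S - Sigma_line)) \<and>
    (\<forall>x\<in>{0<..<x0}. \<phi> x < 0) \<and>
    continuous_on {0..<x0} \<phi> \<and> \<phi> 0 = 0"

definition hyp_H1 ::
    "vfield \<Rightarrow> vfield \<Rightarrow> real \<Rightarrow> (real \<Rightarrow> real) \<Rightarrow> (real \<Rightarrow> real) \<Rightarrow>
      (real \<Rightarrow> real) \<Rightarrow> (real \<Rightarrow> real) \<Rightarrow> bool"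
  where "hyp_H1 Zp Zm x0 \<tau>p \<tau>m \<phi>p \<phi>m \<longleftrightarrow>
    local_lipschitz (UNIV :: real set) Sigma_up (\<lambda>_. Zp) \<and>
    local_lipschitz (UNIV :: real set) Sigma_down (\<lambda>_. Zm) \<and>
    x0 > 0 \<and>
    half_return Zp Sigma_up x0 \<tau>p \<phi>p \<and>
    half_return Zm Sigma_down x0 \<tau>m \<phi>m \<and>
    (\<forall>x\<in>{0<..<x0}. \<tau>p x * \<tau>m x < 0) \<and>
    (\<forall>x\<in>{0<..<x0}. \<phi>p x \<noteq> \<phi>m x)"

text \<open>Under \<^const>\<open>hyp_H1\<close> the following two signs do not depend on the point of \<open>(0,x0)\<close> at which
  they are evaluated; the midpoint is used.\<close>

definition orientation_sign :: "(real \<Rightarrow> real) \<Rightarrow> real \<Rightarrow> real"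
  where "orientation_sign \<tau>p x0 = (if \<tau>p (x0 / 2) < 0 then 1 else - 1)"

definition displacement :: "real \<Rightarrow> (real \<Rightarrow> real) \<Rightarrow> (real \<Rightarrow> real) \<Rightarrow> real \<Rightarrow> real"
  where "displacement \<delta> \<phi>p \<phi>m x = \<delta> * (\<phi>p x - \<phi>m x)"

definition displacement_sign :: "real \<Rightarrow> (real \<Rightarrow> real) \<Rightarrow> (real \<Rightarrow> real) \<Rightarrow> real \<Rightarrow> real"
  where "displacement_sign \<delta> \<phi>p \<phi>m x0 = sgn (displacement \<delta> \<phi>p \<phi>m (x0 / 2))"

definition flat_functions :: "enat \<Rightarrow> real \<Rightarrow> (real \<Rightarrow> real) set"
  where "flat_functions k l = {f. \<exists>\<epsilon>>0.
    (\<forall>\<nu>. enat \<nu> < k \<longrightarrow> (deriv ^^ \<nu>) f differentiable_on {0<..<\<epsilon>}) \<and>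
    (\<forall>\<nu>. enat \<nu> \<le> k \<longrightarrow> continuous_on {0<..<\<epsilon>} ((deriv ^^ \<nu>) f)) \<and>
    (\<forall>\<nu>. enat \<nu> \<le> k \<longrightarrow>
      (\<exists>C>0. \<exists>\<epsilon>0\<in>{0<..\<epsilon>}. \<forall>x\<in>{0<..<\<epsilon>0}. \<bar>(deriv ^^ \<nu>) f x\<bar> \<le> C * x powr (l - real \<nu>)))}"

definition dulac_type :: "(real \<Rightarrow> real) \<Rightarrow> real \<Rightarrow> real \<Rightarrow> real \<Rightarrow> bool"
  where "dulac_type \<phi> \<alpha> r l \<longleftrightarrow>
    (\<exists>f\<in>flat_functions 1 (r + l). \<forall>\<^sub>F x in at_right 0. \<phi> x = \<alpha> * x powr r + f x)"

definition first_coefficient :: "real \<Rightarrow> real \<Rightarrow> real \<Rightarrow> real \<Rightarrow> real \<Rightarrow> real"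
  where "first_coefficient \<delta> \<alpha>p \<alpha>m rp rm =
    (if rp < rm then \<delta> * \<alpha>p else if rp = rm then \<delta> * (\<alpha>p - \<alpha>m) else - \<delta> * \<alpha>m)"

definition position_exponent :: "real \<Rightarrow> real \<Rightarrow> real"
  where "position_exponent rp rm = (if min rp rm \<ge> 1 then 1 / min rp rm else 1)"

text \<open>Here \<open>rm\<close> is the exponent of \<open>\<phi>m\<close>, not the minimal one. The value \<open>0\<close> for
  \<open>rm < rp \<le> 1\<close> corrects the source, which has \<open>1\<close> for \<open>rm < rp < 1\<close> and
  \<open>(1 - \<alpha>p) / \<bar>\<alpha>p\<bar>\<close> for \<open>rm < rp = 1\<close>. For example, the half-return maps \<open>\<phi>p x = - x\<close> and
  \<open>\<phi>m x = - sqrt x\<close>, realised by the fields \<open>(1, - 2 * x)\<close> and \<open>(- 1, - h' x)\<close> with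
  \<open>h x = x^4\<close> for \<open>x \<ge> 0\<close> and \<open>h x = x^8\<close> for \<open>x \<le> 0\<close>, give the equation
  \<open>2 * b - x = - sqrt x\<close>, hence a position \<open>x \<sim> 4 * b\<^sup>2\<close> and not \<open>x \<sim> 2 * \<bar>b\<bar>\<close>.\<close>

definition position_coefficient :: "real \<Rightarrow> real \<Rightarrow> real \<Rightarrow> real \<Rightarrow> real \<Rightarrow> real"
  where "position_coefficient V1 \<alpha>p \<alpha>m rp rm =
    (if min rp rm \<ge> 1 \<and> rp > 1 then 1 / \<bar>V1\<bar> powr (1 / min rp rm)
     else if min rp rm \<ge> 1 \<and> rp = 1 then (1 - \<alpha>p) / \<bar>V1\<bar>
     else if rp < 1 \<and> rp < rm then 1
     else if rp < 1 \<and> rp = rm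
       then \<bar>\<alpha>p\<bar> powr (1 / min rp rm)
              / \<bar>\<bar>\<alpha>p\<bar> powr (1 / min rp rm) - \<bar>\<alpha>m\<bar> powr (1 / min rp rm)\<bar>
     else 0)"

definition shift_x :: "real \<Rightarrow> vfield \<Rightarrow> vfield"
  where "shift_x b Z = (\<lambda>(x, y). Z (x - b, y))"

definition half_arc :: "vfield \<Rightarrow> (real \<times> real) set \<Rightarrow> real \<Rightarrow> (real \<Rightarrow> real \<times> real) \<Rightarrow> bool"
  where "half_arc Z S T \<gamma> \<longleftrightarrow>
    T > 0 \<and> solves_on Z \<gamma> {0..T} \<and> \<gamma> 0 \<in> Sigma_line \<and> \<gamma> T \<in> Sigma_line \<and>
    (\<forall>t\<in>{0<..<T}. \<gamma> t \<in> S - Sigma_line)"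

text \<open>The orbit goes from \<open>y < 0\<close> to \<open>y > 0\<close> at one of its two points on \<^const>\<open>Sigma_line\<close> and back
  at the other, spending no time on the line. At both points the second components of the two
  fields therefore have no opposite strict signs, so neither point is a sliding or escaping point.\<close>

definition crossing_periodic_orbit :: "vfield \<Rightarrow> vfield \<Rightarrow> (real \<times> real) set \<Rightarrow> bool"
  where "crossing_periodic_orbit Xp Xm \<Gamma> \<longleftrightarrow>
    (\<exists>Tp \<gamma>p Tm \<gamma>m. half_arc Xp Sigma_up Tp \<gamma>p \<and> half_arc Xm Sigma_down Tm \<gamma>m \<and>
       \<gamma>p Tp = \<gamma>m 0 \<and> \<gamma>m Tm = \<gamma>p 0 \<and> \<Gamma> = \<gamma>p ` {0..Tp} \<union> \<gamma>m ` {0..Tm})"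

definition crossing_limit_cycle :: "vfield \<Rightarrow> vfield \<Rightarrow> (real \<times> real) set \<Rightarrow> bool"
  where "crossing_limit_cycle Xp Xm \<Gamma> \<longleftrightarrow>
    crossing_periodic_orbit Xp Xm \<Gamma> \<and>
    (\<exists>U. open U \<and> \<Gamma> \<subseteq> U \<and> (\<forall>\<Gamma>'. crossing_periodic_orbit Xp Xm \<Gamma>' \<and> \<Gamma>' \<subseteq> U \<longrightarrow> \<Gamma>' = \<Gamma>))"

definition connects :: "vfield \<Rightarrow> (real \<times> real) set \<Rightarrow> real \<Rightarrow> real \<Rightarrow> bool"
  where "connects Z S u v \<longleftrightarrow> (\<exists>T \<gamma>. half_arc Z S T \<gamma> \<and> \<gamma> 0 = (u, 0) \<and> \<gamma> T = (v, 0))"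

text \<open>The forward trajectory of \<open>(u,0)\<close> crosses \<^const>\<open>Sigma_line\<close> once on the opposite side before
  it comes back to a section around \<open>(u,0)\<close>, hence two consecutive arcs. Both orders are needed:
  whether the lower or the upper arc comes first depends on the orientation of the trajectories.\<close>

definition first_return :: "vfield \<Rightarrow> vfield \<Rightarrow> real \<Rightarrow> real \<Rightarrow> bool"
  where "first_return Xp Xm u w \<longleftrightarrow>
    (\<exists>v. connects Xm Sigma_down u v \<and> connects Xp Sigma_up v w) \<or>
    (\<exists>v. connects Xp Sigma_up u v \<and> connects Xm Sigma_down v w)"

definition return_map :: "vfield \<Rightarrow> vfield \<Rightarrow> real \<Rightarrow> real"
  where "return_map Xp Xm u = (THE w. first_return Xp Xm u w)"

definition hyperbolic_cycle_at :: "vfield \<Rightarrow> vfield \<Rightarrow> real \<Rightarrow> bool"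
  where "hyperbolic_cycle_at Xp Xm x \<longleftrightarrow>
    (\<forall>\<^sub>F u in nhds x. \<exists>!w. first_return Xp Xm u w) \<and> return_map Xp Xm x = x \<and>
    (\<exists>D. (return_map Xp Xm has_real_derivative D) (at x) \<and> D \<noteq> 1)"

text \<open>Asymptotic stability of the fixed point \<open>x\<close> of the return map, and repulsion from it.\<close>

definition stable_cycle_at :: "vfield \<Rightarrow> vfield \<Rightarrow> real \<Rightarrow> bool"
  where "stable_cycle_at Xp Xm x \<longleftrightarrow>
    (\<forall>\<^sub>F u in nhds x. \<exists>!w. first_return Xp Xm u w) \<and>
    (\<forall>\<epsilon>>0. \<forall>\<^sub>F u in nhds x. \<forall>n. \<bar>(return_map Xp Xm ^^ n) u - x\<bar> < \<epsilon>) \<and>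
    (\<forall>\<^sub>F u in nhds x. (\<lambda>n. (return_map Xp Xm ^^ n) u) \<longlonglongrightarrow> x)"

definition unstable_cycle_at :: "vfield \<Rightarrow> vfield \<Rightarrow> real \<Rightarrow> bool"
  where "unstable_cycle_at Xp Xm x \<longleftrightarrow>
    (\<exists>\<epsilon>>0. (\<forall>u. \<bar>u - x\<bar> < \<epsilon> \<longrightarrow> (\<exists>!w. first_return Xp Xm u w)) \<and>
      (\<forall>u. 0 < \<bar>u - x\<bar> \<and> \<bar>u - x\<bar> < \<epsilon> \<longrightarrow> (\<exists>n. \<bar>(return_map Xp Xm ^^ n) u - x\<bar> \<ge> \<epsilon>)))"

end

theory Submission
  imports Defs
begin

text \<open>Uniqueness of trajectories and the impossibility of reaching an inward point of the line in
  finite time show that the arcs with end points near the origin are exactly those given by the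
  half-return maps, up to loops at the origin. Hence the crossing periodic orbits of \<open>Z_b\<close> near
  the origin correspond to the solutions \<open>u > max 0 b\<close> of \<open>\<phi>m u = b + \<phi>p (u - b)\<close>. For
  \<open>\<mu> * b < 0\<close> monotonicity excludes them.

  For \<open>\<mu> = 1\<close> put \<open>f = - \<phi>p\<close>, \<open>g = - \<phi>m\<close>, \<open>w = u - b\<close>; for \<open>\<mu> = - 1\<close> put \<open>f = - \<phi>m\<close>,
  \<open>g = - \<phi>p\<close>, \<open>w = u\<close> and replace \<open>b\<close> by \<open>- b\<close>. In both cases \<open>b > 0\<close>, \<open>f\<close> dominates \<open>g\<close> and the
  equation reads \<open>f w = b + g (w + b)\<close>. Wherever \<open>g (w + b) \<le> f w\<close> one has
  \<open>g' (w + b) < f' w\<close>. This gives uniqueness and decides on which side of \<open>1\<close> the derivative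
  of the return map lies, because that derivative is the quotient of the two slopes. The position
  follows from the leading terms of \<open>f\<close> and \<open>g\<close>.\<close>

section \<open>Orbit arcs in a half plane\<close>

text \<open>The obstacle is low regularity. The fields may be tangent to the line and are merely
  Lipschitz, so the half-return maps are not differentiated through the flow: all slopes come from
  the Dulac expansions, and the return map is handled as an implicit relation between the two
  half-return maps. What survives at every exponent is scale invariant:
  \<open>x * h' x / h x\<close> tends to the exponent. The slopes to be compared belong to two
  different points w and w + b, which need not be close on the scale of w; a factor K > 1, available
  because the leading terms are strictly ordered, absorbs this.

  The half-return maps do not describe loops based at the origin. A lower loop has its base at (0,
  0) and an upper loop at (b, 0); for b \<noteq> 0 neither can be completed to a periodic orbit near
  the origin, because the remaining arc would have to be a loop at a point where there is none. This
  is where b \<noteq> 0 is used.\<close>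

lemma solves_on_subset: "solves_on Z \<gamma> J \<Longrightarrow> K \<subseteq> J \<Longrightarrow> solves_on Z \<gamma> K"
  unfolding solves_on_def by (meson has_vector_derivative_within_subset subsetD)

lemma solves_on_imp_continuous_on: "solves_on Z \<gamma> J \<Longrightarrow> continuous_on J \<gamma>"
  unfolding solves_on_def
  by (meson continuous_on_eq_continuous_within has_vector_derivative_continuous)

text \<open>Integrating factor for two Gronwall arguments: the squared distance of two solutions,
  and the height of a trajectory above the line.\<close>

lemma has_real_derivative_times_exp:
  assumes "(n has_real_derivative D) (at t within A)"
  shows "((\<lambda>t. n t * exp (c * t)) has_real_derivative (D + c * n t) * exp (c * t)) (at t within A)"
  using assms by (auto intro!: derivative_eq_intros simp: algebra_simps)

text \<open>Gronwall: with L a Lipschitz constant on the two trajectories, the squared distance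
  times \<open>exp (- 2 * L * t)\<close> does not increase, and it starts at 0.\<close>

lemma solves_on_unique:
  fixes S :: "(real \<times> real) set"
  assumes lip: "local_lipschitz (UNIV :: real set) S (\<lambda>_. Z)"
    and sol: "solves_on Z \<gamma> {0..a}" "solves_on Z \<gamma>' {0..a}"
    and inS: "\<And>t. t \<in> {0..a} \<Longrightarrow> \<gamma> t \<in> S" "\<And>t. t \<in> {0..a} \<Longrightarrow> \<gamma>' t \<in> S"
    and init: "\<gamma> 0 = \<gamma>' 0" and t: "t \<in> {0..a}"
  shows "\<gamma> t = \<gamma>' t"
proof -
  \<comment> \<open>Both trajectories stay in S, so a Lipschitz constant on this compact subset of S
    suffices; the field is never evaluated outside its half plane.\<close>
  let ?K = "\<gamma> ` {0..a} \<union> \<gamma>' ` {0..a}"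
  have K: "compact ?K" "?K \<subseteq> S"
    using inS solves_on_imp_continuous_on[OF sol(1)] solves_on_imp_continuous_on[OF sol(2)]
    by (auto intro!: compact_Un compact_continuous_image)
  have "local_lipschitz {0::real} ?K (\<lambda>_. Z)"
    by (rule local_lipschitz_subset[OF lip _ K(2)]) simp
  then obtain L where "\<And>s. s \<in> {0::real} \<Longrightarrow> L-lipschitz_on ?K Z"
    by (rule local_lipschitz_compact_implies_lipschitz[OF _ K(1)]) auto
  then have lipK: "L-lipschitz_on ?K Z" by simp
  let ?d = "\<lambda>t. \<gamma> t - \<gamma>' t"
  let ?e = "\<lambda>t. (?d t \<bullet> ?d t) * exp (- 2 * L * t)"
  have der: "(?e has_real_derivative
      (2 * (?d s \<bullet> (Z (\<gamma> s) - Z (\<gamma>' s))) + - 2 * L * (?d s \<bullet> ?d s)) * exp (- 2 * L * s))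
      (at s within {0..a})" if s: "s \<in> {0..a}" for s
  proof -
    have dv: "(?d has_vector_derivative Z (\<gamma> s) - Z (\<gamma>' s)) (at s within {0..a})"
      using sol s unfolding solves_on_def by (intro has_vector_derivative_diff) auto
    have "((\<lambda>t. ?d t \<bullet> ?d t) has_vector_derivative
        2 * (?d s \<bullet> (Z (\<gamma> s) - Z (\<gamma>' s)))) (at s within {0..a})"
      using bounded_bilinear.has_vector_derivative[OF bounded_bilinear_inner dv dv]
      by (simp add: inner_commute)
    then have "((\<lambda>t. ?d t \<bullet> ?d t) has_real_derivative
        2 * (?d s \<bullet> (Z (\<gamma> s) - Z (\<gamma>' s)))) (at s within {0..a})"
      by (simp add: has_real_derivative_iff_has_vector_derivative)
    then show ?thesis by (rule has_real_derivative_times_exp)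
  qed
  have nonpos: "(2 * (?d s \<bullet> (Z (\<gamma> s) - Z (\<gamma>' s))) + - 2 * L * (?d s \<bullet> ?d s)) * exp (- 2 * L * s) \<le> 0"
    if s: "s \<in> {0..a}" for s
  proof -
    have "?d s \<bullet> (Z (\<gamma> s) - Z (\<gamma>' s)) \<le> norm (?d s) * norm (Z (\<gamma> s) - Z (\<gamma>' s))"
      by (rule norm_cauchy_schwarz)
    also have "\<dots> \<le> norm (?d s) * (L * norm (?d s))"
      using lipschitz_on_normD[OF lipK, of "\<gamma> s" "\<gamma>' s"] s by (intro mult_left_mono) auto
    also have "\<dots> = L * (?d s \<bullet> ?d s)"
      by (simp add: dot_square_norm power2_eq_square)
    finally show ?thesis by (simp add: mult_nonpos_nonneg)
  qed
  have "?e t \<le> ?e 0"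
  proof (rule DERIV_nonpos_imp_decreasing_open[of 0 t])
    show "0 \<le> t" using t by simp
    show "\<exists>y. (?e has_real_derivative y) (at s) \<and> y \<le> 0" if "0 < s" "s < t" for s
    proof -
      have "(?e has_real_derivative
        (2 * (?d s \<bullet> (Z (\<gamma> s) - Z (\<gamma>' s))) + - 2 * L * (?d s \<bullet> ?d s)) * exp (- 2 * L * s)) (at s)"
        using der[of s] that t by (simp add: at_within_Icc_at)
      moreover have "s \<in> {0..a}" using that t by simp
      ultimately show ?thesis using nonpos by blast
    qed
    have "continuous_on {0..a} ?e"
      unfolding continuous_on_eq_continuous_within using der DERIV_continuous by blast
    then show "continuous_on {0..t} ?e" by (rule continuous_on_subset) (use t in auto)
  qed
  then have "(?d t \<bullet> ?d t) * exp (- 2 * L * t) \<le> 0" using init by simp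
  then have "?d t \<bullet> ?d t \<le> 0" by (simp add: mult_le_0_iff)
  then have "?d t = 0" by (meson inner_gt_zero_iff not_less)
  then show ?thesis by simp
qed

lemma half_arc_in:
  assumes "half_arc Z S T \<gamma>" "Sigma_line \<subseteq> S" "t \<in> {0..T}"
  shows "\<gamma> t \<in> S"
  using assms unfolding half_arc_def
  by (metis DiffD1 atLeastAtMost_iff greaterThanLessThan_iff order_less_le subsetD)

text \<open>The durations must agree: when the shorter arc is back on the line, the longer one would
  still be strictly inside the half plane, although the two coincide up to that time.\<close>

lemma half_arc_unique:
  assumes lip: "local_lipschitz (UNIV :: real set) S (\<lambda>_. Z)" and S: "Sigma_line \<subseteq> S"
    and arcs: "half_arc Z S T \<gamma>" "half_arc Z S T' \<gamma>'" and init: "\<gamma> 0 = \<gamma>' 0"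
  shows "T = T'" and "\<And>t. t \<in> {0..T} \<Longrightarrow> \<gamma> t = \<gamma>' t"
proof -
  have eq: "\<gamma> t = \<gamma>' t" if "t \<in> {0..min T T'}" for t
  proof (rule solves_on_unique[where a = "min T T'" and \<gamma> = \<gamma> and \<gamma>' = \<gamma>', OF lip _ _ _ _ init that])
    show "solves_on Z \<gamma> {0..min T T'}" "solves_on Z \<gamma>' {0..min T T'}"
      using arcs unfolding half_arc_def by (auto intro: solves_on_subset)
  qed (use half_arc_in[OF _ S] arcs in auto)
  have ne: "\<gamma> T \<noteq> \<gamma>' T" if "T < T'"
    using arcs that unfolding half_arc_def by (metis Diff_iff greaterThanLessThan_iff)
  have ne': "\<gamma> T' \<noteq> \<gamma>' T'" if "T' < T"
    using arcs that unfolding half_arc_def by (metis Diff_iff greaterThanLessThan_iff)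
  have pos: "T > 0" "T' > 0" using arcs by (auto simp: half_arc_def)
  show TT: "T = T'"
  proof (cases T T' rule: linorder_cases)
    case less
    then show ?thesis using ne eq[of T] pos(1) by simp
  next
    case greater
    then show ?thesis using ne' eq[of T'] pos(2) by simp
  qed
  show "\<And>t. t \<in> {0..T} \<Longrightarrow> \<gamma> t = \<gamma>' t" using eq unfolding TT by simp
qed

lemma half_arc_reverse:
  assumes "half_arc Z S T \<gamma>"
  shows "half_arc (\<lambda>p. - Z p) S T (\<lambda>t. \<gamma> (T - t))"
proof -
  have T: "T > 0" using assms by (simp add: half_arc_def)
  have im: "(\<lambda>t. T - t) ` {0..T} = {0..T}" by (auto simp: image_iff intro!: bexI[of _ "T - _"])
  have "((\<lambda>t. \<gamma> (T - t)) has_vector_derivative - Z (\<gamma> (T - t))) (at t within {0..T})"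
    if "t \<in> {0..T}" for t
  proof -
    have "((\<lambda>t. T - t) has_vector_derivative - 1) (at t within {0..T})"
      by (auto intro!: derivative_eq_intros)
    moreover have "(\<gamma> has_vector_derivative Z (\<gamma> (T - t))) (at (T - t) within (\<lambda>t. T - t) ` {0..T})"
      using assms that unfolding im half_arc_def solves_on_def by auto
    ultimately show ?thesis
      using vector_diff_chain_within by (fastforce simp: o_def)
  qed
  then show ?thesis using assms unfolding half_arc_def solves_on_def by auto
qed

text \<open>Time reversal turns every statement about starting points into one about end points, so
  each of them is proved in one direction only.\<close>

lemma connects_reverse: "connects (\<lambda>p. - Z p) S v u \<longleftrightarrow> connects Z S u v"
proof -
  have 1: "connects (\<lambda>p. - Z p) S v u" if "connects Z S u v" for Z u v
    using that half_arc_reverse[of Z S] unfolding connects_def by fastforce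
  show ?thesis using 1[of Z u v] 1[of "\<lambda>p. - Z p" v u] by auto
qed

section \<open>Translated fields and uniqueness of the end points of an arc\<close>

lemma half_arc_shift:
  assumes "S = Sigma_up \<or> S = Sigma_down"
  shows "half_arc (shift_x b Z) S T \<gamma> \<longleftrightarrow> half_arc Z S T (\<lambda>t. \<gamma> t - (b, 0))"
proof -
  have "((\<lambda>t. \<gamma> t - (b, 0)) has_vector_derivative D) F \<longleftrightarrow> (\<gamma> has_vector_derivative D) F" for D F
  proof
    assume "((\<lambda>t. \<gamma> t - (b, 0)) has_vector_derivative D) F"
    from has_vector_derivative_add[OF this has_vector_derivative_const[of "(b,0)"]]
    show "(\<gamma> has_vector_derivative D) F" by simp
  next
    assume "(\<gamma> has_vector_derivative D) F"
    from has_vector_derivative_diff[OF this has_vector_derivative_const[of "(b,0)"]]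
    show "((\<lambda>t. \<gamma> t - (b, 0)) has_vector_derivative D) F" by simp
  qed
  moreover have "shift_x b Z p = Z (p - (b, 0))" for p
    by (cases p) (simp add: shift_x_def)
  moreover have "p - (b, 0) \<in> Sigma_line \<longleftrightarrow> p \<in> Sigma_line" "p - (b, 0) \<in> S \<longleftrightarrow> p \<in> S" for p
    using assms by (auto simp: Sigma_line_def Sigma_up_def Sigma_down_def)
  ultimately show ?thesis unfolding half_arc_def solves_on_def by simp
qed

lemma connects_shift:
  assumes "S = Sigma_up \<or> S = Sigma_down"
  shows "connects (shift_x b Z) S u v \<longleftrightarrow> connects Z S (u - b) (v - b)"
proof
  assume "connects (shift_x b Z) S u v"
  then obtain T \<gamma> where "half_arc (shift_x b Z) S T \<gamma>" "\<gamma> 0 = (u, 0)" "\<gamma> T = (v, 0)"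
    unfolding connects_def by auto
  then show "connects Z S (u - b) (v - b)"
    using half_arc_shift[OF assms] unfolding connects_def
    by (intro exI[of _ T] exI[of _ "\<lambda>t. \<gamma> t - (b, 0)"]) auto
next
  assume "connects Z S (u - b) (v - b)"
  then obtain T \<gamma> where "half_arc Z S T \<gamma>" "\<gamma> 0 = (u - b, 0)" "\<gamma> T = (v - b, 0)"
    unfolding connects_def by auto
  then show "connects (shift_x b Z) S u v"
    using half_arc_shift[OF assms, of b Z T "\<lambda>t. \<gamma> t + (b, 0)"] unfolding connects_def
    by (intro exI[of _ T] exI[of _ "\<lambda>t. \<gamma> t + (b, 0)"]) auto
qed

lemma connects_unique_end:
  assumes "local_lipschitz (UNIV :: real set) S (\<lambda>_. Z)" "Sigma_line \<subseteq> S"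
    and "connects Z S u v" "connects Z S u v'"
  shows "v = v'"
proof -
  obtain T \<gamma> T' \<gamma>' where *: "half_arc Z S T \<gamma>" "\<gamma> 0 = (u, 0)" "\<gamma> T = (v, 0)"
    "half_arc Z S T' \<gamma>'" "\<gamma>' 0 = (u, 0)" "\<gamma>' T' = (v', 0)"
    using assms(3,4) unfolding connects_def by auto
  then have "T = T'" "\<gamma> T = \<gamma>' T"
    using half_arc_unique[OF assms(1,2) *(1) *(4)] by (auto simp: half_arc_def)
  with * show ?thesis by simp
qed

lemma local_lipschitz_uminus:
  fixes S :: "(real \<times> real) set" and Z :: vfield
  assumes "local_lipschitz (UNIV :: real set) S (\<lambda>_. Z)"
  shows "local_lipschitz (UNIV :: real set) S (\<lambda>_ p. - Z p)"
  using assms unfolding local_lipschitz_def lipschitz_on_def by (simp add: dist_minus)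

lemma connects_unique_start:
  assumes "local_lipschitz (UNIV :: real set) S (\<lambda>_. Z)" "Sigma_line \<subseteq> S"
    and "connects Z S u v" "connects Z S u' v"
  shows "u = u'"
  using connects_unique_end[OF local_lipschitz_uminus[OF assms(1)] assms(2)] assms(3,4)
  by (metis connects_reverse)

text \<open>If the field points into the half plane along the line near \<open>u\<close>, the height \<open>y\<close> of a
  trajectory satisfies \<open>y' \<ge> - L * y\<close> there, so it cannot reach \<open>(u, 0)\<close> in finite time.\<close>

lemma no_connects_to_inward_point:
  assumes lip: "local_lipschitz (UNIV :: real set) S (\<lambda>_. Z)"
    and S: "S = {p. 0 \<le> s * snd p}" and s: "\<bar>s\<bar> = 1"
    and inward: "\<forall>\<^sub>F x in nhds u. 0 \<le> s * snd (Z (x, 0))"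
  shows "\<not> connects Z S v u"
proof
  assume "connects Z S v u"
  then obtain T \<gamma> where arc: "half_arc Z S T \<gamma>" and end_u: "\<gamma> T = (u, 0)"
    unfolding connects_def by auto
  have T: "T > 0" and sol: "solves_on Z \<gamma> {0..T}"
    and inside: "\<And>t. t \<in> {0<..<T} \<Longrightarrow> \<gamma> t \<in> S - Sigma_line"
    using arc by (auto simp: half_arc_def)
  have uS: "(u, 0) \<in> S" using S by simp
  obtain r L where r: "r > 0"
    and L0: "\<And>t. t \<in> cball (0 :: real) r \<inter> UNIV \<Longrightarrow> L-lipschitz_on (cball (u, 0) r \<inter> S) Z"
    by (rule local_lipschitzE[OF lip UNIV_I[of 0] uS]) (rule that)
  have L: "L-lipschitz_on (cball (u, 0) r \<inter> S) Z" using L0[of 0] r by simp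
  obtain d where d: "d > 0" and dn: "\<And>x. \<bar>x - u\<bar> < d \<Longrightarrow> 0 \<le> s * snd (Z (x, 0))"
    using inward unfolding eventually_nhds_metric dist_real_def by auto
  have "(\<gamma> \<longlongrightarrow> \<gamma> T) (at T within {0..T})"
    using solves_on_imp_continuous_on[OF sol] T
    by (simp add: continuous_on_def)
  then have "\<forall>\<^sub>F t in at T within {0..T}. dist (\<gamma> t) (u, 0) < min r d"
    using r d end_u by (intro tendstoD) auto
  then obtain h where h: "h > 0"
    and hn: "\<And>t. t \<in> {0..T} \<Longrightarrow> t \<noteq> T \<Longrightarrow> dist t T < h \<Longrightarrow> dist (\<gamma> t) (u, 0) < min r d"
    unfolding eventually_at by auto
  \<comment> \<open>A time strictly inside the arc from which on the trajectory is so close to (u,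
    0) that both the Lipschitz bound and the inward condition at its foot on the line apply.\<close>
  define a where "a = max (T / 2) (T - h / 2)"
  have a: "0 < a" "a < T" using T h by (auto simp: a_def)
  have near: "dist (\<gamma> t) (u, 0) < min r d" if "a \<le> t" "t < T" for t
    using that a h by (intro hn) (auto simp: dist_real_def a_def)
  let ?y = "\<lambda>t. s * snd (\<gamma> t)"
  let ?e = "\<lambda>t. ?y t * exp (L * t)"
  have "?e a \<le> ?e T"
  proof (rule DERIV_nonneg_imp_increasing_open[of a T])
    show "a \<le> T" using a by simp
    show "\<exists>D. (?e has_real_derivative D) (at t) \<and> 0 \<le> D" if "a < t" "t < T" for t
    proof (intro exI conjI)
      have t: "t \<in> {0..T}" "at t within {0..T} = at t"
        using that a by (auto intro!: at_within_Icc_at)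
      then have "(\<gamma> has_vector_derivative Z (\<gamma> t)) (at t)"
        using sol unfolding solves_on_def by metis
      then have "((\<lambda>t. snd (\<gamma> t)) has_vector_derivative snd (Z (\<gamma> t))) (at t)"
        by (rule bounded_linear.has_vector_derivative[OF bounded_linear_snd])
      then have "((\<lambda>t. snd (\<gamma> t)) has_real_derivative snd (Z (\<gamma> t))) (at t)"
        by (simp add: has_real_derivative_iff_has_vector_derivative)
      then show "(?e has_real_derivative (s * snd (Z (\<gamma> t)) + L * ?y t) * exp (L * t)) (at t)"
        by (intro has_real_derivative_times_exp DERIV_cmult)
      have y: "0 \<le> ?y t" using inside[of t] that a S by auto
      obtain x z where xz: "\<gamma> t = (x, z)" by fastforce
      have dist: "dist (x, z) (u, 0) < min r d" using near[of t] that xz by simp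
      have "dist x u \<le> dist (x, z) (u, 0)" using dist_fst_le[of "(x, z)" "(u, 0)"] by simp
      then have "dist x u < min r d" using dist by linarith
      then have x: "\<bar>x - u\<bar> < d" "dist (x, 0 :: real) (u, 0) \<le> r"
        by (simp_all add: dist_real_def dist_Pair_Pair)
      \<comment> \<open>Comparison with the foot (x, 0): there the normal component has the right
        sign, and the Lipschitz bound makes the change at most L times the height.\<close>
      have "norm (Z (x, z) - Z (x, 0)) \<le> L * norm ((x, z) - (x, 0 :: real))"
      proof (rule lipschitz_on_normD[OF L])
        show "(x, z) \<in> cball (u, 0) r \<inter> S" using dist y xz S by (simp add: dist_commute)
        show "(x, 0) \<in> cball (u, 0) r \<inter> S" using x S by (simp add: dist_commute)
      qed
      moreover have "norm ((x, z) - (x, 0 :: real)) = ?y t"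
        using y xz s by (auto simp: norm_Pair abs_if split: if_splits)
      moreover have "\<bar>s * snd (Z (x, z) - Z (x, 0))\<bar> \<le> norm (Z (x, z) - Z (x, 0))"
      proof -
        have "norm (snd p) \<le> norm p" for p :: "real \<times> real" by (metis norm_snd_le prod.collapse)
        from this[of "Z (x, z) - Z (x, 0)"] show ?thesis using s by (simp add: abs_mult)
      qed
      ultimately have "\<bar>s * snd (Z (x, z)) - s * snd (Z (x, 0))\<bar> \<le> L * ?y t"
        by (simp add: right_diff_distrib)
      then have "0 \<le> s * snd (Z (\<gamma> t)) + L * ?y t"
        using dn[OF x(1)] xz by simp
      then show "0 \<le> (s * snd (Z (\<gamma> t)) + L * ?y t) * exp (L * t)" by simp
    qed
    have "continuous_on {a..T} \<gamma>"
      by (rule continuous_on_subset[OF solves_on_imp_continuous_on[OF sol]]) (use a in auto)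
    then show "continuous_on {a..T} ?e" by (intro continuous_intros)
  qed
  then have "?y a \<le> 0" using end_u by (simp add: mult_le_0_iff)
  moreover have "0 \<le> ?y a" "?y a \<noteq> 0"
    using inside[of a] a S s by (auto simp: Sigma_line_def)
  ultimately show False by simp
qed

text \<open>The height vanishes at the start and is nonnegative afterwards, so its one-sided
  derivative, the normal component of the field, is nonnegative. Tangency remains possible, hence
  the weak inequality.\<close>

lemma connects_start_inward:
  assumes "connects Z S u v" and S: "S = {p. 0 \<le> s * snd p}"
  shows "0 \<le> s * snd (Z (u, 0))"
proof -
  obtain T \<gamma> where arc: "half_arc Z S T \<gamma>" and start: "\<gamma> 0 = (u, 0)"
    using assms unfolding connects_def by auto
  have T: "T > 0" using arc by (auto simp: half_arc_def)
  have "(\<gamma> has_vector_derivative Z (u, 0)) (at 0 within {0..T})"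
    using arc start T unfolding half_arc_def solves_on_def by force
  then have "((\<lambda>t. snd (\<gamma> t)) has_vector_derivative snd (Z (u, 0))) (at 0 within {0..T})"
    by (rule bounded_linear.has_vector_derivative[OF bounded_linear_snd])
  then have "((\<lambda>t. snd (\<gamma> t)) has_real_derivative snd (Z (u, 0))) (at 0 within {0..T})"
    by (simp add: has_real_derivative_iff_has_vector_derivative)
  then have "((\<lambda>t. s * snd (\<gamma> t)) has_real_derivative s * snd (Z (u, 0))) (at 0 within {0..T})"
    by (rule DERIV_cmult)
  then have "((\<lambda>t. (s * snd (\<gamma> t) - s * snd (\<gamma> 0)) / (t - 0)) \<longlongrightarrow> s * snd (Z (u, 0)))
      (at 0 within {0..T})"
    by (simp only: has_field_derivative_iff)
  then show ?thesis
  proof (rule tendsto_lowerbound)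
    show "\<forall>\<^sub>F t in at 0 within {0..T}. 0 \<le> (s * snd (\<gamma> t) - s * snd (\<gamma> 0)) / (t - 0)"
    proof -
      have line: "Sigma_line \<subseteq> S" using S by (auto simp: Sigma_line_def)
      have "0 \<le> s * snd (\<gamma> t)" if "t \<in> {0..T}" for t
        using half_arc_in[OF arc line that] S by simp
      then show ?thesis using start
        by (auto simp: eventually_at_filter intro!: always_eventually divide_nonneg_nonneg)
    qed
    show "at 0 within {0..T} \<noteq> bot"
      using T by (simp add: at_within_Icc_at_right)
  qed
qed

text \<open>What is kept of a field for the study of crossings. The first argument of C is the one
  at which \<phi> is evaluated; for a half-return map with negative time, C is the converse of
  \<open>connects\<close>. The last two conditions forbid arcs traversed the wrong way: none may
  arrive at u, none may leave from \<open>\<phi> u\<close>. Arcs with an end at 0 are left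
  undetermined.\<close>

definition arc_relation :: "(real \<Rightarrow> real \<Rightarrow> bool) \<Rightarrow> real \<Rightarrow> (real \<Rightarrow> real) \<Rightarrow> bool"
  where "arc_relation C a \<phi> \<longleftrightarrow>
    continuous_on {0..<a} \<phi> \<and> strict_antimono_on {0..<a} \<phi> \<and> \<phi> 0 = 0 \<and>
    (\<forall>u\<in>{0<..<a}. \<forall>v. (C u v \<longleftrightarrow> v = \<phi> u) \<and> (C v (\<phi> u) \<longleftrightarrow> v = u) \<and> \<not> C v u \<and> \<not> C (\<phi> u) v)"

text \<open>If \<phi> did not decrease from x to y, the intermediate value theorem on [0, x] would
  give the value \<open>\<phi> y\<close> a second preimage z \<le> x, against injectivity.\<close>

lemma strict_antimono_on_of_inj_neg:
  fixes \<phi> :: "real \<Rightarrow> real"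
  assumes cont: "continuous_on {0..<a} \<phi>" and "\<phi> 0 = 0"
    and neg: "\<And>x. x \<in> {0<..<a} \<Longrightarrow> \<phi> x < 0" and inj: "inj_on \<phi> {0<..<a}"
  shows "strict_antimono_on {0..<a} \<phi>"
proof (rule monotone_onI)
  fix x y assume xy: "x \<in> {0..<a}" "y \<in> {0..<a}" "x < y"
  show "\<phi> x > \<phi> y"
  proof (rule ccontr)
    assume "\<not> \<phi> x > \<phi> y"
    then have le: "\<phi> x \<le> \<phi> y" by simp
    have "\<phi> y < 0" using neg xy by auto
    then have x: "0 < x" using le assms(2) xy by (cases "x = 0") auto
    have "continuous_on {0..x} \<phi>" by (rule continuous_on_subset[OF cont]) (use xy in auto)
    then obtain z where "0 \<le> z" "z \<le> x" "\<phi> z = \<phi> y"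
      using IVT2'[of \<phi> x "\<phi> y" 0] le \<open>\<phi> y < 0\<close> assms(2) x by (metis less_eq_real_def)
    moreover from this have "z \<noteq> 0" using \<open>\<phi> y < 0\<close> assms(2) by auto
    ultimately have "z \<in> {0<..<a}" "y \<in> {0<..<a}" "\<phi> z = \<phi> y" using xy x by auto
    then have "z = y" using inj by (meson inj_onD)
    then show False using \<open>z \<le> x\<close> xy by simp
  qed
qed

text \<open>Uniqueness of starting points makes \<phi> injective, hence decreasing. All points near
  u start arcs, so the field is inward along the line there and no arc can end at u. The end points
  \<open>\<phi> z\<close> fill a neighbourhood of \<open>\<phi> u\<close>, so the same argument for
  the reversed field shows that no arc starts there.\<close>

lemma arc_relation_connects:
  assumes lip: "local_lipschitz (UNIV :: real set) S (\<lambda>_. Z)"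
    and S: "S = {p. 0 \<le> s * snd p}" and s: "\<bar>s\<bar> = 1"
    and con: "\<And>x. x \<in> {0<..<a} \<Longrightarrow> connects Z S x (\<phi> x)"
    and neg: "\<And>x. x \<in> {0<..<a} \<Longrightarrow> \<phi> x < 0"
    and cont: "continuous_on {0..<a} \<phi>" and zero: "\<phi> 0 = 0"
  shows "arc_relation (connects Z S) a \<phi>"
proof -
  have line: "Sigma_line \<subseteq> S" using S by (auto simp: Sigma_line_def)
  note uend = connects_unique_end[OF lip line] and ustart = connects_unique_start[OF lip line]
  have inj: "inj_on \<phi> {0<..<a}" by (rule inj_onI) (use con ustart in metis)
  have mono: "strict_antimono_on {0..<a} \<phi>"
    by (rule strict_antimono_on_of_inj_neg[OF cont zero neg inj])
  have no_end: "\<not> connects Z S v u" if u: "u \<in> {0<..<a}" for u v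
  proof (rule no_connects_to_inward_point[OF lip S s])
    show "\<forall>\<^sub>F x in nhds u. 0 \<le> s * snd (Z (x, 0))"
      using eventually_nhds_in_open[OF open_greaterThanLessThan u]
      by eventually_elim (rule connects_start_inward[OF con S])
  qed
  have no_start: "\<not> connects Z S (\<phi> u) v" if u: "u \<in> {0<..<a}" for u v
  proof -
    \<comment> \<open>Any two points enclosing u inside the domain would do; by monotonicity
      (\<open>\<phi> d\<close>, \<open>\<phi> c\<close>) is then a neighbourhood of
      \<open>\<phi> u\<close> consisting of end points.\<close>
    define c where "c = u / 2"
    define d where "d = (u + a) / 2"
    have cd: "0 < c" "c < u" "u < d" "d < a" using u by (auto simp: c_def d_def)
    have img: "\<phi> u \<in> {\<phi> d<..<\<phi> c}" using mono cd by (auto simp: monotone_on_def)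
    have "\<forall>\<^sub>F x in nhds (\<phi> u). 0 \<le> s * snd (- Z (x, 0))"
      using eventually_nhds_in_open[OF open_greaterThanLessThan img]
    proof eventually_elim
      case (elim x)
      have "continuous_on {c..d} \<phi>" by (rule continuous_on_subset[OF cont]) (use cd in auto)
      then obtain z where "c \<le> z" "z \<le> d" "\<phi> z = x"
        using IVT2'[of \<phi> d x c] elim cd by (meson greaterThanLessThan_iff less_eq_real_def less_trans)
      moreover from this have "z \<in> {0<..<a}" using cd by simp
      ultimately have "connects Z S z x" using con by blast
      then have "connects (\<lambda>p. - Z p) S x z" by (simp add: connects_reverse)
      from connects_start_inward[OF this S] show ?case by simp
    qed
    from no_connects_to_inward_point[OF local_lipschitz_uminus[OF lip] S s this]
    show ?thesis by (simp add: connects_reverse)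
  qed
  have "(connects Z S u v \<longleftrightarrow> v = \<phi> u) \<and> (connects Z S v (\<phi> u) \<longleftrightarrow> v = u)"
    if "u \<in> {0<..<a}" for u v
    using con[OF that] uend ustart by metis
  then show ?thesis
    unfolding arc_relation_def using no_end no_start mono cont zero by simp
qed

text \<open>A negative return time means that the arc is really traversed from
  \<open>(\<phi> x, 0)\<close> to \<open>(x, 0)\<close>; translating time by \<open>\<tau> x\<close>
  makes it start at time 0.\<close>

lemma half_return_connects:
  assumes "half_return Z S a \<tau> \<phi>" and x: "x \<in> {0<..<a}"
  shows "\<tau> x > 0 \<Longrightarrow> connects Z S x (\<phi> x)" and "\<tau> x < 0 \<Longrightarrow> connects Z S (\<phi> x) x"
proof -
  obtain \<psi> where \<psi>: "solves_on Z \<psi> (closed_segment 0 (\<tau> x))" "\<psi> 0 = (x, 0)"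
      "\<psi> (\<tau> x) = (\<phi> x, 0)" "\<And>t. t \<in> open_segment 0 (\<tau> x) \<Longrightarrow> \<psi> t \<in> S - Sigma_line"
    using assms unfolding half_return_def by blast
  show "connects Z S x (\<phi> x)" if pos: "\<tau> x > 0"
    unfolding connects_def half_arc_def
    using \<psi> pos by (intro exI[of _ "\<tau> x"] exI[of _ \<psi>])
      (auto simp: closed_segment_eq_real_ivl open_segment_eq_real_ivl Sigma_line_def)
  show "connects Z S (\<phi> x) x" if neg: "\<tau> x < 0"
  proof -
    have seg: "closed_segment 0 (\<tau> x) = {\<tau> x..0}" "open_segment 0 (\<tau> x) = {\<tau> x<..<0}"
      using neg by (auto simp: closed_segment_eq_real_ivl open_segment_eq_real_ivl)
    have im: "(\<lambda>t. \<tau> x + t) ` {0..- \<tau> x} = {\<tau> x..0}"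
      by (simp add: image_add_atLeastAtMost)
    have "((\<lambda>t. \<psi> (\<tau> x + t)) has_vector_derivative Z (\<psi> (\<tau> x + t))) (at t within {0..- \<tau> x})"
      if "t \<in> {0..- \<tau> x}" for t
    proof -
      have "((\<lambda>t. \<tau> x + t) has_vector_derivative 1) (at t within {0..- \<tau> x})"
        by (auto intro!: derivative_eq_intros)
      moreover have "(\<psi> has_vector_derivative Z (\<psi> (\<tau> x + t)))
          (at (\<tau> x + t) within (\<lambda>t. \<tau> x + t) ` {0..- \<tau> x})"
        using \<psi>(1) that unfolding im solves_on_def seg by auto
      ultimately show ?thesis using vector_diff_chain_within by (fastforce simp: o_def)
    qed
    then show ?thesis unfolding connects_def half_arc_def solves_on_def
      using \<psi> neg unfolding seg
      by (intro exI[of _ "- \<tau> x"] exI[of _ "\<lambda>t. \<psi> (\<tau> x + t)"]) (auto simp: Sigma_line_def)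
  qed
qed

lemma half_return_arc_relation:
  assumes hr: "half_return Z S a \<tau> \<phi>" and lip: "local_lipschitz (UNIV :: real set) S (\<lambda>_. Z)"
    and S: "S = {p. 0 \<le> s * snd p}" and s: "\<bar>s\<bar> = 1"
  shows "(\<And>x. x \<in> {0<..<a} \<Longrightarrow> \<tau> x > 0) \<Longrightarrow> arc_relation (connects Z S) a \<phi>"
    and "(\<And>x. x \<in> {0<..<a} \<Longrightarrow> \<tau> x < 0) \<Longrightarrow> arc_relation (\<lambda>u v. connects Z S v u) a \<phi>"
proof -
  note core = arc_relation_connects[OF _ S s, of _ a \<phi>]
  have props: "\<And>x. x \<in> {0<..<a} \<Longrightarrow> \<phi> x < 0" "continuous_on {0..<a} \<phi>" "\<phi> 0 = 0"
    using hr by (auto simp: half_return_def)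
  show "arc_relation (connects Z S) a \<phi>" if "\<And>x. x \<in> {0<..<a} \<Longrightarrow> \<tau> x > 0"
    by (rule core[OF lip _ props]) (use half_return_connects(1)[OF hr] that in auto)
  show "arc_relation (\<lambda>u v. connects Z S v u) a \<phi>" if "\<And>x. x \<in> {0<..<a} \<Longrightarrow> \<tau> x < 0"
    using core[OF local_lipschitz_uminus[OF lip] _ props] half_return_connects(2)[OF hr] that
    unfolding connects_reverse by auto
qed

section \<open>The crossing equation\<close>

text \<open>All that the analysis keeps of a Dulac expansion, applied to - \<phi> so that A is
  positive. The limit for the slope is recorded separately because it does not follow from the limit
  for the value.\<close>

definition asymp_power :: "(real \<Rightarrow> real) \<Rightarrow> (real \<Rightarrow> real) \<Rightarrow> real \<Rightarrow> real \<Rightarrow> bool"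
  where "asymp_power f f' A r \<longleftrightarrow> 0 < A \<and> 0 < r \<and>
    (\<forall>\<^sub>F x in at_right 0. (f has_real_derivative f' x) (at x)) \<and>
    ((\<lambda>x. f x / x powr r) \<longlongrightarrow> A) (at_right 0) \<and>
    ((\<lambda>x. f' x / x powr (r - 1)) \<longlongrightarrow> A * r) (at_right 0)"

section \<open>From Dulac expansions to leading terms of values and slopes\<close>

lemma powr_tendsto_0_at_right:
  fixes e :: real
  assumes "e > 0"
  shows "((\<lambda>x. x powr e) \<longlongrightarrow> 0) (at_right 0)"
proof (rule tendsto_eq_rhs[OF tendsto_powr'[OF tendsto_ident_at tendsto_const]])
  show "0 \<noteq> (0::real) \<or> 0 < e \<and> (\<forall>\<^sub>F x in at_right 0. 0 \<le> x)"
    using assms by (auto simp: eventually_at_filter intro!: always_eventually)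
qed (use assms in auto)

lemma flat_quotient_tendsto_0:
  fixes h :: "real \<Rightarrow> real"
  assumes "e0 > 0" and bound: "\<And>x. x \<in> {0<..<e0} \<Longrightarrow> \<bar>h x\<bar> \<le> c * x powr (s + l)" and "l > 0"
  shows "((\<lambda>x. h x / x powr s) \<longlongrightarrow> 0) (at_right 0)"
proof (rule Lim_null_comparison)
  show "\<forall>\<^sub>F x in at_right 0. norm (h x / x powr s) \<le> c * x powr l"
    using eventually_at_right_real[OF assms(1)]
  proof eventually_elim
    case (elim x)
    then have "\<bar>h x\<bar> / x powr s \<le> c * x powr (s + l) / x powr s"
      by (intro divide_right_mono bound) auto
    with elim show ?case by (simp add: powr_add)
  qed
  show "((\<lambda>x. c * x powr l) \<longlongrightarrow> 0) (at_right 0)"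
    using tendsto_mult_left[OF powr_tendsto_0_at_right[OF \<open>l > 0\<close>], of c] by simp
qed

text \<open>The flatness bounds of orders 0 and 1 make the remainder negligible in the value and in
  the slope. Negativity of \<phi> forces \<alpha> \<le> 0, and \<alpha> \<noteq> 0 makes - \<alpha>
  positive.\<close>

lemma dulac_type_imp_asymp_power:
  assumes dt: "dulac_type \<phi> \<alpha> r l" and "0 < r" "0 < l" "\<alpha> \<noteq> 0"
    and "0 < a" and neg: "\<And>x. x \<in> {0<..<a} \<Longrightarrow> \<phi> x < 0"
  shows "asymp_power (\<lambda>x. - \<phi> x) (\<lambda>x. - deriv \<phi> x) (- \<alpha>) r"
proof -
  obtain R where R: "R \<in> flat_functions 1 (r + l)"
    and eqR: "\<forall>\<^sub>F x in at_right 0. \<phi> x = \<alpha> * x powr r + R x"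
    using dt unfolding dulac_type_def by blast
  obtain e where e: "e > 0"
    and diff0: "\<And>\<nu>. enat \<nu> < 1 \<Longrightarrow> (deriv ^^ \<nu>) R differentiable_on {0<..<e}"
    and bd: "\<And>\<nu>. enat \<nu> \<le> 1 \<Longrightarrow> \<exists>C>0. \<exists>\<epsilon>0\<in>{0<..e}. \<forall>x\<in>{0<..<\<epsilon>0}.
        \<bar>(deriv ^^ \<nu>) R x\<bar> \<le> C * x powr (r + l - real \<nu>)"
    using R unfolding flat_functions_def by blast
  have diff: "R differentiable_on {0<..<e}"
    using diff0[of 0] by (simp add: zero_enat_def[symmetric])
  obtain c0 e0 where b0: "e0 > 0" "\<And>x. x \<in> {0<..<e0} \<Longrightarrow> \<bar>R x\<bar> \<le> c0 * x powr (r + l)"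
  proof -
    have "\<exists>C>0. \<exists>\<epsilon>0\<in>{0<..e}. \<forall>x\<in>{0<..<\<epsilon>0}. \<bar>R x\<bar> \<le> C * x powr (r + l)"
      using bd[of 0] by (simp add: zero_enat_def[symmetric])
    then show ?thesis using that by (metis greaterThanAtMost_iff)
  qed
  obtain c1 e1 where b1: "e1 > 0" "\<And>x. x \<in> {0<..<e1} \<Longrightarrow> \<bar>deriv R x\<bar> \<le> c1 * x powr (r + l - 1)"
  proof -
    have "\<exists>C>0. \<exists>\<epsilon>0\<in>{0<..e}. \<forall>x\<in>{0<..<\<epsilon>0}. \<bar>deriv R x\<bar> \<le> C * x powr (r + l - 1)"
      using bd[of 1] by (simp add: one_enat_def)
    then show ?thesis using that by (metis greaterThanAtMost_iff)
  qed
  have R0: "((\<lambda>x. R x / x powr r) \<longlongrightarrow> 0) (at_right 0)"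
    by (rule flat_quotient_tendsto_0[OF b0(1) b0(2) \<open>0 < l\<close>])
  have R1: "((\<lambda>x. deriv R x / x powr (r - 1)) \<longlongrightarrow> 0) (at_right 0)"
    by (rule flat_quotient_tendsto_0[OF b1(1) _ \<open>0 < l\<close>, of _ c1])
      (use b1(2) in \<open>simp add: algebra_simps\<close>)
  have pos: "\<forall>\<^sub>F x in at_right 0. 0 < (x :: real)" by (simp add: eventually_at_filter)
  obtain d where d: "d > 0" and eq: "\<And>x. x \<in> {0<..<d} \<Longrightarrow> \<phi> x = \<alpha> * x powr r + R x"
    using eqR unfolding eventually_at_right_field by auto
  have der: "(\<phi> has_real_derivative \<alpha> * (r * x powr (r - 1)) + deriv R x) (at x)"
    if x: "x \<in> {0<..<min d e}" for x
  proof -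
    have "R differentiable (at x)"
      using diff x by (auto simp: differentiable_on_eq_differentiable_at)
    then have "(R has_real_derivative deriv R x) (at x)"
      using DERIV_deriv_iff_real_differentiable by blast
    then have "((\<lambda>x. \<alpha> * x powr r + R x) has_real_derivative
        \<alpha> * (r * x powr (r - 1)) + deriv R x) (at x)"
      using x by (auto intro!: derivative_eq_intros)
    then show ?thesis
    proof (rule has_field_derivative_transform_within_open)
      show "open {0<..<d}" "x \<in> {0<..<d}" using x by auto
    qed (use eq in auto)
  qed
  have evder: "\<forall>\<^sub>F x in at_right 0.
      (\<phi> has_real_derivative \<alpha> * (r * x powr (r - 1)) + deriv R x) (at x)"
  proof -
    have "0 < min d e" using d e by simp
    from eventually_at_right_real[OF this] show ?thesis by eventually_elim (use der in auto)
  qed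
  have lim: "((\<lambda>x. - \<phi> x / x powr r) \<longlongrightarrow> - \<alpha>) (at_right 0)"
  proof (rule Lim_transform_eventually)
    show "((\<lambda>x. - \<alpha> - R x / x powr r) \<longlongrightarrow> - \<alpha>) (at_right 0)"
      using tendsto_diff[OF tendsto_const R0, of "- \<alpha>"] by simp
    show "\<forall>\<^sub>F x in at_right 0. - \<alpha> - R x / x powr r = - \<phi> x / x powr r"
      using eqR pos by eventually_elim (simp add: field_simps)
  qed
  have "0 \<le> - \<alpha>"
  proof (rule tendsto_lowerbound[OF lim])
    show "\<forall>\<^sub>F x in at_right 0. 0 \<le> - \<phi> x / x powr r"
      using eventually_at_right_real[OF \<open>0 < a\<close>]
    proof eventually_elim
      case (elim x)
      from neg[OF this] show ?case by (simp add: divide_nonpos_nonneg)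
    qed
  qed simp
  moreover have "((\<lambda>x. - deriv \<phi> x / x powr (r - 1)) \<longlongrightarrow> - \<alpha> * r) (at_right 0)"
  proof (rule Lim_transform_eventually)
    show "((\<lambda>x. - \<alpha> * r - deriv R x / x powr (r - 1)) \<longlongrightarrow> - \<alpha> * r) (at_right 0)"
      using tendsto_diff[OF tendsto_const R1, of "- \<alpha> * r"] by simp
    show "\<forall>\<^sub>F x in at_right 0. - \<alpha> * r - deriv R x / x powr (r - 1) = - deriv \<phi> x / x powr (r - 1)"
      using evder pos by eventually_elim (simp add: DERIV_imp_deriv field_simps)
  qed
  moreover have "\<forall>\<^sub>F x in at_right 0. ((\<lambda>x. - \<phi> x) has_real_derivative - deriv \<phi> x) (at x)"
    using evder by eventually_elim (metis DERIV_imp_deriv DERIV_minus)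
  ultimately show ?thesis
    using lim assms unfolding asymp_power_def by simp
qed

text \<open>With two distinct zeros, h would rise to the right of the first and reach a positive
  maximum between them, where its derivative vanishes. Positivity of the derivative is required only
  where h \<ge> 0, since only there can the slopes of f and g be compared.\<close>

lemma at_most_one_zero:
  fixes h :: "real \<Rightarrow> real"
  assumes cont: "continuous_on {x..y} h" and "x \<le> y" and zeros: "h x = 0" "h y = 0"
    and der: "\<And>z. z \<in> {x..y} \<Longrightarrow> 0 \<le> h z \<Longrightarrow> \<exists>D>0. (h has_real_derivative D) (at z)"
  shows "x = y"
proof (rule ccontr)
  assume "x \<noteq> y"
  then have xy: "x < y" using \<open>x \<le> y\<close> by simp
  obtain D where "D > 0" "(h has_real_derivative D) (at x)" using der[of x] xy zeros by auto
  then obtain d where d: "d > 0" "\<And>e. 0 < e \<Longrightarrow> e < d \<Longrightarrow> h x < h (x + e)"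
    using DERIV_pos_inc_right by blast
  define e where "e = min (d / 2) ((y - x) / 2)"
  have e: "0 < e" "e < d" "x + e < y" using d(1) xy by (auto simp: e_def min_def field_simps)
  obtain z where z: "z \<in> {x..y}" "\<And>t. t \<in> {x..y} \<Longrightarrow> h t \<le> h z"
    using continuous_attains_sup[OF compact_Icc _ cont] xy by auto
  have "0 < h z" using z(2)[of "x + e"] d(2)[of e] e zeros by auto
  then obtain D' where D': "D' > 0" "(h has_real_derivative D') (at z)" using der[OF z(1)] by auto
  have zz: "x < z" "z < y" using \<open>0 < h z\<close> z(1) zeros by (auto simp: less_le)
  have "D' = 0"
    by (rule DERIV_local_max[OF D'(2), of "min (z - x) (y - z)"]) (use zz z(2) in \<open>auto simp: abs_if split: if_splits\<close>)
  with D' show False by simp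
qed

text \<open>Domination is a strict order of the leading terms, not just g < f pointwise: the
  equation evaluates g at the larger point w + b, so there must be room to enlarge the argument of
  g.\<close>

locale dominated_pair =
  fixes f g f' g' :: "real \<Rightarrow> real" and A C p m a :: real
  assumes a: "a > 0"
    and cont_f: "continuous_on {0..<a} f" and mono_f: "strict_mono_on {0..<a} f" and f0: "f 0 = 0"
    and cont_g: "continuous_on {0..<a} g" and mono_g: "strict_mono_on {0..<a} g" and g0: "g 0 = 0"
    and power_f: "asymp_power f f' A p" and power_g: "asymp_power g g' C m"
    and dominated: "p < m \<or> p = m \<and> C < A"
begin

text \<open>The coefficient of \<open>x powr p\<close> in \<open>g\<close>, so that \<open>f x - g x \<sim> (A - C1) * x powr p\<close>.\<close>

definition C1 :: real where "C1 = (if p = m then C else 0)"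

lemma pos: "0 < A" "0 < C" "0 < p" "0 < m"
  using power_f power_g by (auto simp: asymp_power_def)

lemma C1: "0 \<le> C1" "C1 < A"
  using pos dominated by (auto simp: C1_def)

lemma lim_f: "((\<lambda>x. f x / x powr p) \<longlongrightarrow> A) (at_right 0)"
  and lim_g: "((\<lambda>x. g x / x powr m) \<longlongrightarrow> C) (at_right 0)"
  using power_f power_g by (auto simp: asymp_power_def)

lemma lim_g_p: "((\<lambda>x. g x / x powr p) \<longlongrightarrow> C1) (at_right 0)"
proof (cases "p = m")
  case True
  then have "C1 = C" unfolding C1_def by simp
  with lim_g show ?thesis unfolding True by metis
next
  case False
  then have "p < m" using dominated by auto
  have "((\<lambda>x. g x / x powr m * x powr (m - p)) \<longlongrightarrow> C * 0) (at_right 0)"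
    by (intro tendsto_mult lim_g powr_tendsto_0_at_right) (use \<open>p < m\<close> in auto)
  moreover have "\<forall>\<^sub>F x in at_right 0. g x / x powr m * x powr (m - p) = g x / x powr p"
    using eventually_at_right_real[of 0 1] by (auto elim!: eventually_mono simp: powr_diff)
  ultimately show ?thesis using False by (auto simp: C1_def intro: Lim_transform_eventually)
qed

lemma f_less: "x \<in> {0..<a} \<Longrightarrow> y \<in> {0..<a} \<Longrightarrow> x < y \<Longrightarrow> f x < f y"
  and g_less: "x \<in> {0..<a} \<Longrightarrow> y \<in> {0..<a} \<Longrightarrow> x < y \<Longrightarrow> g x < g y"
  using mono_f mono_g by (auto simp: monotone_on_def)

lemma f_pos: "x \<in> {0<..<a} \<Longrightarrow> 0 < f x" and g_pos: "x \<in> {0<..<a} \<Longrightarrow> 0 < g x"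
  using f_less[of 0 x] g_less[of 0 x] f0 g0 by auto

text \<open>To leading order the claim reads \<open>K * (K powr p * C1) < A\<close>. For p = m every
  K > 1 close to 1 works since C < A; for p < m the left side is 0 and K can be taken as large as
  desired. The bound K > m / p is what the comparison of logarithmic derivatives consumes.\<close>

lemma domination_factor:
  obtains K where "m / p < K" "1 < K" "\<forall>\<^sub>F w in at_right 0. K * g (K * w) < f w"
proof -
  have "\<exists>K. m / p < K \<and> 1 < K \<and> K * (K powr p * C1) < A"
  proof (cases "p = m")
    case True
    have "((\<lambda>K. K * (K powr p * C1)) \<longlongrightarrow> 1 * (1 powr p * C1)) (at_right 1)"
      by (intro tendsto_intros) auto
    then have "\<forall>\<^sub>F K in at_right 1. K * (K powr p * C1) < A"
      by (rule order_tendstoD(2)) (use C1 in simp)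
    moreover have "\<forall>\<^sub>F K in at_right 1. 1 < (K::real)" by (simp add: eventually_at_filter)
    ultimately have "\<forall>\<^sub>F K in at_right 1. m / p < K \<and> 1 < K \<and> K * (K powr p * C1) < A"
      by eventually_elim (use True pos in auto)
    then show ?thesis by (rule eventually_happens'[OF trivial_limit_at_right_real])
  next
    case False
    then show ?thesis using C1 pos dominated by (intro exI[of _ "m / p + 1"]) (auto simp: C1_def)
  qed
  then obtain K where K: "m / p < K" "1 < K" "K * (K powr p * C1) < A" by blast
  have "filterlim (\<lambda>w. K * w) (at_right 0) (at_right 0)"
    using filterlim_times_pos[OF filterlim_ident, of K 0 0] K by simp
  from filterlim_compose[OF lim_g_p this]
  have "((\<lambda>w. K * (K powr p * (g (K * w) / (K * w) powr p))) \<longlongrightarrow> K * (K powr p * C1)) (at_right 0)"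
    by (intro tendsto_intros)
  from tendsto_diff[OF lim_f this]
  have "\<forall>\<^sub>F w in at_right 0. 0 < f w / w powr p - K * (K powr p * (g (K * w) / (K * w) powr p))"
    by (rule order_tendstoD(1)) (use K in simp)
  moreover have "\<forall>\<^sub>F w in at_right 0. 0 < (w::real)" by (simp add: eventually_at_filter)
  ultimately have "\<forall>\<^sub>F w in at_right 0. K * g (K * w) < f w"
    by eventually_elim (use K in \<open>simp add: powr_mult field_simps\<close>)
  with K that show ?thesis by blast
qed

text \<open>In this form the coefficient cancels, so slopes at points of different size become
  comparable.\<close>

lemma log_derivative:
  assumes "asymp_power h h' B r"
  shows "((\<lambda>x. x * h' x / h x) \<longlongrightarrow> r) (at_right 0)"
proof (rule Lim_transform_eventually)
  have *: "0 < B" "((\<lambda>x. h x / x powr r) \<longlongrightarrow> B) (at_right 0)"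
    "((\<lambda>x. h' x / x powr (r - 1)) \<longlongrightarrow> B * r) (at_right 0)"
    using assms by (auto simp: asymp_power_def)
  show "((\<lambda>x. (h' x / x powr (r - 1)) / (h x / x powr r)) \<longlongrightarrow> r) (at_right 0)"
    using tendsto_divide[OF *(3,2)] *(1) by simp
  have "\<forall>\<^sub>F x in at_right 0. 0 < (x::real)" by (simp add: eventually_at_filter)
  then show "\<forall>\<^sub>F x in at_right 0. (h' x / x powr (r - 1)) / (h x / x powr r) = x * h' x / h x"
    by eventually_elim (simp add: powr_diff)
qed

text \<open>With \<open>K > m / p\<close> such that \<open>K * g (K * w) < f w\<close>, either \<open>u \<ge> K * w\<close> or
  \<open>f w \<ge> K * g u\<close>. Both give \<open>K * g u * w \<le> f w * u\<close>, and the logarithmic derivatives of \<open>f\<close>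
  and \<open>g\<close> tend to \<open>p\<close> and \<open>m\<close>.\<close>

lemma transversality:
  obtains \<eta> where "0 < \<eta>" "\<eta> \<le> a"
    "\<And>x. x \<in> {0<..<\<eta>} \<Longrightarrow> (f has_real_derivative f' x) (at x) \<and> (g has_real_derivative g' x) (at x)"
    "\<And>x. x \<in> {0<..<\<eta>} \<Longrightarrow> 0 < f' x \<and> 0 < g' x"
    "\<And>w u. 0 < w \<Longrightarrow> w \<le> u \<Longrightarrow> u < \<eta> \<Longrightarrow> g u \<le> f w \<Longrightarrow> g' u < f' w"
proof -
  obtain K where K: "m / p < K" "1 < K" and dom: "\<forall>\<^sub>F w in at_right 0. K * g (K * w) < f w"
    by (rule domination_factor)
  \<comment> \<open>A value strictly between m / K and p: eventually the logarithmic derivative of f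
    exceeds q and that of g stays below q * K.\<close>
  define q where "q = (m / K + p) / 2"
  have q: "0 < q" "q < p" "m < q * K" using K pos by (auto simp: q_def field_simps)
  have pf: "\<forall>\<^sub>F x in at_right 0. q < x * f' x / f x"
    by (rule order_tendstoD(1)[OF log_derivative[OF power_f]]) (use q in simp)
  have pg: "\<forall>\<^sub>F x in at_right 0. x * g' x / g x < q * K"
    by (rule order_tendstoD(2)[OF log_derivative[OF power_g]]) (use q in simp)
  have pg0: "\<forall>\<^sub>F x in at_right 0. 0 < x * g' x / g x"
    by (rule order_tendstoD(1)[OF log_derivative[OF power_g]]) (use pos in simp)
  have ders: "\<forall>\<^sub>F x in at_right 0. (f has_real_derivative f' x) (at x)"
    "\<forall>\<^sub>F x in at_right 0. (g has_real_derivative g' x) (at x)"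
    using power_f power_g by (auto simp: asymp_power_def)
  have "\<forall>\<^sub>F x in at_right 0. K * g (K * x) < f x \<and> q < x * f' x / f x \<and> x * g' x / g x < q * K \<and>
      0 < x * g' x / g x \<and> (f has_real_derivative f' x) (at x) \<and> (g has_real_derivative g' x) (at x)"
    using dom pf pg pg0 ders by eventually_elim auto
  then obtain d where d: "d > 0" and dn: "\<And>x. x \<in> {0<..<d} \<Longrightarrow>
      K * g (K * x) < f x \<and> q < x * f' x / f x \<and> x * g' x / g x < q * K \<and>
      0 < x * g' x / g x \<and> (f has_real_derivative f' x) (at x) \<and> (g has_real_derivative g' x) (at x)"
    unfolding eventually_at_right_field by auto
  \<comment> \<open>The bound a / K keeps K * w inside the domain of g for every w < \<eta>.\<close>
  define \<eta> where "\<eta> = min d (a / K)"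
  have \<eta>: "0 < \<eta>" "\<eta> \<le> d" "\<eta> * K \<le> a" using d a K by (auto simp: \<eta>_def min_def field_simps)
  have "\<eta> \<le> \<eta> * K" using \<eta> K by simp
  then have \<eta>a: "\<eta> \<le> a" using \<eta> by linarith
  have fd: "q * f x < x * f' x" "0 < f x" if "x \<in> {0<..<\<eta>}" for x
  proof -
    show "0 < f x" using that \<eta>a by (intro f_pos) simp
    then show "q * f x < x * f' x" using dn[of x] that \<eta> by (auto simp: pos_less_divide_eq)
  qed
  have gd: "u * g' u < q * K * g u" "0 < g u" "0 < g' u" if "u \<in> {0<..<\<eta>}" for u
  proof -
    show gu: "0 < g u" using that \<eta>a by (intro g_pos) simp
    then show "u * g' u < q * K * g u" using dn[of u] that \<eta> by (auto simp: pos_divide_less_eq)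
    have "0 < u * g' u / g u" using dn[of u] that \<eta> by simp
    then have "0 < u * g' u" using gu by (simp add: zero_less_divide_iff)
    then show "0 < g' u" using that by (simp add: zero_less_mult_iff)
  qed
  have fpos: "0 < f' x" if "x \<in> {0<..<\<eta>}" for x
  proof -
    have "0 < q * f x" using fd(2)[OF that] q by simp
    then have "0 < x * f' x" using fd(1)[OF that] by linarith
    then show ?thesis using that by (simp add: zero_less_mult_iff)
  qed
  have "g' u < f' w" if wu: "0 < w" "w \<le> u" "u < \<eta>" and le: "g u \<le> f w" for w u
  proof -
    have mem: "w \<in> {0<..<\<eta>}" "u \<in> {0<..<\<eta>}" using wu by auto
    have key: "K * g u * w \<le> f w * u"
    proof (cases "u \<ge> K * w")
      case True
      have "g u * (K * w) \<le> f w * u"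
        by (rule mult_mono[OF le True]) (use fd(2)[OF mem(1)] K wu in auto)
      then show ?thesis by (simp add: algebra_simps)
    next
      case False
      have "w * K < \<eta> * K" using wu K by simp
      then have "K * w < a" using \<eta> mult.commute[of K w] by linarith
      moreover have "0 < K * w" "u < K * w" "u < a" using False wu \<eta>a K by auto
      ultimately have "g u < g (K * w)" using wu by (intro g_less) simp_all
      then have "K * g u \<le> K * g (K * w)" using K by simp
      also have "\<dots> \<le> f w" using dn[of w] wu \<eta> by simp
      finally have "K * g u \<le> f w" .
      then have "K * g u * w \<le> f w * w" using wu by simp
      also have "\<dots> \<le> f w * u" using wu fd(2)[OF mem(1)] by simp
      finally show ?thesis .
    qed
    \<comment> \<open>The two logarithmic bounds are joined through \<open>key\<close>; cancelling
      the positive factor u * w leaves the comparison of the slopes.\<close>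
    have "(u * g' u) * w < (q * K * g u) * w" using gd(1)[OF mem(2)] wu by simp
    also have "\<dots> = q * (K * g u * w)" by simp
    also have "\<dots> \<le> q * (f w * u)" using key q by simp
    also have "\<dots> = (q * f w) * u" by simp
    also have "\<dots> < (w * f' w) * u" using fd(1)[OF mem(1)] wu by simp
    finally have "g' u * (u * w) < f' w * (u * w)" by (simp add: algebra_simps)
    then show ?thesis using wu by (simp add: mult_less_cancel_right)
  qed
  moreover have "(f has_real_derivative f' x) (at x) \<and> (g has_real_derivative g' x) (at x)"
    if "x \<in> {0<..<\<eta>}" for x
    using dn[of x] that \<eta> by simp
  ultimately show ?thesis using that[OF \<eta>(1) \<eta>a] gd(3) fpos by blast
qed

text \<open>Intermediate value theorem for \<open>f w - b - g (w + b)\<close>: it is negative at w =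
  0 since f vanishes there, and nonnegative at a fixed w1 with g w1 < f w1 once b is small. The
  bound f w < \<eta> will keep the second intersection with the line near the origin.\<close>

lemma solution_exists:
  assumes "0 < \<eta>"
  shows "\<forall>\<^sub>F b in at_right 0. \<exists>w. 0 < w \<and> w + b < \<eta> \<and> w + b < a \<and> f w < \<eta> \<and> f w = b + g (w + b)"
proof -
  obtain K where K: "1 < K" and dom: "\<forall>\<^sub>F w in at_right 0. K * g (K * w) < f w"
    using domination_factor by blast
  have f_small: "\<forall>\<^sub>F w in at_right 0. f w < \<eta>"
  proof -
    have "(f \<longlongrightarrow> f 0) (at 0 within {0..<a})" 
      using cont_f a unfolding continuous_on_def by simp
    moreover have "at 0 within {0..<a} = at_right 0"
      by (rule at_within_nhd[of _ "{..<a}"]) (use a in auto)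
    ultimately have "(f \<longlongrightarrow> 0) (at_right 0)" using f0 by metis
    then show ?thesis by (rule order_tendstoD(2)[OF _ assms])
  qed
  have "0 < min (a / K) (\<eta> / 2)" using a K assms by simp
  from eventually_at_right_real[OF this] dom f_small
  have "\<forall>\<^sub>F w in at_right 0. 0 < w \<and> w < \<eta> / 2 \<and> w < a / K \<and> K * g (K * w) < f w \<and> f w < \<eta>"
    by eventually_elim simp
  from eventually_happens'[OF trivial_limit_at_right_real this]
  obtain w1 where w1: "0 < w1" "w1 < \<eta> / 2" "w1 < a / K" "K * g (K * w1) < f w1" "f w1 < \<eta>"
    by blast
  have Kw: "w1 < K * w1" "K * w1 < a" using w1 K by (auto simp: field_simps)
  have w1a: "w1 < a" using Kw by linarith
  have "g w1 < g (K * w1)" using Kw w1 w1a by (intro g_less) auto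
  also have "\<dots> \<le> K * g (K * w1)" using K g_pos[of "K * w1"] Kw w1 by simp
  finally have fg: "g w1 < f w1" using w1 by simp
  have "isCont g w1"
    using continuous_on_interior[OF cont_g, of w1] w1(1) w1a by simp
  then have "((\<lambda>b. g (w1 + b)) \<longlongrightarrow> g w1) (at_right 0)"
  proof (rule isCont_tendsto_compose)
    show "((\<lambda>b. w1 + b) \<longlongrightarrow> w1) (at_right 0)"
      using tendsto_add[OF tendsto_const tendsto_ident_at, of w1 0 "{0<..}"] by simp
  qed
  then have "((\<lambda>b. f w1 - b - g (w1 + b)) \<longlongrightarrow> f w1 - 0 - g w1) (at_right 0)"
    by (intro tendsto_intros)
  \<comment> \<open>The point w1 is chosen before b, so continuity of g preserves the strict gap for
    small b.\<close>
  then have "\<forall>\<^sub>F b in at_right 0. 0 < f w1 - b - g (w1 + b)"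
    by (rule order_tendstoD(1)) (use fg in simp)
  moreover have "\<forall>\<^sub>F b in at_right 0. b \<in> {0<..<min (\<eta> / 2) (a - w1)}"
    by (rule eventually_at_right_real) (use w1a assms in simp)
  ultimately show ?thesis
  proof eventually_elim
    case (elim b)
    let ?h = "\<lambda>w. f w - b - g (w + b)"
    have "continuous_on {0..w1} f" by (rule continuous_on_subset[OF cont_f]) (use w1a in auto)
    moreover have "continuous_on {0..w1} (\<lambda>w. g (w + b))"
    proof (rule continuous_on_compose2[OF cont_g])
      show "continuous_on {0..w1} (\<lambda>w. w + b)" by (intro continuous_intros)
      show "(\<lambda>w. w + b) ` {0..w1} \<subseteq> {0..<a}" using elim(2) by auto
    qed
    ultimately have "continuous_on {0..w1} ?h" by (intro continuous_intros)
    moreover have h0: "?h 0 < 0" using g_pos[of b] elim(2) f0 w1(1) by simp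
    moreover have "0 \<le> ?h w1" using elim(1) by linarith
    ultimately obtain w where w: "0 \<le> w" "w \<le> w1" "?h w = 0"
      using IVT'[of ?h 0 0 w1] w1(1) by (metis less_eq_real_def)
    have "w \<noteq> 0" using w(3) h0 by auto
    moreover have "f w \<le> f w1"
    proof (cases "w = w1")
      case False
      then show ?thesis using f_less[of w w1] w w1a by simp
    qed simp
    moreover have "w + b < \<eta>" "w + b < a" using elim(2) w w1 by auto
    ultimately show ?case using w w1(5) by (intro exI[of _ w]) simp
  qed
qed

text \<open>Where \<open>f w - b - g (w + b)\<close> is nonnegative, b > 0 gives g (w + b) \<le> f
  w, so transversality makes its derivative positive. This is exactly the situation of
  \<open>at_most_one_zero\<close>.\<close>

lemma solution_unique:
  obtains \<eta> where "0 < \<eta>" "\<eta> \<le> a"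
    "\<And>b w w'. 0 < b \<Longrightarrow> 0 < w \<Longrightarrow> w + b < \<eta> \<Longrightarrow> f w = b + g (w + b) \<Longrightarrow>
      0 < w' \<Longrightarrow> w' + b < \<eta> \<Longrightarrow> f w' = b + g (w' + b) \<Longrightarrow> w = w'"
proof -
  obtain \<eta> where \<eta>: "0 < \<eta>" "\<eta> \<le> a"
    and der: "\<And>x. x \<in> {0<..<\<eta>} \<Longrightarrow> (f has_real_derivative f' x) (at x) \<and> (g has_real_derivative g' x) (at x)"
    and tr: "\<And>w u. 0 < w \<Longrightarrow> w \<le> u \<Longrightarrow> u < \<eta> \<Longrightarrow> g u \<le> f w \<Longrightarrow> g' u < f' w"
    using transversality by metis
  have less: "x = y" if b: "0 < b" and x: "0 < x" "f x = b + g (x + b)"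
    and y: "y + b < \<eta>" "f y = b + g (y + b)" and "x \<le> y" for b x y
  proof -
    let ?h = "\<lambda>w. f w - b - g (w + b)"
    have hder: "(?h has_real_derivative f' z - g' (z + b)) (at z)" if "z \<in> {x..y}" for z
    proof -
      have "(g has_real_derivative g' (z + b)) (at (z + b))" "(f has_real_derivative f' z) (at z)"
        using der that x y b by auto
      then show ?thesis by (auto intro!: derivative_eq_intros simp: DERIV_shift)
    qed
    show ?thesis
    proof (rule at_most_one_zero[of x y ?h])
      show "continuous_on {x..y} ?h"
        by (rule DERIV_continuous_on) (use hder in \<open>auto intro: has_field_derivative_at_within\<close>)
      show "\<exists>D>0. (?h has_real_derivative D) (at z)" if "z \<in> {x..y}" "0 \<le> ?h z" for z
        using hder[OF that(1)] tr[of z "z + b"] that x y b by (intro exI[of _ "f' z - g' (z + b)"]) auto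
    qed (use that in auto)
  qed
  show ?thesis
    by (rule that[OF \<eta>]) (metis less linear)
qed

text \<open>Two radii: the solution lies in the window \<eta>, while uniqueness is claimed in the
  fixed window \<eta>0. The difference is needed to identify solutions found in different
  windows.\<close>

definition solution_at :: "real \<Rightarrow> real \<Rightarrow> real \<Rightarrow> real \<Rightarrow> bool"
  where "solution_at \<eta>0 \<eta> b w \<longleftrightarrow>
    0 < w \<and> w + b < \<eta> \<and> f w < \<eta> \<and> f w = b + g (w + b) \<and>
    (\<forall>w'. 0 < w' \<and> w' + b < \<eta>0 \<and> f w' = b + g (w' + b) \<longrightarrow> w' = w) \<and>
    (f has_real_derivative f' w) (at w) \<and> (g has_real_derivative g' (w + b)) (at (w + b)) \<and>
    0 < g' (w + b) \<and> g' (w + b) < f' w"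

text \<open>Solutions exist in every small window and are unique in the fixed one, so the chosen
  branch enters every small window as b tends to 0; this gives its limit without any
  estimate.\<close>

lemma solution_branch:
  obtains \<eta>0 where "0 < \<eta>0" "\<eta>0 \<le> a" "\<And>\<eta>. 0 < \<eta> \<Longrightarrow> \<eta> \<le> \<eta>0 \<Longrightarrow>
    \<exists>b0>0. \<exists>W. (\<forall>b. 0 < b \<and> b < b0 \<longrightarrow> solution_at \<eta>0 \<eta> b (W b)) \<and> (W \<longlongrightarrow> 0) (at_right 0)"
proof -
  obtain \<eta>1 where \<eta>1: "0 < \<eta>1" "\<eta>1 \<le> a" and
    uniq: "\<And>b w w'. 0 < b \<Longrightarrow> 0 < w \<Longrightarrow> w + b < \<eta>1 \<Longrightarrow> f w = b + g (w + b) \<Longrightarrow>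
      0 < w' \<Longrightarrow> w' + b < \<eta>1 \<Longrightarrow> f w' = b + g (w' + b) \<Longrightarrow> w = w'"
    using solution_unique by metis
  obtain \<eta>2 where \<eta>2: "0 < \<eta>2"
    and der: "\<And>x. x \<in> {0<..<\<eta>2} \<Longrightarrow> (f has_real_derivative f' x) (at x) \<and> (g has_real_derivative g' x) (at x)"
    and der_pos: "\<And>x. x \<in> {0<..<\<eta>2} \<Longrightarrow> 0 < f' x \<and> 0 < g' x"
    and tr: "\<And>w u. 0 < w \<Longrightarrow> w \<le> u \<Longrightarrow> u < \<eta>2 \<Longrightarrow> g u \<le> f w \<Longrightarrow> g' u < f' w"
    using transversality by metis
  define \<eta>0 where "\<eta>0 = min \<eta>1 \<eta>2"
  have \<eta>0: "0 < \<eta>0" "\<eta>0 \<le> \<eta>1" "\<eta>0 \<le> \<eta>2" "\<eta>0 \<le> a" using \<eta>1 \<eta>2 by (auto simp: \<eta>0_def)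
  show ?thesis
  proof (rule that[OF \<eta>0(1,4)])
    fix \<eta> assume \<eta>: "0 < \<eta>" "\<eta> \<le> \<eta>0"
    let ?P = "\<lambda>\<eta> b w. 0 < w \<and> w + b < \<eta> \<and> f w < \<eta> \<and> f w = b + g (w + b)"
    define W where "W b = (SOME w. ?P \<eta> b w)" for b
    obtain b0 where b0: "b0 > 0" "\<And>b. 0 < b \<Longrightarrow> b < b0 \<Longrightarrow> \<exists>w. ?P \<eta> b w"
      using solution_exists[OF \<eta>(1)] unfolding eventually_at_right_field by blast
    have W: "?P \<eta> b (W b)" if "0 < b" "b < b0" for b
      unfolding W_def by (rule someI_ex) (use b0 that in blast)
    have Wu: "w = W b" if b: "0 < b" "b < b0" and w: "0 < w" "w + b < \<eta>0" "f w = b + g (w + b)" for b w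
      using uniq[of b w "W b"] W[OF b] b w \<eta> \<eta>0 by simp
    have Wd: "(f has_real_derivative f' (W b)) (at (W b)) \<and>
         (g has_real_derivative g' (W b + b)) (at (W b + b)) \<and>
         0 < g' (W b + b) \<and> g' (W b + b) < f' (W b)" if b: "0 < b" "b < b0" for b
    proof -
      have mem: "W b \<in> {0<..<\<eta>2}" "W b + b \<in> {0<..<\<eta>2}" using W[OF b] b \<eta> \<eta>0 by auto
      have "g' (W b + b) < f' (W b)" by (rule tr) (use W[OF b] b mem in auto)
      then show ?thesis using der[OF mem(1)] der[OF mem(2)] der_pos[OF mem(2)] by blast
    qed
    have "(W \<longlongrightarrow> 0) (at_right 0)"
    proof (rule tendstoI)
      fix e :: real assume e: "e > 0"
      have "\<forall>\<^sub>F b in at_right 0. b \<in> {0<..<b0}" by (rule eventually_at_right_real[OF b0(1)])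
      moreover have "0 < min e \<eta>" using e \<eta> by simp
      note solution_exists[OF this]
      ultimately show "\<forall>\<^sub>F b in at_right 0. dist (W b) 0 < e"
      proof eventually_elim
        case (elim b)
        then obtain w where "0 < w" "w + b < min e \<eta>" "f w = b + g (w + b)" by blast
        with Wu[of b w] elim \<eta> show ?case by auto
      qed
    qed
    moreover have "\<forall>b. 0 < b \<and> b < b0 \<longrightarrow> solution_at \<eta>0 \<eta> b (W b)"
      unfolding solution_at_def using W Wu Wd by blast
    ultimately show "\<exists>b0>0. \<exists>W. (\<forall>b. 0 < b \<and> b < b0 \<longrightarrow> solution_at \<eta>0 \<eta> b (W b)) \<and>
        (W \<longlongrightarrow> 0) (at_right 0)"
      using b0(1) by blast
  qed
qed

section \<open>Asymptotics of a solution branch as b tends to 0\<close>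

context
  fixes W :: "real \<Rightarrow> real"
  assumes W_pos: "\<forall>\<^sub>F b in at_right 0. 0 < W b"
    and W_eq: "\<forall>\<^sub>F b in at_right 0. f (W b) = b + g (W b + b)"
    and W_lim: "(W \<longlongrightarrow> 0) (at_right 0)"
begin

lemma b_pos: "\<forall>\<^sub>F b in at_right 0. 0 < (b::real)"
  by (rule eventually_at_right_less)

lemma filterlim_W: "filterlim W (at_right 0) (at_right 0)"
  unfolding filterlim_at using W_pos W_lim by (auto elim: eventually_mono)

lemma filterlim_U: "filterlim (\<lambda>b. W b + b) (at_right 0) (at_right 0)"
  unfolding filterlim_at
proof
  show "((\<lambda>b. W b + b) \<longlongrightarrow> 0) (at_right 0)"
    using tendsto_add[OF W_lim tendsto_ident_at] by simp
  show "\<forall>\<^sub>F b in at_right 0. W b + b \<in> {0<..} \<and> W b + b \<noteq> 0"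
    using W_pos b_pos by eventually_elim auto
qed

lemma lim_fW: "((\<lambda>b. f (W b) / W b powr p) \<longlongrightarrow> A) (at_right 0)"
  and lim_gU: "((\<lambda>b. g (W b + b) / (W b + b) powr p) \<longlongrightarrow> C1) (at_right 0)"
  using filterlim_compose[OF lim_f filterlim_W] filterlim_compose[OF lim_g_p filterlim_U] .

lemma g_nonneg: "\<forall>\<^sub>F b in at_right 0. 0 \<le> g (W b + b)"
proof -
  have "((\<lambda>b. W b + b) \<longlongrightarrow> 0) (at_right 0)"
    using filterlim_U by (simp add: filterlim_at)
  then have "\<forall>\<^sub>F b in at_right 0. W b + b < a" by (rule order_tendstoD(2)) (rule a)
  then show ?thesis using W_pos b_pos
    by eventually_elim (use g_pos in \<open>auto intro: less_imp_le\<close>)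
qed

text \<open>Here b \<le> f (W b), which is of order \<open>W b powr p\<close> and hence negligible
  against W b. So w and w + b are equivalent, the equation gives \<open>b / W b powr p\<close>
  \<rightarrow> A - C1, and this is inverted by the power - 1 / p.\<close>

lemma branch_asymp_gt_1:
  assumes "p > 1"
  shows "((\<lambda>b. W b / b powr (1 / p)) \<longlongrightarrow> 1 / (A - C1) powr (1 / p)) (at_right 0)"
proof -
  have bW: "((\<lambda>b. b / W b) \<longlongrightarrow> 0) (at_right 0)"
  proof (rule tendsto_sandwich)
    show "\<forall>\<^sub>F b in at_right 0. b / W b \<le> f (W b) / W b powr p * W b powr (p - 1)"
      using W_pos W_eq g_nonneg
      by eventually_elim (simp add: powr_diff divide_right_mono)
    show "\<forall>\<^sub>F b in at_right 0. 0 \<le> b / W b"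
      using W_pos b_pos by eventually_elim simp
    show "((\<lambda>b. f (W b) / W b powr p * W b powr (p - 1)) \<longlongrightarrow> 0) (at_right 0)"
      using tendsto_mult[OF lim_fW filterlim_compose[OF powr_tendsto_0_at_right filterlim_W, of "p - 1"]]
        assms by simp
  qed simp
  have UW: "((\<lambda>b. (1 + b / W b) powr p) \<longlongrightarrow> 1) (at_right 0)"
    using tendsto_powr[OF tendsto_add[OF tendsto_const bW, of 1] tendsto_const, of p] by simp
  have "((\<lambda>b. b / W b powr p) \<longlongrightarrow> A - C1) (at_right 0)"
  proof (rule Lim_transform_eventually)
    show "((\<lambda>b. f (W b) / W b powr p - g (W b + b) / (W b + b) powr p * (1 + b / W b) powr p)
        \<longlongrightarrow> A - C1) (at_right 0)"
      using tendsto_diff[OF lim_fW tendsto_mult[OF lim_gU UW]] by simp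
    show "\<forall>\<^sub>F b in at_right 0. f (W b) / W b powr p - g (W b + b) / (W b + b) powr p * (1 + b / W b) powr p
        = b / W b powr p"
      using W_pos W_eq b_pos
    proof eventually_elim
      case (elim b)
      have "1 + b / W b = (W b + b) / W b" using elim by (simp add: field_simps)
      then have "g (W b + b) / (W b + b) powr p * (1 + b / W b) powr p = g (W b + b) / W b powr p"
        using elim by (simp add: powr_divide)
      then show ?case using elim by (simp add: diff_divide_distrib[symmetric])
    qed
  qed
  from tendsto_powr[OF this tendsto_const, of "- (1 / p)"]
  have "((\<lambda>b. (b / W b powr p) powr - (1 / p)) \<longlongrightarrow> (A - C1) powr - (1 / p)) (at_right 0)"
    using C1 by simp
  moreover have "\<forall>\<^sub>F b in at_right 0. (b / W b powr p) powr - (1 / p) = W b / b powr (1 / p)"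
    using W_pos b_pos
    by eventually_elim (use assms in \<open>simp add: powr_minus powr_divide powr_powr\<close>)
  moreover have "(A - C1) powr - (1 / p) = 1 / (A - C1) powr (1 / p)"
    by (simp add: powr_minus field_simps)
  ultimately show ?thesis by (auto intro: Lim_transform_eventually)
qed

lemma branch_asymp_eq_1:
  assumes "p = 1"
  shows "((\<lambda>b. W b / b) \<longlongrightarrow> (1 + C1) / (A - C1)) (at_right 0)"
proof (rule Lim_transform_eventually)
  let ?f = "\<lambda>b. f (W b) / W b powr p" and ?g = "\<lambda>b. g (W b + b) / (W b + b) powr p"
  show "((\<lambda>b. (1 + ?g b) / (?f b - ?g b)) \<longlongrightarrow> (1 + C1) / (A - C1)) (at_right 0)"
    by (intro tendsto_intros lim_fW lim_gU) (use C1 in simp)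
  have "\<forall>\<^sub>F b in at_right 0. 0 < ?f b - ?g b"
    by (rule order_tendstoD(1)[OF tendsto_diff[OF lim_fW lim_gU]]) (use C1 in simp)
  then show "\<forall>\<^sub>F b in at_right 0. (1 + ?g b) / (?f b - ?g b) = W b / b"
    using W_pos W_eq b_pos
  proof eventually_elim
    case (elim b)
    have "?f b * W b = b + ?g b * (W b + b)" using elim assms by simp
    \<comment> \<open>With the quotients treated as coefficients F and G the equation is linear in w
      and is solved exactly; the limit is taken afterwards.\<close>
    moreover have "F * w = b + G * (w + b) \<Longrightarrow> 0 < F - G \<Longrightarrow> (1 + G) / (F - G) = w / b" for F G w :: real
      using \<open>0 < b\<close> by (simp add: field_simps)
    ultimately show ?case using elim(1) by blast
  qed
qed

text \<open>Now b is negligible against \<open>(W b + b) powr p\<close>. Dividing by this power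
  gives the limit of the ratio W b / (W b + b), which is below 1 because C1 < A; the ratio W b / b
  is a function of it. For p < m the limit is 0.\<close>

lemma branch_asymp_lt_1:
  assumes "p < 1"
  shows "((\<lambda>b. W b / b) \<longlongrightarrow> (C1 / A) powr (1 / p) / (1 - (C1 / A) powr (1 / p))) (at_right 0)"
proof -
  let ?U = "\<lambda>b. W b + b"
  have bU: "((\<lambda>b. b / ?U b powr p) \<longlongrightarrow> 0) (at_right 0)"
  proof (rule tendsto_sandwich)
    show "\<forall>\<^sub>F b in at_right 0. b / ?U b powr p \<le> ?U b powr (1 - p)"
      using W_pos b_pos by eventually_elim (simp add: powr_diff divide_right_mono)
    show "\<forall>\<^sub>F b in at_right 0. 0 \<le> b / ?U b powr p"
      using b_pos by eventually_elim simp
    show "((\<lambda>b. ?U b powr (1 - p)) \<longlongrightarrow> 0) (at_right 0)"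
      by (rule filterlim_compose[OF powr_tendsto_0_at_right filterlim_U]) (use assms in simp)
  qed simp
  have "((\<lambda>b. (W b / ?U b) powr p) \<longlongrightarrow> C1 / A) (at_right 0)"
  proof (rule Lim_transform_eventually)
    show "((\<lambda>b. (b / ?U b powr p + g (?U b) / ?U b powr p) / (f (W b) / W b powr p)) \<longlongrightarrow> C1 / A)
        (at_right 0)"
      using tendsto_divide[OF tendsto_add[OF bU lim_gU] lim_fW] pos by simp
    have "\<forall>\<^sub>F b in at_right 0. 0 < f (W b) / W b powr p"
      by (rule order_tendstoD(1)[OF lim_fW]) (rule pos)
    then show "\<forall>\<^sub>F b in at_right 0.
        (b / ?U b powr p + g (?U b) / ?U b powr p) / (f (W b) / W b powr p) = (W b / ?U b) powr p"
      using W_pos W_eq b_pos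
    proof eventually_elim
      case (elim b)
      have "b / ?U b powr p + g (?U b) / ?U b powr p = f (W b) / ?U b powr p"
        using elim by (simp add: add_divide_distrib)
      moreover have "f (W b) \<noteq> 0" using elim by auto
      ultimately show ?case using elim by (simp add: powr_divide)
    qed
  qed
  \<comment> \<open>The variant with nonnegative base is needed because C1 / A is 0 when p <
    m.\<close>
  from tendsto_powr'[OF this tendsto_const, of "1 / p"]
  have "((\<lambda>b. ((W b / ?U b) powr p) powr (1 / p)) \<longlongrightarrow> (C1 / A) powr (1 / p)) (at_right 0)"
    using pos by (simp add: always_eventually)
  moreover have "\<forall>\<^sub>F b in at_right 0. ((W b / ?U b) powr p) powr (1 / p) = W b / ?U b"
    using W_pos b_pos by eventually_elim (use pos in \<open>simp add: powr_powr\<close>)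
  ultimately have lam: "((\<lambda>b. W b / ?U b) \<longlongrightarrow> (C1 / A) powr (1 / p)) (at_right 0)"
    by (rule Lim_transform_eventually)
  have "(C1 / A) powr (1 / p) < 1"
    using powr_less_mono2[of "1 / p" "C1 / A" 1] C1 pos by simp
  then have "((\<lambda>b. (W b / ?U b) / (1 - W b / ?U b)) \<longlongrightarrow>
      (C1 / A) powr (1 / p) / (1 - (C1 / A) powr (1 / p))) (at_right 0)"
    by (intro tendsto_intros lam) simp
  moreover have "\<forall>\<^sub>F b in at_right 0. (W b / ?U b) / (1 - W b / ?U b) = W b / b"
    using W_pos b_pos
  proof eventually_elim
    case (elim b)
    have "1 - W b / ?U b = b / ?U b" using elim by (simp add: field_simps)
    then show ?case using elim by simp
  qed
  ultimately show ?thesis by (rule Lim_transform_eventually)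
qed

text \<open>The case \<mu> = 1, where the abscissa is W b + b. The added b vanishes against
  \<open>b powr (1 / p)\<close> for p > 1 and adds 1 to the coefficient for p \<le> 1, turning (1 +
  C1) / (A - C1) into (1 + A) / (A - C1) and \<Lambda> / (1 - \<Lambda>) into 1 / (1 -
  \<Lambda>).\<close>

lemma shifted_position:
  assumes V: "\<bar>V\<bar> = A - C1"
  shows "((\<lambda>b. (W b + b) / b powr position_exponent p m) \<longlongrightarrow>
    position_coefficient V (- A) (- C) p m) (at_right 0)"
proof -
  have mn: "min p m = p" using dominated by auto
  consider "p > 1" | "p = 1" | "p < 1" by linarith
  then show ?thesis
  proof cases
    case 1
    have "((\<lambda>b. W b / b powr (1 / p) + b powr (1 - 1 / p)) \<longlongrightarrow> 1 / (A - C1) powr (1 / p)) (at_right 0)"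
      using tendsto_add[OF branch_asymp_gt_1[OF 1] powr_tendsto_0_at_right[of "1 - 1 / p"]] 1 by simp
    moreover have "\<forall>\<^sub>F b in at_right 0. W b / b powr (1 / p) + b powr (1 - 1 / p) =
        (W b + b) / b powr position_exponent p m"
      using b_pos
      by eventually_elim (use 1 mn in \<open>simp add: position_exponent_def powr_diff add_divide_distrib\<close>)
    moreover have "position_coefficient V (- A) (- C) p m = 1 / (A - C1) powr (1 / p)"
      using 1 mn V by (simp add: position_coefficient_def)
    ultimately show ?thesis by (simp add: Lim_transform_eventually)
  next
    case 2
    have "((\<lambda>b. W b / b + 1) \<longlongrightarrow> (1 + C1) / (A - C1) + 1) (at_right 0)"
      by (intro tendsto_intros branch_asymp_eq_1[OF 2])
    moreover have "\<forall>\<^sub>F b in at_right 0. W b / b + 1 = (W b + b) / b powr position_exponent p m"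
      using b_pos
      by eventually_elim (use 2 mn in \<open>simp add: position_exponent_def add_divide_distrib\<close>)
    moreover have "position_coefficient V (- A) (- C) p m = (1 + C1) / (A - C1) + 1"
    proof -
      have "position_coefficient V (- A) (- C) p m = (1 + A) / (A - C1)"
        using 2 mn V by (simp add: position_coefficient_def)
      then show ?thesis using C1 by (simp add: field_simps)
    qed
    ultimately show ?thesis by (simp add: Lim_transform_eventually)
  next
    case 3
    define \<Lambda> where "\<Lambda> = (C1 / A) powr (1 / p)"
    have \<Lambda>: "\<Lambda> < 1"
      using powr_less_mono2[of "1 / p" "C1 / A" 1] C1 pos by (simp add: \<Lambda>_def)
    have "((\<lambda>b. W b / b + 1) \<longlongrightarrow> \<Lambda> / (1 - \<Lambda>) + 1) (at_right 0)"
      unfolding \<Lambda>_def by (intro tendsto_intros branch_asymp_lt_1[OF 3])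
    moreover have "\<forall>\<^sub>F b in at_right 0. W b / b + 1 = (W b + b) / b powr position_exponent p m"
      using b_pos
      by eventually_elim (use 3 mn in \<open>simp add: position_exponent_def add_divide_distrib\<close>)
    moreover have "position_coefficient V (- A) (- C) p m = \<Lambda> / (1 - \<Lambda>) + 1"
    proof (cases "p = m")
      case True
      have "\<Lambda> = C powr (1 / p) / A powr (1 / p)"
        using True pos unfolding \<Lambda>_def C1_def by (simp add: powr_divide)
      moreover have "C powr (1 / p) < A powr (1 / p)"
        using True dominated pos by (intro powr_less_mono2) auto
      moreover have "position_coefficient V (- A) (- C) p m =
          A powr (1 / p) / \<bar>A powr (1 / p) - C powr (1 / p)\<bar>"
        using True 3 pos by (simp add: position_coefficient_def)
      moreover have "y / \<bar>y - x\<bar> = x / y / (1 - x / y) + 1" if "0 < x" "x < y" for x y :: real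
        using that by (simp add: field_simps)
      note this[of "C powr (1 / p)" "A powr (1 / p)"]
      ultimately show ?thesis using pos by simp
    next
      case False
      then have "\<Lambda> = 0" by (simp add: \<Lambda>_def C1_def)
      then show ?thesis using False 3 dominated mn by (simp add: position_coefficient_def)
    qed
    ultimately show ?thesis by (simp add: Lim_transform_eventually)
  qed
qed

text \<open>The case \<mu> = - 1, where the abscissa is W b itself and \<open>\<phi>m\<close> is the
  dominating map; hence the exchanged order of the exponents and of the coefficients.\<close>

lemma unshifted_position:
  assumes V: "\<bar>V\<bar> = A - C1"
  shows "((\<lambda>b. W b / b powr position_exponent m p) \<longlongrightarrow>
    position_coefficient V (- C) (- A) m p) (at_right 0)"
proof -
  have mn: "min m p = p" and le: "p \<le> m" using dominated by auto
  consider "p > 1" | "p = 1" | "p < 1" by linarith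
  then show ?thesis
  proof cases
    case 1
    have "position_exponent m p = 1 / p" using 1 mn by (simp add: position_exponent_def)
    moreover have "position_coefficient V (- C) (- A) m p = 1 / (A - C1) powr (1 / p)"
      using 1 mn le V by (simp add: position_coefficient_def)
    ultimately show ?thesis using branch_asymp_gt_1[OF 1] by simp
  next
    case 2
    have "\<forall>\<^sub>F b in at_right 0. W b / b = W b / b powr position_exponent m p"
      using b_pos by eventually_elim (use 2 mn in \<open>simp add: position_exponent_def\<close>)
    moreover have "position_coefficient V (- C) (- A) m p = (1 + C1) / (A - C1)"
    proof (cases "p = m")
      case True
      then have "C1 = C" unfolding C1_def by simp
      then show ?thesis using 2 True V mn by (simp add: position_coefficient_def)
    next
      case False
      \<comment> \<open>With p = 1 < m the upper exponent is above 1, so the first branch of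
        \<open>position_coefficient\<close> applies, and it agrees with (1 + C1) / (A - C1) at C1 =
        0.\<close>
      then have "C1 = 0" "m > 1" using le 2 unfolding C1_def by auto
      then show ?thesis using 2 V mn by (simp add: position_coefficient_def)
    qed
    ultimately show ?thesis using branch_asymp_eq_1[OF 2] by (simp add: Lim_transform_eventually)
  next
    case 3
    define \<Lambda> where "\<Lambda> = (C1 / A) powr (1 / p)"
    have "\<forall>\<^sub>F b in at_right 0. W b / b = W b / b powr position_exponent m p"
      using b_pos by eventually_elim (use 3 mn in \<open>simp add: position_exponent_def\<close>)
    moreover have "position_coefficient V (- C) (- A) m p = \<Lambda> / (1 - \<Lambda>)"
    proof (cases "p = m")
      case True
      have "\<Lambda> = C powr (1 / p) / A powr (1 / p)"
        using True pos unfolding \<Lambda>_def C1_def by (simp add: powr_divide)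
      moreover have "C powr (1 / p) < A powr (1 / p)"
        using True dominated pos by (intro powr_less_mono2) auto
      moreover have "position_coefficient V (- C) (- A) m p =
          C powr (1 / p) / \<bar>C powr (1 / p) - A powr (1 / p)\<bar>"
        using True 3 pos by (simp add: position_coefficient_def)
      moreover have "x / \<bar>x - y\<bar> = x / y / (1 - x / y)" if "0 < x" "x < y" for x y :: real
        using that by (simp add: field_simps)
      note this[of "C powr (1 / p)" "A powr (1 / p)"]
      ultimately show ?thesis using pos by simp
    next
      case False
      then have "\<Lambda> = 0" by (simp add: \<Lambda>_def C1_def)
      moreover have "p < m" using False le by simp
      \<comment> \<open>This is the final branch of \<open>position_coefficient\<close>, with value
        0: the solution is o(b).\<close>
      ultimately show ?thesis using 3 mn by (simp add: position_coefficient_def)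
    qed
    ultimately show ?thesis using branch_asymp_lt_1[OF 3]
      by (simp add: Lim_transform_eventually \<Lambda>_def)
  qed
qed

text \<open>Since p \<le> m, exponents on opposite sides of 1 mean p < 1 < m, so C1 = 0. The two
  position formulas of the mixed case are this limit read for x = W b + b and for x = W b.\<close>

lemma mixed_position:
  assumes "(p - 1) * (m - 1) < 0"
  shows "((\<lambda>b. W b / b) \<longlongrightarrow> 0) (at_right 0)"
proof -
  have "p < 1" "p < m" using assms dominated by (auto simp: mult_less_0_iff)
  then show ?thesis using branch_asymp_lt_1 by (simp add: C1_def)
qed

end

end

section \<open>Return maps near a fixed point\<close>

text \<open>The return of u is the w with f w = g u. Locally w = h (g u) with h the inverse of f, so
  the multiplier is the quotient of the slopes; no derivative of a flow enters.\<close>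

lemma return_map_of_relation:
  fixes f g :: "real \<Rightarrow> real"
  assumes x: "x \<in> {c<..<d}" and cont: "continuous_on {c<..<d} f"
    and mono: "strict_antimono_on {c<..<d} f"
    and f: "(f has_real_derivative f0) (at x)" "f0 \<noteq> 0"
    and g: "(g has_real_derivative g0) (at x)" and fg: "f x = g x"
    and R: "\<And>u w w'. u \<in> {c<..<d} \<Longrightarrow> w \<in> {c<..<d} \<Longrightarrow> f w = g u \<Longrightarrow> R u w' \<longleftrightarrow> w' = w"
  shows "\<forall>\<^sub>F u in nhds x. \<exists>!w. R u w" and "(THE w. R x w) = x"
    and "((\<lambda>u. THE w. R u w) has_real_derivative g0 / f0) (at x)"
proof -
  have inj: "inj_on f {c<..<d}"
  proof (rule inj_onI)
    fix y z assume "y \<in> {c<..<d}" "z \<in> {c<..<d}" "f y = f z"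
    then show "y = z"
      using monotone_onD[OF mono, of y z] monotone_onD[OF mono, of z y]
      by (cases y z rule: linorder_cases) simp_all
  qed
  define h where "h = the_inv_into {c<..<d} f"
  have hf: "h (f z) = z" if "z \<in> {c<..<d}" for z
    unfolding h_def by (rule the_inv_into_f_f[OF inj that])
  define e where "e = min (x - c) (d - x) / 2"
  have e: "0 < e" "c < x - e" "x + e < d" using x by (auto simp: e_def min_def field_simps)
  have conth: "isCont h (f x)"
  proof (rule isCont_inverse_function[where f = f and g = h and x = x, OF e(1)])
    fix z assume "\<bar>z - x\<bar> \<le> e"
    then have z: "z \<in> {c<..<d}" using e by auto
    show "h (f z) = z" by (rule hf[OF z])
    show "isCont f z" using cont z by (simp add: continuous_on_eq_continuous_at)
  qed
  have less: "f (x + e) < f x" "f x < f (x - e)"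
    using mono e x by (auto simp: monotone_on_def)
  have surj: "h y \<in> {c<..<d} \<and> f (h y) = y" if y: "f (x + e) < y" "y < f (x - e)" for y
  proof -
    have "continuous_on {x - e..x + e} f" by (rule continuous_on_subset[OF cont]) (use e in auto)
    then obtain z where z: "x - e \<le> z" "z \<le> x + e" "f z = y"
      using IVT2'[of f "x + e" y "x - e"] y e by (metis add_le_cancel_left diff_le_eq less_eq_real_def order_trans add_increasing2)
    then have "z \<in> {c<..<d}" using e by auto
    with hf z show ?thesis by auto
  qed
  have "(h has_real_derivative inverse f0) (at (f x))"
  proof (rule DERIV_inverse_function[OF _ f(2) less])
    show "(f has_real_derivative f0) (at (h (f x)))" using f(1) hf[OF x] by simp
  qed (use surj conth in auto)
  then have "(h has_real_derivative inverse f0) (at (g x))" using fg by simp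
  from DERIV_chain2[OF this g]
  have comp: "((\<lambda>u. h (g u)) has_real_derivative g0 / f0) (at x)"
    by (simp add: divide_inverse mult.commute)
  have "isCont g x" using g by (rule DERIV_isCont)
  then have gx: "(g \<longlongrightarrow> g x) (nhds x)" by (simp add: isCont_def tendsto_nhds_iff)
  have near: "\<forall>\<^sub>F u in nhds x. u \<in> {c<..<d} \<and> f (x + e) < g u \<and> g u < f (x - e)"
  proof -
    have "\<forall>\<^sub>F u in nhds x. f (x + e) < g u" "\<forall>\<^sub>F u in nhds x. g u < f (x - e)"
      using less fg by (auto intro: order_tendstoD[OF gx])
    with eventually_nhds_in_open[OF open_greaterThanLessThan x]
    show ?thesis by eventually_elim blast
  qed
  have Rh: "R u w' \<longleftrightarrow> w' = h (g u)"
    if "u \<in> {c<..<d}" "f (x + e) < g u" "g u < f (x - e)" for u w'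
    using R[of u "h (g u)" w'] surj[of "g u"] that by auto
  show "\<forall>\<^sub>F u in nhds x. \<exists>!w. R u w"
    using near by eventually_elim (use Rh in auto)
  have the: "(THE w. R u w) = h (g u)"
    if "u \<in> {c<..<d}" "f (x + e) < g u" "g u < f (x - e)" for u
    using Rh[OF that] by (intro the_equality) auto
  show "(THE w. R x w) = x"
    using the[OF x] less fg hf[OF x] by simp
  show "((\<lambda>u. THE w. R u w) has_real_derivative g0 / f0) (at x)"
  proof (rule has_field_derivative_cong_eventually[THEN iffD1, OF _ _ comp])
    show "\<forall>\<^sub>F u in at x. h (g u) = (THE w. R u w)"
      unfolding eventually_at_filter using near by eventually_elim (use the in auto)
    show "h (g x) = (THE w. R x w)" using the[OF x] less fg by simp
  qed
qed

section \<open>Stability of a fixed point from its multiplier\<close>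

lemma contraction_iterates:
  fixes P :: "real \<Rightarrow> real"
  assumes P: "\<And>u. \<bar>u - x\<bar> < r \<Longrightarrow> \<bar>P u - x\<bar> \<le> c * \<bar>u - x\<bar>" and c: "0 \<le> c" "c < 1"
    and u: "\<bar>u - x\<bar> < r"
  shows "\<bar>(P ^^ n) u - x\<bar> \<le> c ^ n * \<bar>u - x\<bar>"
proof (induction n)
  case (Suc n)
  have "c ^ n * \<bar>u - x\<bar> \<le> 1 * \<bar>u - x\<bar>"
    using c by (intro mult_right_mono power_le_one) auto
  then have "\<bar>(P ^^ n) u - x\<bar> < r" using Suc u by simp
  then have "\<bar>(P ^^ Suc n) u - x\<bar> \<le> c * \<bar>(P ^^ n) u - x\<bar>" using P by simp
  also have "\<dots> \<le> c * (c ^ n * \<bar>u - x\<bar>)" using Suc c by (intro mult_left_mono) auto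
  finally show ?case by simp
qed simp

lemma derivative_quotient_tendsto:
  assumes "(P has_real_derivative D) (at x)" "P x = x"
  shows "((\<lambda>u. \<bar>P u - x\<bar> / \<bar>u - x\<bar>) \<longlongrightarrow> \<bar>D\<bar>) (at x)"
  using tendsto_rabs[of "\<lambda>u. (P u - P x) / (u - x)"] assms
  by (simp add: has_field_derivative_iff)

lemma stable_cycle_atI:
  assumes ex: "\<forall>\<^sub>F u in nhds x. \<exists>!w. first_return Xp Xm u w"
    and fix_x: "return_map Xp Xm x = x"
    and der: "(return_map Xp Xm has_real_derivative D) (at x)" and "0 \<le> D" "D < 1"
  shows "stable_cycle_at Xp Xm x"
proof -
  let ?P = "return_map Xp Xm"
  \<comment> \<open>A rate strictly between the multiplier and 1; near x every step contracts the
    distance by at least this factor, so the iterates never leave the region where the bound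
    holds.\<close>
  define c where "c = (D + 1) / 2"
  have c: "0 \<le> c" "c < 1" "\<bar>D\<bar> < c" using assms by (auto simp: c_def)
  have "\<forall>\<^sub>F u in at x. \<bar>?P u - x\<bar> / \<bar>u - x\<bar> < c"
    by (rule order_tendstoD(2)[OF derivative_quotient_tendsto[OF der fix_x] c(3)])
  then obtain r where r: "r > 0" "\<And>u. u \<noteq> x \<Longrightarrow> \<bar>u - x\<bar> < r \<Longrightarrow> \<bar>?P u - x\<bar> / \<bar>u - x\<bar> < c"
    unfolding eventually_at dist_real_def by auto
  have P: "\<bar>?P u - x\<bar> \<le> c * \<bar>u - x\<bar>" if "\<bar>u - x\<bar> < r" for u
  proof (cases "u = x")
    case False
    with r(2)[OF False that] show ?thesis by (simp add: divide_less_eq)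
  qed (simp add: fix_x)
  have it: "\<bar>(?P ^^ n) u - x\<bar> \<le> c ^ n * \<bar>u - x\<bar>" if "\<bar>u - x\<bar> < r" for n u
    by (rule contraction_iterates[OF P c(1,2) that])
  have near: "\<forall>\<^sub>F u in nhds x. \<bar>u - x\<bar> < s" if "s > 0" for s
    using that unfolding eventually_nhds_metric dist_real_def by auto
  show ?thesis unfolding stable_cycle_at_def
  proof (intro conjI allI impI ex)
    fix \<epsilon> :: real assume "\<epsilon> > 0"
    then have "0 < min r \<epsilon>" using r by simp
    from near[OF this] show "\<forall>\<^sub>F u in nhds x. \<forall>n. \<bar>(?P ^^ n) u - x\<bar> < \<epsilon>"
    proof eventually_elim
      case (elim u)
      show ?case
      proof
        fix n
        have "c ^ n * \<bar>u - x\<bar> \<le> 1 * \<bar>u - x\<bar>"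
          using c by (intro mult_right_mono power_le_one) auto
        then show "\<bar>(?P ^^ n) u - x\<bar> < \<epsilon>" using it[of u n] elim by (auto simp del: mult_1)
      qed
    qed
  next
    show "\<forall>\<^sub>F u in nhds x. (\<lambda>n. (?P ^^ n) u) \<longlonglongrightarrow> x"
      using near[OF r(1)]
    proof eventually_elim
      case (elim u)
      have "(\<lambda>n. c ^ n * \<bar>u - x\<bar>) \<longlonglongrightarrow> 0"
        using tendsto_mult_left_zero[OF LIMSEQ_power_zero[of c]] c by simp
      then have "(\<lambda>n. (?P ^^ n) u - x) \<longlonglongrightarrow> 0"
        by (rule Lim_null_comparison[rotated]) (use it[OF elim] in simp)
      then show ?case by (simp add: LIM_zero_iff)
    qed
  qed
qed

lemma unstable_cycle_atI:
  assumes ex: "\<forall>\<^sub>F u in nhds x. \<exists>!w. first_return Xp Xm u w"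
    and fix_x: "return_map Xp Xm x = x"
    and der: "(return_map Xp Xm has_real_derivative D) (at x)" and "1 < D"
  shows "unstable_cycle_at Xp Xm x"
proof -
  let ?P = "return_map Xp Xm"
  define c where "c = (D + 1) / 2"
  have c: "1 < c" "c < \<bar>D\<bar>" using assms by (auto simp: c_def)
  have "\<forall>\<^sub>F u in at x. c < \<bar>?P u - x\<bar> / \<bar>u - x\<bar>"
    by (rule order_tendstoD(1)[OF derivative_quotient_tendsto[OF der fix_x] c(2)])
  then obtain r where r: "r > 0" "\<And>u. u \<noteq> x \<Longrightarrow> \<bar>u - x\<bar> < r \<Longrightarrow> c < \<bar>?P u - x\<bar> / \<bar>u - x\<bar>"
    unfolding eventually_at dist_real_def by auto
  have P: "c * \<bar>u - x\<bar> \<le> \<bar>?P u - x\<bar>" if "\<bar>u - x\<bar> < r" for u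
  proof (cases "u = x")
    case False
    with r(2)[OF False that] show ?thesis by (simp add: less_divide_eq)
  qed simp
  obtain s where s: "s > 0" "\<And>u. \<bar>u - x\<bar> < s \<Longrightarrow> \<exists>!w. first_return Xp Xm u w"
    using ex unfolding eventually_nhds_metric dist_real_def by auto
  define \<epsilon> where "\<epsilon> = min r s"
  have "\<exists>n. \<epsilon> \<le> \<bar>(?P ^^ n) u - x\<bar>" if u: "0 < \<bar>u - x\<bar>" for u
  proof (rule ccontr)
    \<comment> \<open>As long as the iterates stay within \<epsilon>, the expansion bound applies at
      each step and the distance grows geometrically, which is incompatible with staying.\<close>
    assume "\<not> ?thesis"
    then have small: "\<bar>(?P ^^ n) u - x\<bar> < \<epsilon>" for n by (simp add: not_le)
    have grow: "c ^ n * \<bar>u - x\<bar> \<le> \<bar>(?P ^^ n) u - x\<bar>" for n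
    proof (induction n)
      case (Suc n)
      have "c * (c ^ n * \<bar>u - x\<bar>) \<le> c * \<bar>(?P ^^ n) u - x\<bar>" using Suc c by simp
      also have "\<dots> \<le> \<bar>?P ((?P ^^ n) u) - x\<bar>" using P small[of n] by (simp add: \<epsilon>_def)
      finally show ?case by simp
    qed simp
    obtain n where "\<epsilon> / \<bar>u - x\<bar> < c ^ n" using real_arch_pow[OF c(1)] by blast
    then have "\<epsilon> < c ^ n * \<bar>u - x\<bar>" using u by (simp add: pos_divide_less_eq)
    with grow[of n] small[of n] show False by simp
  qed
  then show ?thesis unfolding unstable_cycle_at_def
    using r s by (intro exI[of _ \<epsilon>]) (auto simp: \<epsilon>_def)
qed

section \<open>Crossing periodic orbits\<close>

lemma arc_relationD:
  assumes "arc_relation C a \<phi>"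
  shows "continuous_on {0..<a} \<phi>" "\<phi> 0 = 0"
    and "\<And>x y. 0 \<le> x \<Longrightarrow> x < y \<Longrightarrow> y < a \<Longrightarrow> \<phi> y < \<phi> x"
    and "\<And>x. 0 < x \<Longrightarrow> x < a \<Longrightarrow> \<phi> x < 0"
    and "\<And>u v. 0 < u \<Longrightarrow> u < a \<Longrightarrow> C u v \<longleftrightarrow> v = \<phi> u"
    and "\<And>u v. 0 < u \<Longrightarrow> u < a \<Longrightarrow> C v (\<phi> u) \<longleftrightarrow> v = u"
    and "\<And>u v. 0 < u \<Longrightarrow> u < a \<Longrightarrow> \<not> C v u"
    and "\<And>u v. 0 < u \<Longrightarrow> u < a \<Longrightarrow> \<not> C (\<phi> u) v"
proof -
  show less: "\<phi> y < \<phi> x" if "0 \<le> x" "x < y" "y < a" for x y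
    using assms that unfolding arc_relation_def monotone_on_def by simp
  show zero: "\<phi> 0 = 0" using assms unfolding arc_relation_def by simp
  show "\<phi> x < 0" if "0 < x" "x < a" for x using less[of 0 x] that zero by simp
qed (use assms in \<open>simp_all add: arc_relation_def\<close>)

lemma arc_relation_preimage:
  assumes rel: "arc_relation C a \<phi>" and c: "0 < c" "c < a" and y: "\<phi> c < y" "y < 0"
  obtains z where "0 < z" "z < c" "\<phi> z = y"
proof -
  have "continuous_on {0..c} \<phi>"
    by (rule continuous_on_subset[OF arc_relationD(1)[OF rel]]) (use c in auto)
  then obtain z where z: "0 \<le> z" "z \<le> c" "\<phi> z = y"
    using IVT2'[of \<phi> c y 0] arc_relationD(2)[OF rel] c y by (metis less_eq_real_def)
  moreover have "z \<noteq> 0" "z \<noteq> c" using z y arc_relationD(2)[OF rel] by auto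
  ultimately show ?thesis using that[of z] by simp
qed

lemma arc_relation_small:
  assumes rel: "arc_relation C a \<phi>" and "0 < a" "0 < e"
  obtains c where "0 < c" "c < a" "c < e" "\<And>x. 0 \<le> x \<Longrightarrow> x \<le> c \<Longrightarrow> \<bar>\<phi> x\<bar> < e"
proof -
  obtain d where d: "d > 0" "\<And>x. x \<in> {0..<a} \<Longrightarrow> dist x 0 < d \<Longrightarrow> dist (\<phi> x) (\<phi> 0) < e"
    using arc_relationD(1)[OF rel] assms unfolding continuous_on_iff by (metis atLeastLessThan_iff order_refl)
  define c where "c = min (min a e) d / 2"
  have "0 < c" "c < a" "c < e" "c < d" using assms d by (auto simp: c_def)
  moreover have "\<bar>\<phi> x\<bar> < e" if "0 \<le> x" "x \<le> c" for x
    using d(2)[of x] that \<open>c < a\<close> \<open>c < d\<close> arc_relationD(2)[OF rel] by (simp add: dist_real_def)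
  ultimately show ?thesis using that by blast
qed

lemma arc_relation_local:
  assumes rel: "arc_relation C a \<phi>" and "0 < a"
  obtains N where "0 < N" "N \<le> a"
    "\<And>u v. \<bar>u\<bar> < N \<Longrightarrow> \<bar>v\<bar> < N \<Longrightarrow> C u v \<Longrightarrow> (u = 0 \<and> v = 0) \<or> (0 < u \<and> v = \<phi> u)"
proof -
  note D = arc_relationD[OF rel]
  \<comment> \<open>With this radius every y in (- N, 0) is a value \<open>\<phi> z\<close>, so the
    relation is determined at each nonzero point of the window, on both sides of the origin.\<close>
  define N where "N = min a (- \<phi> (a / 2))"
  have N: "0 < N" "N \<le> a" using D(4)[of "a / 2"] assms by (auto simp: N_def)
  have neg: "\<exists>z. 0 < z \<and> z < a \<and> \<phi> z = y" if "- N < y" "y < 0" for y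
  proof (rule arc_relation_preimage[OF rel])
    show "0 < a / 2" "a / 2 < a" using assms by auto
    show "\<phi> (a / 2) < y" "y < 0" using that by (auto simp: N_def)
    fix z assume "0 < z" "z < a / 2" "\<phi> z = y"
    then show ?thesis using assms by (intro exI[of _ z]) simp
  qed
  have "(u = 0 \<and> v = 0) \<or> (0 < u \<and> v = \<phi> u)" if uv: "\<bar>u\<bar> < N" "\<bar>v\<bar> < N" and C: "C u v" for u v
  proof -
    have "\<not> u < 0"
    proof
      assume "u < 0"
      then obtain z where "0 < z" "z < a" "\<phi> z = u" using neg[of u] uv by auto
      then show False using D(8)[of z v] C by simp
    qed
    moreover have "v = \<phi> u" if "0 < u" using D(5)[of u v] that uv N C by simp
    moreover have "v = 0" if "u = 0"
    proof -
      have "\<not> 0 < v" using D(7)[of v u] uv N C by auto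
      moreover have "\<not> v < 0"
      proof
        assume "v < 0"
        then obtain z where "0 < z" "z < a" "\<phi> z = v" using neg[of v] uv by auto
        then show False using D(6)[of z u] C \<open>u = 0\<close> by simp
      qed
      ultimately show ?thesis by simp
    qed
    ultimately show ?thesis by linarith
  qed
  with N that show ?thesis by blast
qed

text \<open>A loop of either field would force u = v. The other arc would then be a loop too, which
  requires b = 0, or it would join a positive abscissa to a negative one, which is impossible for u
  = v.\<close>

lemma crossing_pairs_local:
  assumes relm: "arc_relation Cm a \<phi>m" and relp: "arc_relation Cp a \<phi>p" and "0 < a"
  obtains e where "0 < e" "2 * e \<le> a"
    "\<And>b u v. b \<noteq> 0 \<Longrightarrow> \<bar>b\<bar> < e \<Longrightarrow> \<bar>u\<bar> < e \<Longrightarrow> \<bar>v\<bar> < e \<Longrightarrow> Cm u v \<Longrightarrow> Cp (u - b) (v - b) \<Longrightarrow>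
      0 < u \<and> b < u \<and> v = \<phi>m u \<and> \<phi>m u = b + \<phi>p (u - b)"
proof -
  obtain Nm where Nm: "0 < Nm" "Nm \<le> a"
    "\<And>u v. \<bar>u\<bar> < Nm \<Longrightarrow> \<bar>v\<bar> < Nm \<Longrightarrow> Cm u v \<Longrightarrow> (u = 0 \<and> v = 0) \<or> (0 < u \<and> v = \<phi>m u)"
    using arc_relation_local[OF relm \<open>0 < a\<close>] by blast
  obtain Np where Np: "0 < Np" "Np \<le> a"
    "\<And>u v. \<bar>u\<bar> < Np \<Longrightarrow> \<bar>v\<bar> < Np \<Longrightarrow> Cp u v \<Longrightarrow> (u = 0 \<and> v = 0) \<or> (0 < u \<and> v = \<phi>p u)"
    using arc_relation_local[OF relp \<open>0 < a\<close>] by blast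
  \<comment> \<open>Half of the common radius, because the upper arc is evaluated at u - b and v -
    b.\<close>
  define e where "e = min Nm Np / 2"
  have e: "0 < e" "2 * e \<le> a" "2 * e \<le> Nm" "2 * e \<le> Np" using Nm Np by (auto simp: e_def)
  have "0 < u \<and> b < u \<and> v = \<phi>m u \<and> \<phi>m u = b + \<phi>p (u - b)"
    if b: "b \<noteq> 0" "\<bar>b\<bar> < e" and uv: "\<bar>u\<bar> < e" "\<bar>v\<bar> < e" and C: "Cm u v" "Cp (u - b) (v - b)" for b u v
  proof -
    have 1: "(u = 0 \<and> v = 0) \<or> (0 < u \<and> v = \<phi>m u)"
      by (rule Nm(3)) (use uv e C in auto)
    have 2: "(u - b = 0 \<and> v - b = 0) \<or> (0 < u - b \<and> v - b = \<phi>p (u - b))"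
      by (rule Np(3)) (use uv b e C in auto)
    have neg: "\<phi>m u < 0" if "0 < u" using arc_relationD(4)[OF relm, of u] that uv e by simp
    have "\<phi>p (u - b) < 0" if "0 < u - b"
      using arc_relationD(4)[OF relp, of "u - b"] that uv b e by simp
    with 1 2 neg b(1) show ?thesis by auto
  qed
  with e that show ?thesis by blast
qed

text \<open>Arcs may be large, so one intersection on the section must be shown to force the other
  near the origin. At positive abscissas the lower relation does this. If u or v is 0 it says
  nothing, and the upper relation is used at - b \<noteq> 0 instead.\<close>

lemma crossing_pairs_through_section:
  assumes relm: "arc_relation Cm a \<phi>m" and relp: "arc_relation Cp a \<phi>p" and "0 < a" "0 < e"
  obtains x1 b1 where "0 < x1" "x1 \<le> a" "0 < b1"
    "\<And>b u v. b \<noteq> 0 \<Longrightarrow> \<bar>b\<bar> < b1 \<Longrightarrow> Cm u v \<Longrightarrow> Cp (u - b) (v - b) \<Longrightarrow>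
      u \<in> {0..<x1} \<or> v \<in> {0..<x1} \<Longrightarrow> \<bar>u\<bar> < e \<and> \<bar>v\<bar> < e"
proof -
  note Dm = arc_relationD[OF relm] and Dp = arc_relationD[OF relp]
  obtain c where c: "0 < c" "c < a" "c < e" "\<And>x. 0 \<le> x \<Longrightarrow> x \<le> c \<Longrightarrow> \<bar>\<phi>m x\<bar> < e"
    using arc_relation_small[OF relm \<open>0 < a\<close> \<open>0 < e\<close>] by blast
  have "0 < e / 2" using \<open>0 < e\<close> by simp
  then obtain d where d: "0 < d" "d < a" "d < e / 2" "\<And>x. 0 \<le> x \<Longrightarrow> x \<le> d \<Longrightarrow> \<bar>\<phi>p x\<bar> < e / 2"
    using arc_relation_small[OF relp \<open>0 < a\<close>] by blast
  \<comment> \<open>Then - b, when negative, lies above \<open>\<phi>p d\<close> and so is a value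
    of \<open>\<phi>p\<close> at some point of (0, d); when positive, it is itself in (0,
    d).\<close>
  define b1 where "b1 = min d (- \<phi>p d)"
  have b1: "0 < b1" "b1 \<le> d" "b1 \<le> - \<phi>p d" using d Dp(4)[of d] by (auto simp: b1_def)
  have "\<bar>u\<bar> < e \<and> \<bar>v\<bar> < e"
    if b: "b \<noteq> 0" "\<bar>b\<bar> < b1" and C: "Cm u v" "Cp (u - b) (v - b)"
      and uv: "u \<in> {0..<c} \<or> v \<in> {0..<c}" for b u v
  proof -
    have neg: "\<exists>z. 0 < z \<and> z < d \<and> \<phi>p z = - b" if "- b < 0"
      using arc_relation_preimage[OF relp d(1,2), of "- b"] that b b1 by fastforce
    consider "0 < u" "u < c" | "u = 0" | "0 < v" "v < c" | "v = 0" using uv by fastforce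
    then show ?thesis
    proof cases
      case 1
      then show ?thesis using Dm(5)[of u v] C c by simp
    next
      case 2
      have "\<not> - b < 0"
      proof
        assume "- b < 0"
        then obtain z where z: "0 < z" "z < d" "\<phi>p z = - b" using neg by blast
        then show False using Dp(8)[of z "v - b"] C(2) 2 d by simp
      qed
      then have nb: "0 < - b" using b by simp
      then have "v - b = \<phi>p (- b)" using Dp(5)[of "- b" "v - b"] C(2) 2 b b1 d by simp
      moreover have "\<bar>\<phi>p (- b)\<bar> < e / 2" using nb b b1 by (intro d(4)) auto
      ultimately show ?thesis using 2 b b1 d \<open>0 < e\<close> by linarith
    next
      case 3
      then show ?thesis using Dm(7)[of v u] C c by simp
    next
      case 4
      have "\<not> 0 < - b"
      proof
        assume "0 < - b"
        then show False using Dp(7)[of "- b" "u - b"] C(2) 4 b b1 d by simp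
      qed
      then obtain z where z: "0 < z" "z < d" "\<phi>p z = - b" using neg b by force
      then have "u - b = z" using Dp(6)[of z "u - b"] C(2) 4 d by simp
      then show ?thesis using z 4 b b1 d \<open>0 < e\<close> by auto
    qed
  qed
  with c b1 that[of c b1] show ?thesis by force
qed

section \<open>Periodic orbits as pairs of arcs, and their trace on the line\<close>

definition orbit_through ::
    "vfield \<Rightarrow> vfield \<Rightarrow> real \<Rightarrow> real \<Rightarrow> (real \<times> real) set \<Rightarrow> bool"
  where "orbit_through Xp Xm c d \<Gamma> \<longleftrightarrow>
    (\<exists>Tp \<gamma>p Tm \<gamma>m. half_arc Xp Sigma_up Tp \<gamma>p \<and> half_arc Xm Sigma_down Tm \<gamma>m \<and>
       \<gamma>m 0 = (c, 0) \<and> \<gamma>m Tm = (d, 0) \<and> \<gamma>p 0 = (d, 0) \<and> \<gamma>p Tp = (c, 0) \<and>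
       \<Gamma> = \<gamma>p ` {0..Tp} \<union> \<gamma>m ` {0..Tm})"

lemma crossing_periodic_orbit_iff:
  "crossing_periodic_orbit Xp Xm \<Gamma> \<longleftrightarrow> (\<exists>c d. orbit_through Xp Xm c d \<Gamma>)"
proof
  assume "crossing_periodic_orbit Xp Xm \<Gamma>"
  then obtain Tp \<gamma>p Tm \<gamma>m where *: "half_arc Xp Sigma_up Tp \<gamma>p" "half_arc Xm Sigma_down Tm \<gamma>m"
    "\<gamma>p Tp = \<gamma>m 0" "\<gamma>m Tm = \<gamma>p 0" "\<Gamma> = \<gamma>p ` {0..Tp} \<union> \<gamma>m ` {0..Tm}"
    unfolding crossing_periodic_orbit_def by blast
  moreover have "\<gamma>m 0 = (fst (\<gamma>m 0), 0)" "\<gamma>p 0 = (fst (\<gamma>p 0), 0)"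
    using *(1,2) by (auto simp: half_arc_def Sigma_line_def prod_eq_iff)
  ultimately show "\<exists>c d. orbit_through Xp Xm c d \<Gamma>"
    unfolding orbit_through_def by metis
next
  assume "\<exists>c d. orbit_through Xp Xm c d \<Gamma>"
  then show "crossing_periodic_orbit Xp Xm \<Gamma>"
    unfolding orbit_through_def crossing_periodic_orbit_def by metis
qed

lemma orbit_through_connects:
  assumes "orbit_through Xp Xm c d \<Gamma>"
  shows "connects Xm Sigma_down c d" "connects Xp Sigma_up d c"
  using assms unfolding orbit_through_def connects_def by blast+

lemma half_arc_inter_line:
  assumes "half_arc Z S T \<gamma>"
  shows "\<gamma> ` {0..T} \<inter> Sigma_line = {\<gamma> 0, \<gamma> T}"
proof
  show "\<gamma> ` {0..T} \<inter> Sigma_line \<subseteq> {\<gamma> 0, \<gamma> T}"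
  proof
    fix q assume "q \<in> \<gamma> ` {0..T} \<inter> Sigma_line"
    then obtain t where t: "t \<in> {0..T}" "q = \<gamma> t" "\<gamma> t \<in> Sigma_line" by blast
    then have "t \<notin> {0<..<T}" using assms unfolding half_arc_def by blast
    then have "t = 0 \<or> t = T" using t(1) by auto
    then show "q \<in> {\<gamma> 0, \<gamma> T}" using t(2) by blast
  qed
  show "{\<gamma> 0, \<gamma> T} \<subseteq> \<gamma> ` {0..T} \<inter> Sigma_line" using assms by (auto simp: half_arc_def)
qed

lemma orbit_through_inter_line:
  assumes "orbit_through Xp Xm c d \<Gamma>"
  shows "\<Gamma> \<inter> Sigma_line = {(c, 0), (d, 0)}"
proof -
  obtain Tp \<gamma>p Tm \<gamma>m where *: "half_arc Xp Sigma_up Tp \<gamma>p" "half_arc Xm Sigma_down Tm \<gamma>m"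
    "\<gamma>m 0 = (c, 0)" "\<gamma>m Tm = (d, 0)" "\<gamma>p 0 = (d, 0)" "\<gamma>p Tp = (c, 0)"
    "\<Gamma> = \<gamma>p ` {0..Tp} \<union> \<gamma>m ` {0..Tm}"
    using assms unfolding orbit_through_def by blast
  show ?thesis
    unfolding *(7) Int_Un_distrib2 half_arc_inter_line[OF *(1)] half_arc_inter_line[OF *(2)] *(3-6)
    by blast
qed

lemma orbit_through_exists:
  assumes "connects Xm Sigma_down c d" "connects Xp Sigma_up d c"
  shows "\<exists>\<Gamma>. orbit_through Xp Xm c d \<Gamma>"
  using assms unfolding orbit_through_def connects_def by blast

lemma Sigma_line_subset: "Sigma_line \<subseteq> Sigma_up" "Sigma_line \<subseteq> Sigma_down"
  by (auto simp: Sigma_line_def Sigma_up_def Sigma_down_def)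

lemma half_arc_image_unique:
  assumes "local_lipschitz (UNIV :: real set) S (\<lambda>_. Z)" "S = Sigma_up \<or> S = Sigma_down"
    and "half_arc (shift_x b Z) S T \<gamma>" "half_arc (shift_x b Z) S T' \<gamma>'" "\<gamma> 0 = \<gamma>' 0"
  shows "\<gamma> ` {0..T} = \<gamma>' ` {0..T'}"
proof -
  have S: "Sigma_line \<subseteq> S" using assms(2) Sigma_line_subset by auto
  note arcs = assms(3,4)[unfolded half_arc_shift[OF assms(2)]]
  have "T = T'" and eq: "\<And>t. t \<in> {0..T} \<Longrightarrow> \<gamma> t - (b, 0) = \<gamma>' t - (b, 0)"
    using half_arc_unique[OF assms(1) S arcs] assms(5) by auto
  then show ?thesis by (metis (no_types, lifting) diff_add_cancel image_cong)
qed

lemma orbit_through_unique: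
  assumes lip: "local_lipschitz (UNIV :: real set) Sigma_up (\<lambda>_. Zp)"
      "local_lipschitz (UNIV :: real set) Sigma_down (\<lambda>_. Zm)"
    and "orbit_through (shift_x b Zp) Zm c d \<Gamma>" "orbit_through (shift_x b Zp) Zm c d \<Gamma>'"
  shows "\<Gamma> = \<Gamma>'"
proof -
  \<comment> \<open>The lower field is seen as shifted by 0, so one uniqueness lemma serves both
    arcs.\<close>
  have shift0: "shift_x 0 Zm = Zm" by (simp add: shift_x_def fun_eq_iff)
  obtain Tp \<gamma>p Tm \<gamma>m where 1: "half_arc (shift_x b Zp) Sigma_up Tp \<gamma>p" "half_arc Zm Sigma_down Tm \<gamma>m"
    "\<gamma>m 0 = (c, 0)" "\<gamma>p 0 = (d, 0)" "\<Gamma> = \<gamma>p ` {0..Tp} \<union> \<gamma>m ` {0..Tm}"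
    using assms(3) unfolding orbit_through_def by blast
  obtain Tp' \<gamma>p' Tm' \<gamma>m' where 2: "half_arc (shift_x b Zp) Sigma_up Tp' \<gamma>p'" "half_arc Zm Sigma_down Tm' \<gamma>m'"
    "\<gamma>m' 0 = (c, 0)" "\<gamma>p' 0 = (d, 0)" "\<Gamma>' = \<gamma>p' ` {0..Tp'} \<union> \<gamma>m' ` {0..Tm'}"
    using assms(4) unfolding orbit_through_def by blast
  have "\<gamma>p ` {0..Tp} = \<gamma>p' ` {0..Tp'}"
    by (rule half_arc_image_unique[OF lip(1) _ 1(1) 2(1)]) (use 1 2 in auto)
  moreover have "\<gamma>m ` {0..Tm} = \<gamma>m' ` {0..Tm'}"
    by (rule half_arc_image_unique[OF lip(2), of 0]) (use 1 2 shift0 in auto)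
  ultimately show ?thesis using 1 2 by simp
qed

lemma return_map_derivative_imp:
  assumes "\<forall>\<^sub>F u in nhds x. \<exists>!w. first_return Xp Xm u w" "return_map Xp Xm x = x"
    and "(return_map Xp Xm has_real_derivative D) (at x)" "0 \<le> D" "D \<noteq> 1"
  shows "hyperbolic_cycle_at Xp Xm x" "D < 1 \<Longrightarrow> stable_cycle_at Xp Xm x"
    "1 < D \<Longrightarrow> unstable_cycle_at Xp Xm x"
proof -
  show "hyperbolic_cycle_at Xp Xm x" unfolding hyperbolic_cycle_at_def using assms by blast
  show "stable_cycle_at Xp Xm x" if "D < 1" by (rule stable_cycle_atI[OF assms(1-4) that])
  show "unstable_cycle_at Xp Xm x" if "1 < D" by (rule unstable_cycle_atI[OF assms(1-3) that])
qed

text \<open>For \<open>\<delta> = 1\<close> trajectories run from \<open>(u, 0)\<close> through \<open>y < 0\<close> to \<open>(\<phi>m u, 0)\<close>, and from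
  \<open>(\<phi>p u, 0)\<close> through \<open>y > 0\<close> to \<open>(u, 0)\<close>; for \<open>\<delta> = - 1\<close> both are reversed.\<close>

locale half_return_pair =
  fixes Zp Zm :: vfield and a \<delta> :: real and \<phi>p \<phi>m :: "real \<Rightarrow> real"
  assumes a: "0 < a" and \<delta>: "\<delta> = 1 \<or> \<delta> = - 1"
    and lip_up: "local_lipschitz (UNIV :: real set) Sigma_up (\<lambda>_. Zp)"
    and lip_down: "local_lipschitz (UNIV :: real set) Sigma_down (\<lambda>_. Zm)"
    and rel_down': "arc_relation (\<lambda>u v. if \<delta> = 1 then connects Zm Sigma_down u v
      else connects Zm Sigma_down v u) a \<phi>m"
    and rel_up': "arc_relation (\<lambda>u v. if \<delta> = 1 then connects Zp Sigma_up v u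
      else connects Zp Sigma_up u v) a \<phi>p"
begin

text \<open>Orientation is normalised here: the first argument is the end at which
  \<open>\<phi>m\<close> is evaluated, whichever way the trajectory runs. The definition of
  \<open>up\<close> does the same for \<open>\<phi>p\<close>.\<close>

definition down :: "real \<Rightarrow> real \<Rightarrow> bool"
  where "down u v = (if \<delta> = 1 then connects Zm Sigma_down u v else connects Zm Sigma_down v u)"

definition up :: "real \<Rightarrow> real \<Rightarrow> bool"
  where "up u v = (if \<delta> = 1 then connects Zp Sigma_up v u else connects Zp Sigma_up u v)"

lemma rel_down: "arc_relation down a \<phi>m" and rel_up: "arc_relation up a \<phi>p"
  using rel_down' rel_up' unfolding down_def[abs_def] up_def[abs_def] .

lemmas down = arc_relationD[OF rel_down]
lemmas up = arc_relationD[OF rel_up]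

lemma shifted_up: "connects (shift_x b Zp) Sigma_up u v \<longleftrightarrow> connects Zp Sigma_up (u - b) (v - b)"
  by (rule connects_shift) simp

lemma first_return_iff:
  "first_return (shift_x b Zp) Zm u w \<longleftrightarrow>
    (if \<delta> = 1 then (\<exists>v. down u v \<and> up (w - b) (v - b)) \<or> (\<exists>v. up (v - b) (u - b) \<and> down v w)
     else (\<exists>v. down v u \<and> up (v - b) (w - b)) \<or> (\<exists>v. up (u - b) (v - b) \<and> down w v))"
  unfolding first_return_def shifted_up down_def up_def by simp

text \<open>Only one order of the two arcs is possible at u: in the other order u, or u - b, would
  be a positive second argument of an arc relation. In the remaining order each arc determines its
  other end.\<close>

lemma first_return_unique:
  assumes u: "0 < u" "b < u" "u < a" "u < a + b" and w: "0 < w" "b < w" "w < a" "w < a + b"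
    and eq: "if \<delta> = 1 then b + \<phi>p (w - b) = \<phi>m u else \<phi>m w = b + \<phi>p (u - b)"
  shows "first_return (shift_x b Zp) Zm u w' \<longleftrightarrow> w' = w"
proof (cases "\<delta> = 1")
  case True
  have "\<not> up (v - b) (u - b)" for v using up(7)[of "u - b" "v - b"] u by simp
  moreover have "down u v \<longleftrightarrow> v = \<phi>m u" for v using down(5)[of u v] u by simp
  moreover have "\<phi>m u - b = \<phi>p (w - b)" using eq True by simp
  moreover have "up (w' - b) (\<phi>p (w - b)) \<longleftrightarrow> w' - b = w - b" using up(6)[of "w - b" "w' - b"] w by simp
  ultimately show ?thesis unfolding first_return_iff using True by simp
next
  case False
  have "\<not> down v u" for v using down(7)[of u v] u by simp
  moreover have "up (u - b) (v - b) \<longleftrightarrow> v = \<phi>m w" for v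
    using up(5)[of "u - b" "v - b"] u eq False by auto
  moreover have "down w' (\<phi>m w) \<longleftrightarrow> w' = w" using down(6)[of w w'] w by simp
  ultimately show ?thesis unfolding first_return_iff using False by simp
qed

lemma cycle_stability:
  assumes x: "0 < x" "b < x" "x < a" "x < a + b" and eq: "\<phi>m x = b + \<phi>p (x - b)"
    and der_m: "(\<phi>m has_real_derivative - dm) (at x)"
    and der_p: "(\<phi>p has_real_derivative - dp) (at (x - b))"
    and pos: "0 < dm" "0 < dp" and "dm \<noteq> dp"
  shows "hyperbolic_cycle_at (shift_x b Zp) Zm x"
    and "(if \<delta> = 1 then dm < dp else dp < dm) \<Longrightarrow> stable_cycle_at (shift_x b Zp) Zm x"
    and "(if \<delta> = 1 then dp < dm else dm < dp) \<Longrightarrow> unstable_cycle_at (shift_x b Zp) Zm x"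
proof -
  let ?R = "first_return (shift_x b Zp) Zm" and ?P = "return_map (shift_x b Zp) Zm"
  \<comment> \<open>The points at which both \<open>\<phi>m u\<close> and
    \<open>\<phi>p (u - b)\<close> lie in the range described by the arc relations.\<close>
  let ?I = "{max 0 b<..<min a (a + b)}"
  let ?D = "if \<delta> = 1 then dm / dp else dp / dm"
  have P: "?P = (\<lambda>u. THE w. ?R u w)" by (simp add: return_map_def fun_eq_iff)
  have xI: "x \<in> ?I" using x by simp
  have der_shift: "((\<lambda>w. b + \<phi>p (w - b)) has_real_derivative - dp) (at x)"
  proof -
    have "(\<phi>p has_real_derivative - dp) (at (x + - b))" using der_p by simp
    then have "((\<lambda>w. \<phi>p (w + - b)) has_real_derivative - dp) (at x)" by (simp only: DERIV_shift)
    then show ?thesis by (auto intro!: derivative_eq_intros)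
  qed
  have cont_m: "continuous_on ?I \<phi>m" by (rule continuous_on_subset[OF down(1)]) auto
  have cont_p: "continuous_on ?I (\<lambda>w. b + \<phi>p (w - b))"
    by (intro continuous_intros continuous_on_compose2[OF up(1)]) auto
  have mono_m: "strict_antimono_on ?I \<phi>m"
    by (rule monotone_onI, rule down(3)) auto
  have mono_p: "strict_antimono_on ?I (\<lambda>w. b + \<phi>p (w - b))"
  proof (rule monotone_onI)
    fix y z assume "y \<in> ?I" "z \<in> ?I" "y < z"
    then show "b + \<phi>p (y - b) > b + \<phi>p (z - b)" using up(3)[of "y - b" "z - b"] by simp
  qed
  have props: "(\<forall>\<^sub>F u in nhds x. \<exists>!w. ?R u w) \<and> ?P x = x \<and> (?P has_real_derivative ?D) (at x)"
  proof (cases "\<delta> = 1")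
    case True
    have R: "?R u w' \<longleftrightarrow> w' = w" if "u \<in> ?I" "w \<in> ?I" "b + \<phi>p (w - b) = \<phi>m u" for u w w'
      using first_return_unique[of u b w w'] that True by simp
    have "- dp \<noteq> 0" using pos by simp
    note ret = return_map_of_relation[where R = ?R, OF xI cont_p mono_p der_shift this der_m eq[symmetric] R]
    have D: "?D = - dm / - dp" using True by simp
    show ?thesis unfolding P D using ret by blast
  next
    case False
    have R: "?R u w' \<longleftrightarrow> w' = w" if "u \<in> ?I" "w \<in> ?I" "\<phi>m w = b + \<phi>p (u - b)" for u w w'
      using first_return_unique[of u b w w'] that False by simp
    have "- dm \<noteq> 0" using pos by simp
    note ret = return_map_of_relation[where R = ?R, OF xI cont_m mono_m der_m this der_shift eq R]
    have D: "?D = - dp / - dm" using False by simp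
    show ?thesis unfolding P D using ret by blast
  qed
  have D: "0 \<le> ?D" "?D \<noteq> 1" using pos assms(10) by (auto simp: field_simps)
  note * = return_map_derivative_imp[OF props[THEN conjunct1] props[THEN conjunct2, THEN conjunct1]
    props[THEN conjunct2, THEN conjunct2] D]
  show "hyperbolic_cycle_at (shift_x b Zp) Zm x" by (rule *(1))
  show "stable_cycle_at (shift_x b Zp) Zm x" if "if \<delta> = 1 then dm < dp else dp < dm"
    by (rule *(2)) (use that pos in \<open>auto split: if_splits\<close>)
  show "unstable_cycle_at (shift_x b Zp) Zm x" if "if \<delta> = 1 then dp < dm else dm < dp"
    by (rule *(3)) (use that pos in \<open>auto split: if_splits\<close>)
qed

section \<open>Existence, uniqueness and isolation of the periodic orbit\<close>

definition orbit :: "real \<Rightarrow> real \<Rightarrow> real \<Rightarrow> (real \<times> real) set \<Rightarrow> bool"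
  where "orbit b u v \<Gamma> = (if \<delta> = 1 then orbit_through (shift_x b Zp) Zm u v \<Gamma>
    else orbit_through (shift_x b Zp) Zm v u \<Gamma>)"

lemma crossing_iff_orbit:
  "crossing_periodic_orbit (shift_x b Zp) Zm \<Gamma> \<longleftrightarrow> (\<exists>u v. orbit b u v \<Gamma>)"
  unfolding crossing_periodic_orbit_iff orbit_def by auto

lemma orbitD:
  assumes "orbit b u v \<Gamma>"
  shows "down u v" "up (u - b) (v - b)" "\<Gamma> \<inter> Sigma_line = {(u, 0), (v, 0)}"
proof -
  show "down u v" "up (u - b) (v - b)"
    using assms unfolding orbit_def down_def up_def
    by (auto simp: shifted_up[symmetric] dest: orbit_through_connects split: if_splits)
  show "\<Gamma> \<inter> Sigma_line = {(u, 0), (v, 0)}"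
    using assms orbit_through_inter_line unfolding orbit_def by (auto split: if_splits)
qed

lemma orbit_exists: "down u v \<Longrightarrow> up (u - b) (v - b) \<Longrightarrow> \<exists>\<Gamma>. orbit b u v \<Gamma>"
  unfolding orbit_def down_def up_def shifted_up[symmetric]
  by (auto intro: orbit_through_exists split: if_splits)

lemma orbit_unique: "orbit b u v \<Gamma> \<Longrightarrow> orbit b u v \<Gamma>' \<Longrightarrow> \<Gamma> = \<Gamma>'"
  unfolding orbit_def using orbit_through_unique[OF lip_up lip_down] by (auto split: if_splits)

definition crossing_radius :: "real \<Rightarrow> bool"
  where "crossing_radius e \<longleftrightarrow> 0 < e \<and> 2 * e \<le> a \<and>
    (\<forall>b u v. b \<noteq> 0 \<and> \<bar>b\<bar> < e \<and> \<bar>u\<bar> < e \<and> \<bar>v\<bar> < e \<and> down u v \<and> up (u - b) (v - b) \<longrightarrow>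
      0 < u \<and> b < u \<and> v = \<phi>m u \<and> \<phi>m u = b + \<phi>p (u - b))"

lemma crossing_radiusD:
  assumes "crossing_radius e" "b \<noteq> 0" "\<bar>b\<bar> < e" "\<bar>u\<bar> < e" "\<bar>v\<bar> < e" "down u v" "up (u - b) (v - b)"
  shows "0 < u \<and> b < u \<and> v = \<phi>m u \<and> \<phi>m u = b + \<phi>p (u - b)"
  using assms unfolding crossing_radius_def by blast

lemma crossing_radius_exists: obtains e where "crossing_radius e"
  unfolding crossing_radius_def using crossing_pairs_local[OF rel_down rel_up a] by metis

lemma unique_limit_cycle:
  assumes e: "crossing_radius e" and b: "b \<noteq> 0" "\<bar>b\<bar> < e" and "\<epsilon> \<le> e"
    and x: "0 < x" "b < x" "x < \<epsilon>" "\<bar>\<phi>m x\<bar> < \<epsilon>" and eq: "\<phi>m x = b + \<phi>p (x - b)"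
    and uniq: "\<And>u. 0 < u \<Longrightarrow> b < u \<Longrightarrow> u < \<epsilon> \<Longrightarrow> \<phi>m u = b + \<phi>p (u - b) \<Longrightarrow> u = x"
  shows "\<exists>!\<Gamma>. crossing_periodic_orbit (shift_x b Zp) Zm \<Gamma> \<and>
      \<Gamma> \<inter> Sigma_line \<subseteq> {-\<epsilon><..<\<epsilon>} \<times> {0}"
    and "crossing_periodic_orbit (shift_x b Zp) Zm \<Gamma> \<Longrightarrow>
      \<Gamma> \<inter> Sigma_line \<subseteq> {-\<epsilon><..<\<epsilon>} \<times> {0} \<Longrightarrow>
      crossing_limit_cycle (shift_x b Zp) Zm \<Gamma> \<and> \<Gamma> \<inter> ({0<..} \<times> {0}) = {(x, 0)}"
proof -
  let ?small = "\<lambda>\<Gamma>. crossing_periodic_orbit (shift_x b Zp) Zm \<Gamma> \<and>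
      \<Gamma> \<inter> Sigma_line \<subseteq> {-\<epsilon><..<\<epsilon>} \<times> {0}"
  have ea: "2 * e \<le> a" using e by (simp add: crossing_radius_def)
  have xa: "x < a" "0 < x - b" "x - b < a" using x b ea \<open>\<epsilon> \<le> e\<close> by linarith+
  have "down x (\<phi>m x)" using down(5)[OF x(1) xa(1)] by blast
  moreover have "up (x - b) (\<phi>m x - b)" using up(5)[OF xa(2,3)] eq by (metis add_diff_cancel_left')
  ultimately obtain \<Gamma>0 where \<Gamma>0: "orbit b x (\<phi>m x) \<Gamma>0" using orbit_exists by blast
  have small0: "?small \<Gamma>0"
  proof
    show "crossing_periodic_orbit (shift_x b Zp) Zm \<Gamma>0"
      using \<Gamma>0 unfolding crossing_iff_orbit by blast
    show "\<Gamma>0 \<inter> Sigma_line \<subseteq> {-\<epsilon><..<\<epsilon>} \<times> {0}"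
      unfolding orbitD(3)[OF \<Gamma>0] using x by (simp add: abs_less_iff)
  qed
  have small_eq: "\<Gamma> = \<Gamma>0" if small: "?small \<Gamma>" for \<Gamma>
  proof -
    obtain u v where uv: "orbit b u v \<Gamma>" using small unfolding crossing_iff_orbit by blast
    have bound: "\<bar>u\<bar> < \<epsilon>" "\<bar>v\<bar> < \<epsilon>"
      using small unfolding orbitD(3)[OF uv] by (simp_all add: abs_less_iff)
    then have "\<bar>u\<bar> < e" "\<bar>v\<bar> < e" using \<open>\<epsilon> \<le> e\<close> by linarith+
    note * = crossing_radiusD[OF e b this orbitD(1,2)[OF uv]]
    have "u < \<epsilon>" using bound(1) by linarith
    then have "u = x" using * uniq by blast
    moreover have "v = \<phi>m u" using * by blast
    ultimately have "orbit b x (\<phi>m x) \<Gamma>" using uv by blast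
    then show ?thesis using \<Gamma>0 by (rule orbit_unique)
  qed
  show "\<exists>!\<Gamma>. ?small \<Gamma>" by (rule ex1I[of _ \<Gamma>0]) (fact small0, fact small_eq)
  assume "crossing_periodic_orbit (shift_x b Zp) Zm \<Gamma>" "\<Gamma> \<inter> Sigma_line \<subseteq> {-\<epsilon><..<\<epsilon>} \<times> {0}"
  then have eq0: "\<Gamma> = \<Gamma>0" by (intro small_eq conjI)
  have inter: "\<Gamma>0 \<inter> ({0<..} \<times> {0}) = {(x, 0)}"
  proof -
    have "\<Gamma>0 \<inter> ({0<..} \<times> {0}) = (\<Gamma>0 \<inter> Sigma_line) \<inter> ({0<..} \<times> {0})"
      by (auto simp: Sigma_line_def)
    also have "\<dots> = {(x, 0)}"
      unfolding orbitD(3)[OF \<Gamma>0] using x(1) down(4)[OF x(1) xa(1)] by fastforce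
    finally show ?thesis .
  qed
  \<comment> \<open>The isolating neighbourhood removes only the part of the line outside the
    window. Thus an orbit lies in U iff its trace on the line lies in the window, and isolation is
    the uniqueness already shown.\<close>
  define U where "U = {p :: real \<times> real. snd p \<noteq> 0} \<union> {p. \<bar>fst p\<bar> < \<epsilon>}"
  have "open U"
    unfolding U_def by (intro open_Un open_Collect_neq open_Collect_less continuous_intros)
  moreover have inU: "\<Gamma>' \<inter> Sigma_line \<subseteq> {-\<epsilon><..<\<epsilon>} \<times> {0} \<longleftrightarrow> \<Gamma>' \<subseteq> U" for \<Gamma>'
  proof -
    have "p \<in> {-\<epsilon><..<\<epsilon>} \<times> {0} \<longleftrightarrow> p \<in> U" if "p \<in> Sigma_line" for p
      using that by (cases p) (auto simp: U_def Sigma_line_def)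
    moreover have "p \<in> U" if "p \<notin> Sigma_line" for p
      using that by (simp add: U_def Sigma_line_def)
    ultimately show ?thesis by blast
  qed
  ultimately have "crossing_limit_cycle (shift_x b Zp) Zm \<Gamma>0"
    unfolding crossing_limit_cycle_def using small0 small_eq[unfolded inU] by (metis inU)
  with inter eq0 show "crossing_limit_cycle (shift_x b Zp) Zm \<Gamma> \<and> \<Gamma> \<inter> ({0<..} \<times> {0}) = {(x, 0)}"
    by simp
qed

text \<open>The crossing equation says b = \<open>\<phi>m u - \<phi>p (u - b)\<close>. If \<mu> = 1
  and b < 0, then \<open>\<phi>p (u - b) < \<phi>p u < \<phi>m u\<close> makes the right side
  positive; the case \<mu> = - 1 is the mirror image.\<close>

lemma no_crossing_periodic_orbit:
  assumes \<mu>: "\<mu> = 1 \<and> (\<forall>x\<in>{0<..<a}. \<phi>p x < \<phi>m x) \<or> \<mu> = - 1 \<and> (\<forall>x\<in>{0<..<a}. \<phi>m x < \<phi>p x)"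
  shows "\<exists>x1\<in>{0<..a}. \<exists>b1>0. \<forall>b. \<mu> * b < 0 \<and> \<bar>b\<bar> < b1 \<longrightarrow>
    \<not> (\<exists>\<Gamma>. crossing_periodic_orbit (shift_x b Zp) Zm \<Gamma> \<and> \<Gamma> \<inter> {0..<x1} \<times> {0} \<noteq> {})"
proof -
  obtain e where e: "crossing_radius e" by (rule crossing_radius_exists)
  then have e0: "0 < e" "2 * e \<le> a" by (auto simp: crossing_radius_def)
  obtain x1 b1 where x1: "0 < x1" "x1 \<le> a" "0 < b1"
    and through: "\<And>b u v. b \<noteq> 0 \<Longrightarrow> \<bar>b\<bar> < b1 \<Longrightarrow> down u v \<Longrightarrow> up (u - b) (v - b) \<Longrightarrow>
      u \<in> {0..<x1} \<or> v \<in> {0..<x1} \<Longrightarrow> \<bar>u\<bar> < e \<and> \<bar>v\<bar> < e"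
    by (rule crossing_pairs_through_section[OF rel_down rel_up a e0(1)]) blast
  have False if b: "\<mu> * b < 0" "\<bar>b\<bar> < min b1 e"
    and \<Gamma>: "crossing_periodic_orbit (shift_x b Zp) Zm \<Gamma>" "\<Gamma> \<inter> {0..<x1} \<times> {0} \<noteq> {}" for b \<Gamma>
  proof -
    obtain u v where uv: "orbit b u v \<Gamma>" using \<Gamma>(1) unfolding crossing_iff_orbit by blast
    note O = orbitD[OF uv]
    obtain q where q: "q \<in> \<Gamma>" "q \<in> {0..<x1} \<times> {0}" using \<Gamma>(2) by blast
    then have "q \<in> \<Gamma> \<inter> Sigma_line" by (auto simp: Sigma_line_def)
    then have "q = (u, 0) \<or> q = (v, 0)" unfolding O(3) by simp
    then have "u \<in> {0..<x1} \<or> v \<in> {0..<x1}" using q(2) by auto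
    moreover have b0: "b \<noteq> 0" using b by auto
    moreover have "\<bar>b\<bar> < b1" using b by simp
    ultimately have uve: "\<bar>u\<bar> < e" "\<bar>v\<bar> < e" using through[OF _ _ O(1,2)] by blast+
    have "\<bar>b\<bar> < e" using b by simp
    note O' = crossing_radiusD[OF e b0 this uve O(1,2)]
    have u: "0 < u" "b < u" "\<phi>m u = b + \<phi>p (u - b)" "u < e" using O' uve(1) by linarith+
    have ua: "u < a" "u - b < a" using u(4) \<open>\<bar>b\<bar> < e\<close> e0 by linarith+
    from \<mu> show False
    proof
      assume \<mu>: "\<mu> = 1 \<and> (\<forall>x\<in>{0<..<a}. \<phi>p x < \<phi>m x)"
      then have "b < 0" using b by simp
      then have "\<phi>p (u - b) < \<phi>p u" by (intro up(3)) (use u(1) ua in linarith)+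
      moreover have "\<phi>p u < \<phi>m u" using \<mu> u(1) ua(1) by simp
      ultimately show False using u(3) \<open>b < 0\<close> by linarith
    next
      assume \<mu>: "\<mu> = - 1 \<and> (\<forall>x\<in>{0<..<a}. \<phi>m x < \<phi>p x)"
      then have "0 < b" using b by simp
      then have "\<phi>p u < \<phi>p (u - b)" by (intro up(3)) (use u(2) ua in linarith)+
      moreover have "\<phi>m u < \<phi>p u" using \<mu> u(1) ua(1) by simp
      ultimately show False using u(3) \<open>0 < b\<close> by linarith
    qed
  qed
  moreover have "0 < min b1 e" "x1 \<in> {0<..a}" using x1 e0 by auto
  ultimately show ?thesis by blast
qed

end

section \<open>The family of limit cycles\<close>

lemma constant_sign:
  fixes h :: "real \<Rightarrow> real"
  assumes cont: "continuous_on {0<..<a} h" and nz: "\<And>x. x \<in> {0<..<a} \<Longrightarrow> h x \<noteq> 0"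
    and y: "y \<in> {0<..<a}" "h y < 0" and x: "x \<in> {0<..<a}"
  shows "h x < 0"
proof (rule ccontr)
  assume "\<not> h x < 0"
  then have "0 \<le> h x" by simp
  have "connected (h ` {0<..<a})" by (rule connected_continuous_image[OF cont connected_Ioo])
  then have "0 \<in> h ` {0<..<a}"
    by (rule connectedD_interval[of _ "h y" "h x"]) (use x y \<open>0 \<le> h x\<close> in auto)
  with nz show False by force
qed

text \<open>A pointwise inequality yields only a weak order of the leading terms; the condition A
  \<noteq> C for equal exponents, which comes from V1 \<noteq> 0, makes it strict.\<close>

lemma dominating_exponent:
  assumes f: "asymp_power f f' A p" and g: "asymp_power g g' C m"
    and less: "\<forall>\<^sub>F x in at_right 0. g x < f x" and ne: "p = m \<Longrightarrow> A \<noteq> C"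
  shows "p < m \<or> p = m \<and> C < A"
proof (rule ccontr)
  assume "\<not> ?thesis"
  then have mp: "m < p \<or> p = m \<and> A < C" using ne by (metis linorder_less_linear)
  have lims: "((\<lambda>x. f x / x powr p) \<longlongrightarrow> A) (at_right 0)" "((\<lambda>x. g x / x powr m) \<longlongrightarrow> C) (at_right 0)"
    and C: "0 < C" using f g by (auto simp: asymp_power_def)
  define A1 where "A1 = (if p = m then A else 0)"
  have "A1 < C" using mp C by (auto simp: A1_def)
  have "((\<lambda>x. f x / x powr m) \<longlongrightarrow> A1) (at_right 0)"
  proof (cases "p = m")
    case True
    then show ?thesis using lims(1) by (simp add: A1_def)
  next
    case False
    have "((\<lambda>x. f x / x powr p * x powr (p - m)) \<longlongrightarrow> A * 0) (at_right 0)"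
      by (intro tendsto_mult lims powr_tendsto_0_at_right) (use False mp in auto)
    moreover have "\<forall>\<^sub>F x in at_right 0. f x / x powr p * x powr (p - m) = f x / x powr m"
      using eventually_at_right_less[of "0 :: real"] by eventually_elim (simp add: powr_diff)
    ultimately show ?thesis using False by (simp add: A1_def Lim_transform_eventually)
  qed
  from tendsto_diff[OF this lims(2)]
  have "\<forall>\<^sub>F x in at_right 0. f x / x powr m - g x / x powr m < 0"
    by (rule order_tendstoD(2)) (use \<open>A1 < C\<close> in simp)
  then have "\<forall>\<^sub>F x in at_right (0 :: real). False"
    using less eventually_at_right_less[of "0 :: real"]
    by eventually_elim (simp add: divide_less_cancel diff_divide_distrib[symmetric] divide_less_0_iff)
  then show False by (simp add: trivial_limit_at_right_real)
qed

text \<open>Common interface of the two signs of \<mu>. The numbers dm and dp are absolute slopes,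
  and the last inequality says that the dominating map is the steeper one at its own point.\<close>

definition cycle_point ::
    "(real \<Rightarrow> real) \<Rightarrow> (real \<Rightarrow> real) \<Rightarrow> real \<Rightarrow> real \<Rightarrow> real \<Rightarrow> real \<Rightarrow> bool"
  where "cycle_point \<phi>p \<phi>m \<epsilon> \<mu> b x \<longleftrightarrow>
    \<bar>b\<bar> < \<epsilon> \<and> 0 < x \<and> b < x \<and> x < \<epsilon> \<and> \<bar>\<phi>m x\<bar> < \<epsilon> \<and> \<phi>m x = b + \<phi>p (x - b) \<and>
    (\<forall>u. 0 < u \<and> b < u \<and> u < \<epsilon> \<and> \<phi>m u = b + \<phi>p (u - b) \<longrightarrow> u = x) \<and>
    (\<exists>dm dp. (\<phi>m has_real_derivative - dm) (at x) \<and> (\<phi>p has_real_derivative - dp) (at (x - b)) \<and>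
       0 < dm \<and> 0 < dp \<and> (if \<mu> = 1 then dm < dp else dp < dm))"

lemma cycle_pointI:
  assumes "\<bar>b\<bar> < \<epsilon>" "0 < x" "b < x" "x < \<epsilon>" "\<bar>\<phi>m x\<bar> < \<epsilon>" "\<phi>m x = b + \<phi>p (x - b)"
    and "\<And>u. 0 < u \<Longrightarrow> b < u \<Longrightarrow> u < \<epsilon> \<Longrightarrow> \<phi>m u = b + \<phi>p (u - b) \<Longrightarrow> u = x"
    and "(\<phi>m has_real_derivative - dm) (at x)" "(\<phi>p has_real_derivative - dp) (at (x - b))"
    and "0 < dm" "0 < dp" "if \<mu> = 1 then dm < dp else dp < dm"
  shows "cycle_point \<phi>p \<phi>m \<epsilon> \<mu> b x"
  unfolding cycle_point_def using assms by blast

definition position_asymptotics :: "real \<Rightarrow> real \<Rightarrow> real \<Rightarrow> real \<Rightarrow> real \<Rightarrow> real \<Rightarrow> (real \<Rightarrow> real) \<Rightarrow> bool"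
  where "position_asymptotics V1 \<alpha>p \<alpha>m rp rm \<mu> x \<longleftrightarrow>
        ((rp - 1) * (rm - 1) \<ge> 0 \<longrightarrow>
          (\<lambda>b. x b - position_coefficient V1 \<alpha>p \<alpha>m rp rm * \<bar>b\<bar> powr position_exponent rp rm)
            \<in> o[at 0 within {b. 0 < \<mu> * b}](\<lambda>b. \<bar>b\<bar> powr position_exponent rp rm)) \<and>
        ((rp - 1) * (rm - 1) < 0 \<longrightarrow>
          (\<mu> = 1 \<longrightarrow> (\<lambda>b. x b - b) \<in> o[at 0 within {b. 0 < \<mu> * b}](\<lambda>b. b)) \<and>
          (\<mu> = - 1 \<longrightarrow> x \<in> o[at 0 within {b. 0 < \<mu> * b}](\<lambda>b. b)))"

lemma smallo_of_quotient_tendsto: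
  fixes x h :: "real \<Rightarrow> real"
  assumes lim: "((\<lambda>b. x b / h b) \<longlongrightarrow> K) F" and nz: "\<forall>\<^sub>F b in F. h b \<noteq> 0"
  shows "(\<lambda>b. x b - K * h b) \<in> o[F](h)"
proof (rule smalloI_tendsto[OF _ nz])
  have "((\<lambda>b. x b / h b - K) \<longlongrightarrow> 0) F"
    using tendsto_diff[OF lim tendsto_const, of K] by simp
  moreover have "\<forall>\<^sub>F b in F. x b / h b - K = (x b - K * h b) / h b"
    using nz by eventually_elim (simp add: field_simps)
  ultimately show "((\<lambda>b. (x b - K * h b) / h b) \<longlongrightarrow> 0) F" by (rule Lim_transform_eventually)
qed

lemma cycle_points_positive_shift:
  assumes dom: "dominated_pair (\<lambda>x. - \<phi>p x) (\<lambda>x. - \<phi>m x) fp fm (- \<alpha>p) (- \<alpha>m) rp rm a" and "0 < e"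
    and V: "\<bar>V\<bar> = - \<alpha>p - dominated_pair.C1 (- \<alpha>m) rp rm"
  obtains \<epsilon> b0 x where "0 < \<epsilon>" "\<epsilon> \<le> e" "0 < b0"
    "\<And>b. 0 < b \<Longrightarrow> b < b0 \<Longrightarrow> cycle_point \<phi>p \<phi>m \<epsilon> 1 b (x b)"
    "position_asymptotics V \<alpha>p \<alpha>m rp rm 1 x"
proof -
  interpret dominated_pair "\<lambda>x. - \<phi>p x" "\<lambda>x. - \<phi>m x" fp fm "- \<alpha>p" "- \<alpha>m" rp rm a by (rule dom)
  obtain \<eta>0 where \<eta>0: "0 < \<eta>0" "\<eta>0 \<le> a" and branch: "\<And>\<eta>. 0 < \<eta> \<Longrightarrow> \<eta> \<le> \<eta>0 \<Longrightarrow>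
      \<exists>b0>0. \<exists>W. (\<forall>b. 0 < b \<and> b < b0 \<longrightarrow> solution_at \<eta>0 \<eta> b (W b)) \<and> (W \<longlongrightarrow> 0) (at_right 0)"
    by (rule solution_branch) (rule that)
  define \<epsilon> where "\<epsilon> = min e \<eta>0"
  have \<epsilon>: "0 < \<epsilon>" "\<epsilon> \<le> e" "\<epsilon> \<le> \<eta>0" using \<eta>0 \<open>0 < e\<close> by (auto simp: \<epsilon>_def)
  obtain b0 W where b0: "0 < b0"
    and sol: "\<And>b. 0 < b \<Longrightarrow> b < b0 \<Longrightarrow> solution_at \<eta>0 \<epsilon> b (W b)"
    and lim: "(W \<longlongrightarrow> 0) (at_right 0)"
    using branch[OF \<epsilon>(1,3)] by blast
  have W: "0 < W b \<and> W b + b < \<epsilon> \<and> - \<phi>p (W b) < \<epsilon> \<and> - \<phi>p (W b) = b + - \<phi>m (W b + b)"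
    and Wu: "\<And>w. 0 < w \<Longrightarrow> w + b < \<eta>0 \<Longrightarrow> - \<phi>p w = b + - \<phi>m (w + b) \<Longrightarrow> w = W b"
    and Wd: "((\<lambda>x. - \<phi>p x) has_real_derivative fp (W b)) (at (W b)) \<and>
         ((\<lambda>x. - \<phi>m x) has_real_derivative fm (W b + b)) (at (W b + b)) \<and>
         0 < fm (W b + b) \<and> fm (W b + b) < fp (W b)" if "0 < b" "b < b0" for b
    using sol[OF that] unfolding solution_at_def by blast+
  have ev: "\<forall>\<^sub>F b in at_right 0. b \<in> {0<..<b0}" by (rule eventually_at_right_real[OF b0])
  have Wpos: "\<forall>\<^sub>F b in at_right 0. 0 < W b"
    using ev by eventually_elim (use W in simp)
  have Weq: "\<forall>\<^sub>F b in at_right 0. - \<phi>p (W b) = b + - \<phi>m (W b + b)"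
    using ev by eventually_elim (use W in simp)
  define x where "x b = W b + b" for b
  have "cycle_point \<phi>p \<phi>m \<epsilon> 1 b (x b)" if b: "0 < b" "b < b0" for b
  proof -
    note Wb = W[OF b]
    \<comment> \<open>Together with - \<open>\<phi>m (W b + b)\<close> = -
      \<open>\<phi>p (W b)\<close> - b < \<epsilon> this places the negative intersection in the
      window.\<close>
    have "0 < - \<phi>m (W b + b)" by (rule g_pos) (use Wb b \<epsilon> \<eta>0 in auto)
    note Wb = Wb this and ders = Wd[OF b]
    have xb: "x b - b = W b" by (simp add: x_def)
    show ?thesis
    proof (rule cycle_pointI)
      show "\<bar>b\<bar> < \<epsilon>" "0 < x b" "b < x b" "x b < \<epsilon>" "\<bar>\<phi>m (x b)\<bar> < \<epsilon>"
        using Wb b unfolding x_def by linarith+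
      show "\<phi>m (x b) = b + \<phi>p (x b - b)" using Wb unfolding x_def by simp
      show "u = x b" if "0 < u" "b < u" "u < \<epsilon>" "\<phi>m u = b + \<phi>p (u - b)" for u
        using Wu[OF b, of "u - b"] that \<epsilon> unfolding x_def by simp
      show "(\<phi>m has_real_derivative - fm (x b)) (at (x b))"
        using DERIV_minus[of "\<lambda>x. - \<phi>m x" "fm (x b)"] ders unfolding x_def by simp
      show "(\<phi>p has_real_derivative - fp (W b)) (at (x b - b))"
        using DERIV_minus[of "\<lambda>x. - \<phi>p x" "fp (W b)"] ders unfolding xb by simp
      show "0 < fm (x b)" "0 < fp (W b)" "if (1 :: real) = 1 then fm (x b) < fp (W b) else fp (W b) < fm (x b)"
        using ders unfolding x_def by auto
    qed
  qed
  moreover have "position_asymptotics V \<alpha>p \<alpha>m rp rm 1 x"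
  proof -
    have F: "at 0 within {b :: real. 0 < 1 * b} = at_right 0" by (simp add: greaterThan_def)
    have nz: "\<forall>\<^sub>F b in at_right 0. b \<noteq> (0 :: real)" "\<forall>\<^sub>F b in at_right 0. \<bar>b\<bar> = (b :: real)"
      by (rule eventually_mono[OF eventually_at_right_less], simp)+
    have "(\<lambda>b. x b - position_coefficient V \<alpha>p \<alpha>m rp rm * \<bar>b\<bar> powr position_exponent rp rm)
        \<in> o[at_right 0](\<lambda>b. \<bar>b\<bar> powr position_exponent rp rm)"
    proof (rule smallo_of_quotient_tendsto)
      have "((\<lambda>b. (W b + b) / b powr position_exponent rp rm) \<longlongrightarrow> position_coefficient V \<alpha>p \<alpha>m rp rm) (at_right 0)"
        using shifted_position[OF Wpos Weq lim V] by simp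
      moreover have "\<forall>\<^sub>F b in at_right 0. (W b + b) / b powr position_exponent rp rm =
          x b / \<bar>b\<bar> powr position_exponent rp rm"
        using nz(2) by eventually_elim (simp add: x_def)
      ultimately show "((\<lambda>b. x b / \<bar>b\<bar> powr position_exponent rp rm) \<longlongrightarrow>
          position_coefficient V \<alpha>p \<alpha>m rp rm) (at_right 0)"
        by (rule Lim_transform_eventually)
      show "\<forall>\<^sub>F b in at_right 0. \<bar>b\<bar> powr position_exponent rp rm \<noteq> 0"
        using nz(1) by eventually_elim simp
    qed
    moreover have "(\<lambda>b. x b - b) \<in> o[at_right 0](\<lambda>b. b)" if side: "(rp - 1) * (rm - 1) < 0"
      unfolding x_def using smallo_of_quotient_tendsto[OF mixed_position[OF Wpos Weq lim side] nz(1)] by simp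
    ultimately show ?thesis unfolding position_asymptotics_def F by simp
  qed
  ultimately show ?thesis by (rule that[OF \<epsilon>(1,2) b0])
qed

lemma cycle_points_negative_shift:
  assumes dom: "dominated_pair (\<lambda>x. - \<phi>m x) (\<lambda>x. - \<phi>p x) fm fp (- \<alpha>m) (- \<alpha>p) rm rp a" and "0 < e"
    and V: "\<bar>V\<bar> = - \<alpha>m - dominated_pair.C1 (- \<alpha>p) rm rp"
  obtains \<epsilon> b0 x where "0 < \<epsilon>" "\<epsilon> \<le> e" "0 < b0"
    "\<And>b. 0 < - b \<Longrightarrow> - b < b0 \<Longrightarrow> cycle_point \<phi>p \<phi>m \<epsilon> (- 1) b (x b)"
    "position_asymptotics V \<alpha>p \<alpha>m rp rm (- 1) x"
proof -
  interpret dominated_pair "\<lambda>x. - \<phi>m x" "\<lambda>x. - \<phi>p x" fm fp "- \<alpha>m" "- \<alpha>p" rm rp a by (rule dom)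
  obtain \<eta>0 where \<eta>0: "0 < \<eta>0" "\<eta>0 \<le> a" and branch: "\<And>\<eta>. 0 < \<eta> \<Longrightarrow> \<eta> \<le> \<eta>0 \<Longrightarrow>
      \<exists>b0>0. \<exists>W. (\<forall>b. 0 < b \<and> b < b0 \<longrightarrow> solution_at \<eta>0 \<eta> b (W b)) \<and> (W \<longlongrightarrow> 0) (at_right 0)"
    by (rule solution_branch) (rule that)
  \<comment> \<open>Half of \<eta>0: a competing solution u < \<epsilon> is evaluated by
    \<open>\<phi>p\<close> at u - b with - b < \<epsilon>, and this point must stay in the window of
    uniqueness.\<close>
  define \<epsilon> where "\<epsilon> = min e (\<eta>0 / 2)"
  have \<epsilon>: "0 < \<epsilon>" "\<epsilon> \<le> e" "2 * \<epsilon> \<le> \<eta>0" using \<eta>0 \<open>0 < e\<close> by (auto simp: \<epsilon>_def)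
  then have "\<epsilon> \<le> \<eta>0" by simp
  obtain b0 W where b0: "0 < b0"
    and sol: "\<And>b. 0 < b \<Longrightarrow> b < b0 \<Longrightarrow> solution_at \<eta>0 \<epsilon> b (W b)"
    and lim: "(W \<longlongrightarrow> 0) (at_right 0)"
    using branch[OF \<epsilon>(1) \<open>\<epsilon> \<le> \<eta>0\<close>] by blast
  have W: "0 < W b \<and> W b + b < \<epsilon> \<and> - \<phi>m (W b) < \<epsilon> \<and> - \<phi>m (W b) = b + - \<phi>p (W b + b)"
    and Wu: "\<And>w. 0 < w \<Longrightarrow> w + b < \<eta>0 \<Longrightarrow> - \<phi>m w = b + - \<phi>p (w + b) \<Longrightarrow> w = W b"
    and Wd: "((\<lambda>x. - \<phi>m x) has_real_derivative fm (W b)) (at (W b)) \<and>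
         ((\<lambda>x. - \<phi>p x) has_real_derivative fp (W b + b)) (at (W b + b)) \<and>
         0 < fp (W b + b) \<and> fp (W b + b) < fm (W b)" if "0 < b" "b < b0" for b
    using sol[OF that] unfolding solution_at_def by blast+
  have ev: "\<forall>\<^sub>F b in at_right 0. b \<in> {0<..<b0}" by (rule eventually_at_right_real[OF b0])
  have Wpos: "\<forall>\<^sub>F b in at_right 0. 0 < W b"
    using ev by eventually_elim (use W in simp)
  have Weq: "\<forall>\<^sub>F b in at_right 0. - \<phi>m (W b) = b + - \<phi>p (W b + b)"
    using ev by eventually_elim (use W in simp)
  define x where "x b = W (- b)" for b
  have "cycle_point \<phi>p \<phi>m \<epsilon> (- 1) b (x b)" if b: "0 < - b" "- b < b0" for b
  proof -
    note Wb = W[OF b]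
    have "0 < - \<phi>m (W (- b))" by (rule f_pos) (use Wb b \<epsilon> \<eta>0 in auto)
    note Wb = Wb this and ders = Wd[OF b]
    have xb: "x b - b = W (- b) + - b" by (simp add: x_def)
    show ?thesis
    proof (rule cycle_pointI)
      show bx: "\<bar>b\<bar> < \<epsilon>" "0 < x b" "b < x b" "x b < \<epsilon>" "\<bar>\<phi>m (x b)\<bar> < \<epsilon>"
        using Wb b unfolding x_def by linarith+
      show "\<phi>m (x b) = b + \<phi>p (x b - b)" using Wb unfolding x_def by simp
      show "u = x b" if "0 < u" "b < u" "u < \<epsilon>" "\<phi>m u = b + \<phi>p (u - b)" for u
        using Wu[OF b, of u] that \<epsilon> bx(1) unfolding x_def by simp
      show "(\<phi>m has_real_derivative - fm (x b)) (at (x b))"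
        using DERIV_minus[of "\<lambda>x. - \<phi>m x" "fm (x b)"] ders unfolding x_def by simp
      show "(\<phi>p has_real_derivative - fp (x b - b)) (at (x b - b))"
        using DERIV_minus[of "\<lambda>x. - \<phi>p x" "fp (x b - b)"] ders unfolding xb by simp
      show "0 < fm (x b)" "0 < fp (x b - b)"
        "if (- 1 :: real) = 1 then fm (x b) < fp (x b - b) else fp (x b - b) < fm (x b)"
        using ders unfolding xb unfolding x_def by auto
    qed
  qed
  moreover have "position_asymptotics V \<alpha>p \<alpha>m rp rm (- 1) x"
  proof -
    have F: "at 0 within {b :: real. 0 < - 1 * b} = at_left 0" by (simp add: lessThan_def)
    have nz: "\<forall>\<^sub>F b in at_left 0. b \<noteq> (0 :: real)" "\<forall>\<^sub>F b in at_left 0. \<bar>b\<bar> = - (b :: real)"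
      by (auto simp: eventually_at_filter)
    have minus: "filterlim (\<lambda>b :: real. - b) (at_right 0) (at_left 0)"
      unfolding filterlim_def by (simp add: at_left_minus filtermap_filtermap)
    have "(\<lambda>b. x b - position_coefficient V \<alpha>p \<alpha>m rp rm * \<bar>b\<bar> powr position_exponent rp rm)
        \<in> o[at_left 0](\<lambda>b. \<bar>b\<bar> powr position_exponent rp rm)"
    proof (rule smallo_of_quotient_tendsto)
      from filterlim_compose[OF unshifted_position[OF Wpos Weq lim V] minus]
      have "((\<lambda>b. x b / (- b) powr position_exponent rp rm) \<longlongrightarrow> position_coefficient V \<alpha>p \<alpha>m rp rm) (at_left 0)"
        by (simp add: x_def)
      moreover have "\<forall>\<^sub>F b in at_left 0. x b / (- b) powr position_exponent rp rm =
          x b / \<bar>b\<bar> powr position_exponent rp rm"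
        using nz(2) by eventually_elim simp
      ultimately show "((\<lambda>b. x b / \<bar>b\<bar> powr position_exponent rp rm) \<longlongrightarrow>
          position_coefficient V \<alpha>p \<alpha>m rp rm) (at_left 0)"
        by (rule Lim_transform_eventually)
      show "\<forall>\<^sub>F b in at_left 0. \<bar>b\<bar> powr position_exponent rp rm \<noteq> 0"
        using nz(1) by eventually_elim simp
    qed
    moreover have "x \<in> o[at_left 0](\<lambda>b. b)" if side: "(rp - 1) * (rm - 1) < 0"
    proof -
      have "(rm - 1) * (rp - 1) < 0" using side by (simp add: mult.commute)
      from filterlim_compose[OF mixed_position[OF Wpos Weq lim this] minus]
      have "((\<lambda>b. x b / - b) \<longlongrightarrow> 0) (at_left 0)" unfolding x_def .
      from tendsto_minus[OF this] have "((\<lambda>b. x b / b) \<longlongrightarrow> 0) (at_left 0)" by simp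
      from smallo_of_quotient_tendsto[OF this nz(1)] show ?thesis by simp
    qed
    ultimately show ?thesis unfolding position_asymptotics_def F by simp
  qed
  ultimately show ?thesis by (rule that[OF \<epsilon>(1,2) b0])
qed

section \<open>Assembly: the family of limit cycles and the role of the signs\<close>

context half_return_pair
begin

text \<open>The multiplier is dm / dp for \<delta> = 1 and dp / dm for \<delta> = - 1, while \<mu>
  tells which slope is larger. It is therefore below 1 exactly when \<mu> = \<delta>, which is the
  sign condition V < 0.\<close>

lemma limit_cycle_family:
  assumes e: "crossing_radius e" and \<epsilon>: "0 < \<epsilon>" "\<epsilon> \<le> e"
    and points: "\<And>b. 0 < \<mu> * b \<Longrightarrow> \<mu> * b < b0 \<Longrightarrow> cycle_point \<phi>p \<phi>m \<epsilon> \<mu> b (x b)"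
    and \<mu>: "\<mu> = 1 \<or> \<mu> = - 1" and V: "V < 0 \<longleftrightarrow> \<mu> = \<delta>" "V > 0 \<longleftrightarrow> \<mu> \<noteq> \<delta>"
    and b: "0 < \<mu> * b \<and> \<mu> * b < b0"
  shows "(\<exists>!\<Gamma>. crossing_periodic_orbit (shift_x b Zp) Zm \<Gamma> \<and>
                \<Gamma> \<inter> Sigma_line \<subseteq> {-\<epsilon><..<\<epsilon>} \<times> {0}) \<and>
          (\<forall>\<Gamma>. crossing_periodic_orbit (shift_x b Zp) Zm \<Gamma> \<and>
                \<Gamma> \<inter> Sigma_line \<subseteq> {-\<epsilon><..<\<epsilon>} \<times> {0} \<longrightarrow>
             crossing_limit_cycle (shift_x b Zp) Zm \<Gamma> \<and>
             \<Gamma> \<inter> ({0<..} \<times> {0}) = {(x b, 0)} \<and>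
             hyperbolic_cycle_at (shift_x b Zp) Zm (x b) \<and>
             (V < 0 \<longrightarrow> stable_cycle_at (shift_x b Zp) Zm (x b)) \<and>
             (V > 0 \<longrightarrow> unstable_cycle_at (shift_x b Zp) Zm (x b)))"
proof -
  have "cycle_point \<phi>p \<phi>m \<epsilon> \<mu> b (x b)" using points b by blast
  then obtain dm dp where bx: "\<bar>b\<bar> < \<epsilon>" "0 < x b" "b < x b" "x b < \<epsilon>" "\<bar>\<phi>m (x b)\<bar> < \<epsilon>"
    and eq: "\<phi>m (x b) = b + \<phi>p (x b - b)"
    and uniq: "\<And>u. 0 < u \<Longrightarrow> b < u \<Longrightarrow> u < \<epsilon> \<Longrightarrow> \<phi>m u = b + \<phi>p (u - b) \<Longrightarrow> u = x b"
    and der: "(\<phi>m has_real_derivative - dm) (at (x b))" "(\<phi>p has_real_derivative - dp) (at (x b - b))"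
    and dpos: "0 < dm" "0 < dp" and dless: "if \<mu> = 1 then dm < dp else dp < dm"
    unfolding cycle_point_def by blast
  have b': "b \<noteq> 0" "\<bar>b\<bar> < e" using b bx(1) \<epsilon> by auto
  have "2 * e \<le> a" using e by (simp add: crossing_radius_def)
  then have xa: "x b < a" "x b < a + b" using bx(1,4) \<epsilon> by linarith+
  have ne: "dm \<noteq> dp" using dless by (auto split: if_splits)
  note stab = cycle_stability[OF bx(2,3) xa eq der dpos ne]
  note cycle = unique_limit_cycle[OF e b' \<epsilon>(2) bx(2-5) eq]
  show ?thesis
  proof (intro conjI allI impI)
    show "\<exists>!\<Gamma>. crossing_periodic_orbit (shift_x b Zp) Zm \<Gamma> \<and>
                \<Gamma> \<inter> Sigma_line \<subseteq> {-\<epsilon><..<\<epsilon>} \<times> {0}"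
      by (rule cycle(1)) (rule uniq)
    show "hyperbolic_cycle_at (shift_x b Zp) Zm (x b)" by (rule stab(1))
    show "stable_cycle_at (shift_x b Zp) Zm (x b)" if "V < 0"
      by (rule stab(2)) (use that V(1) \<delta> \<mu> dless in auto)
    show "unstable_cycle_at (shift_x b Zp) Zm (x b)" if "V > 0"
      by (rule stab(3)) (use that V(2) \<delta> \<mu> dless in auto)
    fix \<Gamma> assume "crossing_periodic_orbit (shift_x b Zp) Zm \<Gamma> \<and>
                \<Gamma> \<inter> Sigma_line \<subseteq> {-\<epsilon><..<\<epsilon>} \<times> {0}"
    then have *: "crossing_limit_cycle (shift_x b Zp) Zm \<Gamma> \<and> \<Gamma> \<inter> ({0<..} \<times> {0}) = {(x b, 0)}"
      by (intro cycle(2)[OF uniq]) auto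
    show "crossing_limit_cycle (shift_x b Zp) Zm \<Gamma>" by (rule *[THEN conjunct1])
    show "\<Gamma> \<inter> ({0<..} \<times> {0}) = {(x b, 0)}" by (rule *[THEN conjunct2])
  qed
qed

end

text \<open>A continuous return time without zeros keeps its sign, so the midpoint decides the
  orientation everywhere. The opposite sign of the other time makes one half-return map run forward
  and the other backward.\<close>

lemma hyp_H1_half_return_pair:
  assumes H1: "hyp_H1 Zp Zm x0 \<tau>p \<tau>m \<phi>p \<phi>m" and \<delta>: "\<delta> = orientation_sign \<tau>p x0"
  shows "half_return_pair Zp Zm x0 \<delta> \<phi>p \<phi>m"
proof -
  have x0: "0 < x0" and lip: "local_lipschitz (UNIV :: real set) Sigma_up (\<lambda>_. Zp)"
      "local_lipschitz (UNIV :: real set) Sigma_down (\<lambda>_. Zm)"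
    and hr: "half_return Zp Sigma_up x0 \<tau>p \<phi>p" "half_return Zm Sigma_down x0 \<tau>m \<phi>m"
    and opposite: "\<And>x. x \<in> {0<..<x0} \<Longrightarrow> \<tau>p x * \<tau>m x < 0"
    using H1 unfolding hyp_H1_def by auto
  have cont: "continuous_on {0<..<x0} \<tau>p" using hr(1) unfolding half_return_def by blast
  have nz: "\<tau>p x \<noteq> 0" if "x \<in> {0<..<x0}" for x using opposite[OF that] by auto
  have mid: "x0 / 2 \<in> {0<..<x0}" using x0 by simp
  have up: "Sigma_up = {p. 0 \<le> 1 * snd p}" and down: "Sigma_down = {p. 0 \<le> - 1 * snd p}"
    by (simp_all add: Sigma_up_def Sigma_down_def)
  have rels: "\<bar>1 :: real\<bar> = 1" "\<bar>- 1 :: real\<bar> = 1" by simp_all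
  note rel_up = half_return_arc_relation[OF hr(1) lip(1) up rels(1)]
  note rel_down = half_return_arc_relation[OF hr(2) lip(2) down rels(2)]
  show ?thesis
  proof (cases "\<tau>p (x0 / 2) < 0")
    case True
    then have d: "\<delta> = 1" using \<delta> by (simp add: orientation_sign_def)
    have neg: "\<tau>p x < 0" if "x \<in> {0<..<x0}" for x
      by (rule constant_sign[OF cont nz mid True that])
    then have "\<tau>m x > 0" if "x \<in> {0<..<x0}" for x
      using opposite[OF that] neg[OF that] by (simp add: mult_less_0_iff)
    from rel_down(1)[OF this] rel_up(2)[OF neg] show ?thesis
      by unfold_locales (simp_all add: d x0 lip)
  next
    case False
    then have d: "\<delta> = - 1" using \<delta> by (simp add: orientation_sign_def)
    have "- \<tau>p (x0 / 2) < 0" using False nz[OF mid] by linarith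
    then have "- \<tau>p x < 0" if "x \<in> {0<..<x0}" for x
      using constant_sign[of x0 "\<lambda>x. - \<tau>p x" "x0 / 2" x] cont nz mid that
      by (simp add: continuous_on_minus)
    then have pos: "\<tau>p x > 0" if "x \<in> {0<..<x0}" for x using that by force
    then have "\<tau>m x < 0" if "x \<in> {0<..<x0}" for x
      using opposite[OF that] pos[OF that] by (simp add: mult_less_0_iff)
    from rel_down(2)[OF this] rel_up(1)[OF pos] show ?thesis
      by unfold_locales (simp_all add: d x0 lip)
  qed
qed

lemma (in half_return_pair) dominated_pair_of_less:
  assumes "asymp_power (\<lambda>x. - \<phi>p x) fp A rp" "asymp_power (\<lambda>x. - \<phi>m x) fm C rm"
    and "rp = rm \<Longrightarrow> A \<noteq> C"
  shows "\<forall>x\<in>{0<..<a}. \<phi>p x < \<phi>m x \<Longrightarrow> dominated_pair (\<lambda>x. - \<phi>p x) (\<lambda>x. - \<phi>m x) fp fm A C rp rm a"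
    and "\<forall>x\<in>{0<..<a}. \<phi>m x < \<phi>p x \<Longrightarrow> dominated_pair (\<lambda>x. - \<phi>m x) (\<lambda>x. - \<phi>p x) fm fp C A rm rp a"
proof -
  have near: "\<forall>\<^sub>F x in at_right 0. x \<in> {0<..<a}" by (rule eventually_at_right_real[OF a])
  have cont: "continuous_on {0..<a} (\<lambda>x. - \<phi>p x)" "continuous_on {0..<a} (\<lambda>x. - \<phi>m x)"
    using up(1) down(1) by (auto intro: continuous_on_minus)
  have mono: "strict_mono_on {0..<a} (\<lambda>x. - \<phi>p x)" "strict_mono_on {0..<a} (\<lambda>x. - \<phi>m x)"
    using up(3) down(3) by (simp_all add: monotone_on_def)
  show "dominated_pair (\<lambda>x. - \<phi>p x) (\<lambda>x. - \<phi>m x) fp fm A C rp rm a"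
    if less: "\<forall>x\<in>{0<..<a}. \<phi>p x < \<phi>m x"
  proof unfold_locales
    have "\<forall>\<^sub>F x in at_right 0. - \<phi>m x < - \<phi>p x" using near by eventually_elim (use less in simp)
    from dominating_exponent[OF assms(1,2) this assms(3)] show "rp < rm \<or> rp = rm \<and> C < A" .
  qed (use a cont mono assms up(2) down(2) in simp_all)
  show "dominated_pair (\<lambda>x. - \<phi>m x) (\<lambda>x. - \<phi>p x) fm fp C A rm rp a"
    if less: "\<forall>x\<in>{0<..<a}. \<phi>m x < \<phi>p x"
  proof unfold_locales
    have "\<forall>\<^sub>F x in at_right 0. - \<phi>p x < - \<phi>m x" using near by eventually_elim (use less in simp)
    from dominating_exponent[OF assms(2,1) this] assms(3) show "rm < rp \<or> rm = rp \<and> A < C" by metis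
  qed (use a cont mono assms up(2) down(2) in simp_all)
qed

theorem theorem3:
  fixes Zp Zm :: vfield
    and x0 l \<alpha>p \<alpha>m rp rm \<delta> \<mu> V1 :: real
    and \<tau>p \<tau>m \<phi>p \<phi>m :: "real \<Rightarrow> real"
  assumes "hyp_H1 Zp Zm x0 \<tau>p \<tau>m \<phi>p \<phi>m"
    and "\<delta> = orientation_sign \<tau>p x0"
    and "\<mu> = - displacement_sign \<delta> \<phi>p \<phi>m x0 * \<delta>"
    and "\<alpha>p \<noteq> 0" and "\<alpha>m \<noteq> 0" and "rp > 0" and "rm > 0" and "l > 0"
    and "dulac_type \<phi>p \<alpha>p rp l" and "dulac_type \<phi>m \<alpha>m rm l"
    and "V1 = first_coefficient \<delta> \<alpha>p \<alpha>m rp rm"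
    and "V1 \<noteq> 0"
  shows
    "(\<exists>b0>0. \<exists>\<epsilon>>0. \<exists>x :: real \<Rightarrow> real.
        (\<forall>b. 0 < \<mu> * b \<and> \<mu> * b < b0 \<longrightarrow>
          (\<exists>!\<Gamma>. crossing_periodic_orbit (shift_x b Zp) Zm \<Gamma> \<and>
                \<Gamma> \<inter> Sigma_line \<subseteq> {-\<epsilon><..<\<epsilon>} \<times> {0}) \<and>
          (\<forall>\<Gamma>. crossing_periodic_orbit (shift_x b Zp) Zm \<Gamma> \<and>
                \<Gamma> \<inter> Sigma_line \<subseteq> {-\<epsilon><..<\<epsilon>} \<times> {0} \<longrightarrow>
             crossing_limit_cycle (shift_x b Zp) Zm \<Gamma> \<and>
             \<Gamma> \<inter> ({0<..} \<times> {0}) = {(x b, 0)} \<and>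
             hyperbolic_cycle_at (shift_x b Zp) Zm (x b) \<and>
             (V1 < 0 \<longrightarrow> stable_cycle_at (shift_x b Zp) Zm (x b)) \<and>
             (V1 > 0 \<longrightarrow> unstable_cycle_at (shift_x b Zp) Zm (x b)))) \<and>
        ((rp - 1) * (rm - 1) \<ge> 0 \<longrightarrow>
          (\<lambda>b. x b - position_coefficient V1 \<alpha>p \<alpha>m rp rm * \<bar>b\<bar> powr position_exponent rp rm)
            \<in> o[at 0 within {b. 0 < \<mu> * b}](\<lambda>b. \<bar>b\<bar> powr position_exponent rp rm)) \<and>
        ((rp - 1) * (rm - 1) < 0 \<longrightarrow>
          (\<mu> = 1 \<longrightarrow> (\<lambda>b. x b - b) \<in> o[at 0 within {b. 0 < \<mu> * b}](\<lambda>b. b)) \<and>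
          (\<mu> = - 1 \<longrightarrow> x \<in> o[at 0 within {b. 0 < \<mu> * b}](\<lambda>b. b)))) \<and>
     (\<exists>x1\<in>{0<..x0}. \<exists>b1>0. \<forall>b. \<mu> * b < 0 \<and> \<bar>b\<bar> < b1 \<longrightarrow>
        \<not> (\<exists>\<Gamma>. crossing_periodic_orbit (shift_x b Zp) Zm \<Gamma> \<and> \<Gamma> \<inter> {0..<x1} \<times> {0} \<noteq> {}))"
proof -
  interpret half_return_pair Zp Zm x0 \<delta> \<phi>p \<phi>m
    by (rule hyp_H1_half_return_pair[OF assms(1,2)])
  have neg: "\<phi>p x < 0" "\<phi>m x < 0" if "x \<in> {0<..<x0}" for x
    using up(4)[of x] down(4)[of x] that by auto
  have powers: "asymp_power (\<lambda>x. - \<phi>p x) (\<lambda>x. - deriv \<phi>p x) (- \<alpha>p) rp"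
    "asymp_power (\<lambda>x. - \<phi>m x) (\<lambda>x. - deriv \<phi>m x) (- \<alpha>m) rm"
    by (rule dulac_type_imp_asymp_power[OF assms(9) assms(6,8,4) a], rule neg(1), assumption)
      (rule dulac_type_imp_asymp_power[OF assms(10) assms(7,8,5) a], rule neg(2), assumption)
  have ne: "- \<alpha>p \<noteq> - \<alpha>m" if "rp = rm"
    using assms(11,12) that by (auto simp: first_coefficient_def)
  have mid: "x0 / 2 \<in> {0<..<x0}" using a by simp
  have cont: "continuous_on {0<..<x0} \<phi>p" "continuous_on {0<..<x0} \<phi>m"
    using up(1) down(1) by (auto intro: continuous_on_subset)
  have distinct: "\<phi>p x \<noteq> \<phi>m x" if "x \<in> {0<..<x0}" for x
    using assms(1) that unfolding hyp_H1_def by blast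
  have sides: "\<mu> = 1 \<and> (\<forall>x\<in>{0<..<x0}. \<phi>p x < \<phi>m x) \<or> \<mu> = - 1 \<and> (\<forall>x\<in>{0<..<x0}. \<phi>m x < \<phi>p x)"
  proof (cases "\<phi>p (x0 / 2) < \<phi>m (x0 / 2)")
    case True
    \<comment> \<open>The factor \<delta> inside the displacement cancels the one in \<mu>, so \<mu>
      is simply the sign of \<open>\<phi>m\<close> - \<open>\<phi>p\<close>.\<close>
    then have "\<mu> = 1"
      using \<delta> assms(3) by (auto simp: displacement_sign_def displacement_def)
    moreover have "\<phi>p x - \<phi>m x < 0" if "x \<in> {0<..<x0}" for x
    proof (rule constant_sign[OF continuous_on_diff[OF cont] _ mid _ that])
      show "\<phi>p y - \<phi>m y \<noteq> 0" if "y \<in> {0<..<x0}" for y using distinct[OF that] by simp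
    qed (use True in simp)
    ultimately show ?thesis by force
  next
    case False
    then have less: "\<phi>m (x0 / 2) < \<phi>p (x0 / 2)" using distinct[OF mid] by linarith
    then have "\<mu> = - 1"
      using \<delta> assms(3) by (auto simp: displacement_sign_def displacement_def)
    moreover have "\<phi>m x - \<phi>p x < 0" if "x \<in> {0<..<x0}" for x
    proof (rule constant_sign[OF continuous_on_diff[OF cont(2,1)] _ mid _ that])
      show "\<phi>m y - \<phi>p y \<noteq> 0" if "y \<in> {0<..<x0}" for y using distinct[OF that] by simp
    qed (use less in simp)
    ultimately show ?thesis by force
  qed
  then have \<mu>: "\<mu> = 1 \<or> \<mu> = - 1" by blast
  obtain e where e: "crossing_radius e" by (rule crossing_radius_exists)
  then have "0 < e" by (simp add: crossing_radius_def)
  have "\<exists>\<epsilon>>0. \<epsilon> \<le> e \<and> (\<exists>b0>0. \<exists>x.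
      (\<forall>b. 0 < \<mu> * b \<longrightarrow> \<mu> * b < b0 \<longrightarrow> cycle_point \<phi>p \<phi>m \<epsilon> \<mu> b (x b)) \<and>
      position_asymptotics V1 \<alpha>p \<alpha>m rp rm \<mu> x) \<and> (V1 < 0 \<longleftrightarrow> \<mu> = \<delta>) \<and> (V1 > 0 \<longleftrightarrow> \<mu> \<noteq> \<delta>)"
    using sides
  proof
    assume \<mu>: "\<mu> = 1 \<and> (\<forall>x\<in>{0<..<x0}. \<phi>p x < \<phi>m x)"
    interpret D: dominated_pair "\<lambda>x. - \<phi>p x" "\<lambda>x. - \<phi>m x" "\<lambda>x. - deriv \<phi>p x" "\<lambda>x. - deriv \<phi>m x"
      "- \<alpha>p" "- \<alpha>m" rp rm x0
      by (rule dominated_pair_of_less(1)[OF powers _ \<mu>[THEN conjunct2]]) (rule ne)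
    \<comment> \<open>The cases of \<open>first_coefficient\<close> collapse here:
      \<open>\<phi>p\<close> dominates, and \<open>D.C1\<close> is - \<alpha>m for equal exponents
      and 0 otherwise. The absolute value gives the position, the sign gives the stability.\<close>
    have V: "V1 = - \<delta> * (- \<alpha>p - D.C1)"
      using assms(11) D.dominated unfolding D.C1_def first_coefficient_def
      by (auto simp: algebra_simps)
    have C1: "0 < - \<alpha>p - D.C1" using D.C1 by simp
    have V_abs: "\<bar>V1\<bar> = - \<alpha>p - D.C1" using \<delta> C1 unfolding V by (auto simp: abs_mult)
    have V_sign: "(V1 < 0 \<longleftrightarrow> \<mu> = \<delta>) \<and> (V1 > 0 \<longleftrightarrow> \<mu> \<noteq> \<delta>)"
      using \<delta> \<mu> C1 unfolding V by (auto simp: zero_less_mult_iff mult_less_0_iff)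
    obtain \<epsilon> b0 x where "0 < \<epsilon>" "\<epsilon> \<le> e" "0 < b0"
      "\<And>b. 0 < b \<Longrightarrow> b < b0 \<Longrightarrow> cycle_point \<phi>p \<phi>m \<epsilon> 1 b (x b)"
      "position_asymptotics V1 \<alpha>p \<alpha>m rp rm 1 x"
      by (rule cycle_points_positive_shift[OF D.dominated_pair_axioms \<open>0 < e\<close> V_abs]) (rule that)
    with V_sign \<mu>[THEN conjunct1] show ?thesis
      by (intro exI[of _ \<epsilon>] conjI exI[of _ b0] exI[of _ x]) simp_all
  next
    assume \<mu>: "\<mu> = - 1 \<and> (\<forall>x\<in>{0<..<x0}. \<phi>m x < \<phi>p x)"
    interpret D: dominated_pair "\<lambda>x. - \<phi>m x" "\<lambda>x. - \<phi>p x" "\<lambda>x. - deriv \<phi>m x" "\<lambda>x. - deriv \<phi>p x"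
      "- \<alpha>m" "- \<alpha>p" rm rp x0
      by (rule dominated_pair_of_less(2)[OF powers _ \<mu>[THEN conjunct2]]) (rule ne)
    have V: "V1 = \<delta> * (- \<alpha>m - D.C1)"
      using assms(11) D.dominated unfolding D.C1_def first_coefficient_def
      by (auto simp: algebra_simps)
    have C1: "0 < - \<alpha>m - D.C1" using D.C1 by simp
    have V_abs: "\<bar>V1\<bar> = - \<alpha>m - D.C1" using \<delta> C1 unfolding V by (auto simp: abs_mult)
    have V_sign: "(V1 < 0 \<longleftrightarrow> \<mu> = \<delta>) \<and> (V1 > 0 \<longleftrightarrow> \<mu> \<noteq> \<delta>)"
      using \<delta> \<mu> C1 unfolding V by (auto simp: zero_less_mult_iff mult_less_0_iff)
    obtain \<epsilon> b0 x where "0 < \<epsilon>" "\<epsilon> \<le> e" "0 < b0"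
      "\<And>b. 0 < - b \<Longrightarrow> - b < b0 \<Longrightarrow> cycle_point \<phi>p \<phi>m \<epsilon> (- 1) b (x b)"
      "position_asymptotics V1 \<alpha>p \<alpha>m rp rm (- 1) x"
      by (rule cycle_points_negative_shift[OF D.dominated_pair_axioms \<open>0 < e\<close> V_abs]) (rule that)
    with V_sign \<mu>[THEN conjunct1] show ?thesis
      by (intro exI[of _ \<epsilon>] conjI exI[of _ b0] exI[of _ x]) simp_all
  qed
  then obtain \<epsilon> b0 x where \<epsilon>: "0 < \<epsilon>" "\<epsilon> \<le> e" and b0: "0 < b0"
    and points: "\<And>b. 0 < \<mu> * b \<Longrightarrow> \<mu> * b < b0 \<Longrightarrow> cycle_point \<phi>p \<phi>m \<epsilon> \<mu> b (x b)"
    and asym: "position_asymptotics V1 \<alpha>p \<alpha>m rp rm \<mu> x"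
    and V: "V1 < 0 \<longleftrightarrow> \<mu> = \<delta>" "V1 > 0 \<longleftrightarrow> \<mu> \<noteq> \<delta>"
    by blast
  show ?thesis
    by (rule conjI[OF _ no_crossing_periodic_orbit[OF sides]],
      rule exI[of _ b0], rule conjI[OF b0], rule exI[of _ \<epsilon>], rule conjI[OF \<epsilon>(1)],
      rule exI[of _ x], rule conjI[OF _ asym[unfolded position_asymptotics_def]],
      intro allI impI, rule limit_cycle_family[OF e \<epsilon> points \<mu> V])
qed

end
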